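(* For every $n\ge1$: (1) $(\mathbb{O}_f)_f$, $f$ ranging over blue-packed forests of size $n$, is a basis of $\mathbf{WQSym}_n$; (2) $(\mathbb{O}_t)_t$, $t$ ranging over blue-packed trees of size $n$, is a basis of $\mathrm{Prim}_n$; (3) $(\mathbb{O}_t)_t$, $t$ ranging over blue-packed trees of size $n$ whose root has an empty left forest, is a basis of $\mathrm{TPrim}_n$.
   Context: Words are finite words over the positive integers; $|w|$ length, $\max(w)$ largest letter ($\max(\varepsilon)=0$). A word is packed if every integer $1,\dots,\max(w)$ occurs; $\mathrm{PW}_n$ packed words of length $n$; $\mathrm{pack}(w)$ replaces the $j$-th smallest distinct letter by $j$; $u|_{\le i}$, $u|_{>i}$ are the subwords of letters $\le i$, $>i$. For $w\in\mathrm{PW}$: for $1\le i\le\max(w)+1$, $\psi_{i^\circ}(w)$ is obtained by adding $1$ to every letter $\ge i$ of $w$ and then appending the letter $i$; for $1\le i\le\max(w)$, $\psi_{i^\bullet}(w)=w\cdot i$. $\mathbf{WQSym}_n$ has basis $(\mathbb{Q}_w)_{w\in\mathrm{PW}_n}$, $(\mathbf{WQSym})_+=\bigoplus_{n\ge1}\mathbf{WQSym}_n$. For nonempty packed $u,v$: $\mathbb{Q}_u\prec\mathbb{Q}_v=\sum\mathbb{Q}_{u'v'}$ over pairs of words $u',v'$ with $\mathrm{pack}(u')=u$, $\mathrm{pack}(v')=v$, $u'v'$ packed, no letter common to $u'$ and $v'$, and $\max(u')>\max(v')$; $\mathbb{Q}_u\succ\mathbb{Q}_v$ is the same sum with $\max(u')<\max(v')$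 (bilinear extension). For $u=u_1\cdots u_n$: $\Delta_\prec(\mathbb{Q}_u)=\sum_{i=u_n}^{\max(u)-1}\mathbb{Q}_{u|_{\le i}}\otimes\mathbb{Q}_{\mathrm{pack}(u|_{>i})}$, $\Delta_\succ(\mathbb{Q}_u)=\sum_{i=1}^{u_n-1}\mathbb{Q}_{u|_{\le i}}\otimes\mathbb{Q}_{\mathrm{pack}(u|_{>i})}$. $\mathrm{Prim}_n=\mathbf{WQSym}_n\cap\ker(\Delta_\prec+\Delta_\succ)$, $\mathrm{TPrim}_n=\mathbf{WQSym}_n\cap\ker\Delta_\prec\cap\ker\Delta_\succ$. The linear map $\Psi_{i^\alpha}$ sends $\mathbb{Q}_w$ to $\mathbb{Q}_{\psi_{i^\circ}(w)}$ if $\alpha=\circ$ and $1\le i\le\max(w)+1$, to $\mathbb{Q}_{\psi_{i^\bullet}(w)}$ if $\alpha=\bullet$ and $1\le i\le\max(w)$, and to $0$ otherwise. Brace brackets: for $n\ge2$, $\langle p_1,\dots,p_{n-1};p_n\rangle=\sum_{i=0}^{n-1}(-1)^{n-1-i}(p_1\prec(p_2\prec(\cdots\prec p_i)\cdots))\succ p_n\prec((\cdots(p_{i+1}\succ p_{i+2})\succ\cdots)\succ p_{n-1})$, where for $i=0$ the left factor and "$\succ$" are omitted and for $i=n-1$ the right factor and "$\prec$" are omitted. Biplane trees: recursively $\mathrm{Node}(x,f_\ell,f_r)$, root label $x$, ordered possibly empty lists $f_\ell,f_r$ of trees; forests are ordered lists of trees. Blue-packed trees are labeled $i^\alpha$,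 $i$ a positive integer, $\alpha\in\{\circ,\bullet\}$; weight $\omega$ = number of nodes with $\alpha=\circ$; size = number of nodes. $\mathrm{Node}(i^\alpha,[\ell_1..\ell_g],[r_1..r_d])$ is blue-packed if all children are blue-packed and either ($d=0$, $i^\alpha=1^\circ$) or ($d=1$, $i^\alpha\ne1^\circ$, $1\le i\le\omega(r_1)$). Blue-packed forest: list of blue-packed trees. Definition of $\mathbb{O}$: $\mathbb{O}_{[]}=\mathbb{Q}_\varepsilon$; $\mathbb{O}_{[t_1,\dots,t_k]}=\mathbb{O}_{t_k}\prec(\mathbb{O}_{t_{k-1}}\prec(\cdots\prec\mathbb{O}_{t_1})\cdots)$ for $k\ge1$; $\mathbb{O}_{\mathrm{Node}(i^\alpha,[],f_r)}=\Psi_{i^\alpha}(\mathbb{O}_{f_r})$; and for $g\ge1$, $\mathbb{O}_{\mathrm{Node}(i^\alpha,[\ell_1,\dots,\ell_g],f_r)}=\langle\mathbb{O}_{\ell_1},\dots,\mathbb{O}_{\ell_g};\mathbb{O}_{\mathrm{Node}(i^\alpha,[],f_r)}\rangle$. *)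

theory Defs
  imports Complex_Main "HOL-Library.Poly_Mapping"
begin

section \<open>Free vector spaces\<close>

text \<open>The free \<open>'k\<close>-vector space on \<open>'b\<close> is the type \<open>'b \<Rightarrow>\<^sub>0 'k\<close> of finitely supported functions.\<close>

definition fscale :: "'k::field \<Rightarrow> ('b \<Rightarrow>\<^sub>0 'k) \<Rightarrow> ('b \<Rightarrow>\<^sub>0 'k)" where
  "fscale c x = Poly_Mapping.map ((*) c) x"

lemma lookup_fscale [simp]: "Poly_Mapping.lookup (fscale c x) b = c * Poly_Mapping.lookup x b"
  by (simp add: fscale_def Poly_Mapping.map.rep_eq when_def)

global_interpretation free: vector_space fscale
  by unfold_locales (rule poly_mapping_eqI, simp add: lookup_add algebra_simps)+

definition is_basis_family :: "('i \<Rightarrow> ('b \<Rightarrow>\<^sub>0 'k::field)) \<Rightarrow> 'i set \<Rightarrow> ('b \<Rightarrow>\<^sub>0 'k) set \<Rightarrow> bool" where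
  "is_basis_family e I V \<longleftrightarrow>
     inj_on e I \<and> free.independent (e ` I) \<and> free.span (e ` I) = V"

definition lin_ext :: "('a \<Rightarrow> ('b \<Rightarrow>\<^sub>0 'k::field)) \<Rightarrow> ('a \<Rightarrow>\<^sub>0 'k) \<Rightarrow> ('b \<Rightarrow>\<^sub>0 'k)" where
  "lin_ext f x = (\<Sum>a\<in>Poly_Mapping.keys x. fscale (Poly_Mapping.lookup x a) (f a))"

definition bilin_ext ::
  "('a \<Rightarrow> 'a \<Rightarrow> ('b \<Rightarrow>\<^sub>0 'k::field)) \<Rightarrow> ('a \<Rightarrow>\<^sub>0 'k) \<Rightarrow> ('a \<Rightarrow>\<^sub>0 'k) \<Rightarrow> ('b \<Rightarrow>\<^sub>0 'k)" where
  "bilin_ext f x y = lin_ext (\<lambda>a. lin_ext (\<lambda>b. f a b) y) x"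


section \<open>Packed words\<close>

type_synonym word = "nat list"

definition wmax :: "word \<Rightarrow> nat" where
  "wmax w = Max (insert 0 (set w))"

definition packed :: "word \<Rightarrow> bool" where
  "packed w \<longleftrightarrow> set w = {1..wmax w}"

definition PW :: "nat \<Rightarrow> word set" where
  "PW n = {w. packed w \<and> length w = n}"

definition pack :: "word \<Rightarrow> word" where
  "pack w = map (\<lambda>a. card {b \<in> set w. b \<le> a}) w"

definition psi_circ :: "nat \<Rightarrow> word \<Rightarrow> word" where
  "psi_circ i w = map (\<lambda>a. if i \<le> a then a + 1 else a) w @ [i]"

definition psi_bullet :: "nat \<Rightarrow> word \<Rightarrow> word" where
  "psi_bullet i w = w @ [i]"


section \<open>The algebra of word quasi-symmetric functions\<close>

text \<open>Elements are finitely supported functions on all words; the homogeneous components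
  are cut out by requiring the support to consist of packed words. The tensor square is
  represented by its basis of pairs of words.\<close>

abbreviation \<QQ> :: "'b \<Rightarrow> ('b \<Rightarrow>\<^sub>0 'k::field)" where
  "\<QQ> w \<equiv> Poly_Mapping.single w 1"

definition WQSym :: "nat \<Rightarrow> (word \<Rightarrow>\<^sub>0 'k::field) set" where
  "WQSym n = {x. Poly_Mapping.keys x \<subseteq> PW n}"

definition split_words :: "word \<Rightarrow> word \<Rightarrow> (word \<times> word) set" where
  "split_words u v = {(u', v'). pack u' = u \<and> pack v' = v \<and> packed (u' @ v') \<and> set u' \<inter> set v' = {}}"

text \<open>The half products are only meaningful for nonempty packed words, and the half
  coproducts in positive degree; the values elsewhere are never used.\<close>

definition prec :: "(word \<Rightarrow>\<^sub>0 'k::field) \<Rightarrow> (word \<Rightarrow>\<^sub>0 'k) \<Rightarrow> (word \<Rightarrow>\<^sub>0 'k)" (infix \<open>\<prec>\<close> 70) where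
  "x \<prec> y = bilin_ext (\<lambda>u v. \<Sum>(u', v') \<in> {(u', v') \<in> split_words u v. wmax u' > wmax v'}. \<QQ> (u' @ v')) x y"

definition succ :: "(word \<Rightarrow>\<^sub>0 'k::field) \<Rightarrow> (word \<Rightarrow>\<^sub>0 'k) \<Rightarrow> (word \<Rightarrow>\<^sub>0 'k)" (infix \<open>\<succ>\<close> 70) where
  "x \<succ> y = bilin_ext (\<lambda>u v. \<Sum>(u', v') \<in> {(u', v') \<in> split_words u v. wmax u' < wmax v'}. \<QQ> (u' @ v')) x y"

definition cut :: "word \<Rightarrow> nat \<Rightarrow> word \<times> word" where
  "cut u i = (filter (\<lambda>a. a \<le> i) u, pack (filter (\<lambda>a. a > i) u))"

definition Delta_prec :: "(word \<Rightarrow>\<^sub>0 'k::field) \<Rightarrow> (word \<times> word \<Rightarrow>\<^sub>0 'k)" where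
  "Delta_prec = lin_ext (\<lambda>u. if u = [] then 0 else \<Sum>i\<in>{last u..<wmax u}. \<QQ> (cut u i))"

definition Delta_succ :: "(word \<Rightarrow>\<^sub>0 'k::field) \<Rightarrow> (word \<times> word \<Rightarrow>\<^sub>0 'k)" where
  "Delta_succ = lin_ext (\<lambda>u. if u = [] then 0 else \<Sum>i\<in>{1..<last u}. \<QQ> (cut u i))"

definition Prim :: "nat \<Rightarrow> (word \<Rightarrow>\<^sub>0 'k::field) set" where
  "Prim n = {x \<in> WQSym n. Delta_prec x + Delta_succ x = 0}"

definition TPrim :: "nat \<Rightarrow> (word \<Rightarrow>\<^sub>0 'k::field) set" where
  "TPrim n = {x \<in> WQSym n. Delta_prec x = 0 \<and> Delta_succ x = 0}"

datatype colour = Circ | Bullet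

type_synonym label = "nat \<times> colour"

definition Psi :: "label \<Rightarrow> (word \<Rightarrow>\<^sub>0 'k::field) \<Rightarrow> (word \<Rightarrow>\<^sub>0 'k)" where
  "Psi x = (case x of (i, \<alpha>) \<Rightarrow> lin_ext (\<lambda>w.
     if \<alpha> = Circ \<and> 1 \<le> i \<and> i \<le> wmax w + 1 then \<QQ> (psi_circ i w)
     else if \<alpha> = Bullet \<and> 1 \<le> i \<and> i \<le> wmax w then \<QQ> (psi_bullet i w)
     else 0))"

text \<open>\<open>prec_comb [p\<^sub>1, \<dots>, p\<^sub>k] = p\<^sub>1 \<prec> (p\<^sub>2 \<prec> (\<dots> \<prec> p\<^sub>k))\<close> and
  \<open>succ_comb [p\<^sub>1, \<dots>, p\<^sub>k] = ((p\<^sub>1 \<succ> p\<^sub>2) \<succ> \<dots>) \<succ> p\<^sub>k\<close>.\<close>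

fun prec_comb :: "(word \<Rightarrow>\<^sub>0 'k::field) list \<Rightarrow> (word \<Rightarrow>\<^sub>0 'k)" where
  "prec_comb [] = \<QQ> []"
| "prec_comb [p] = p"
| "prec_comb (p # q # ps) = p \<prec> prec_comb (q # ps)"

definition succ_comb :: "(word \<Rightarrow>\<^sub>0 'k::field) list \<Rightarrow> (word \<Rightarrow>\<^sub>0 'k)" where
  "succ_comb ps = foldl (\<succ>) (hd ps) (tl ps)"

text \<open>\<open>brace [p\<^sub>1, \<dots>, p\<^sub>m] p\<close> is the bracket \<open>\<langle>p\<^sub>1, \<dots>, p\<^sub>m; p\<rangle>\<close>. The summand \<open>a \<succ> p \<prec> b\<close> is read as
  \<open>(a \<succ> p) \<prec> b\<close>, which is also \<open>a \<succ> (p \<prec> b)\<close> by the dendriform axioms.\<close>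

definition brace :: "(word \<Rightarrow>\<^sub>0 'k::field) list \<Rightarrow> (word \<Rightarrow>\<^sub>0 'k) \<Rightarrow> (word \<Rightarrow>\<^sub>0 'k)" where
  "brace ps p = (\<Sum>i=0..length ps. fscale ((-1) ^ (length ps - i))
     (let q = (if i = 0 then p else prec_comb (take i ps) \<succ> p)
      in if i = length ps then q else q \<prec> succ_comb (drop i ps)))"


section \<open>Biplane trees\<close>

datatype 'a biplane = Node 'a (left_forest: "'a biplane list") (right_forest: "'a biplane list")

fun nodes :: "'a biplane \<Rightarrow> nat" where
  "nodes (Node x ls rs) = 1 + sum_list (map nodes ls) + sum_list (map nodes rs)"

definition forest_nodes :: "'a biplane list \<Rightarrow> nat" where
  "forest_nodes f = sum_list (map nodes f)"

fun weight :: "label biplane \<Rightarrow> nat" where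
  "weight (Node (i, \<alpha>) ls rs) =
     (if \<alpha> = Circ then 1 else 0) + sum_list (map weight ls) + sum_list (map weight rs)"

fun blue_packed :: "label biplane \<Rightarrow> bool" where
  "blue_packed (Node (i, \<alpha>) ls rs) \<longleftrightarrow>
     (\<forall>t\<in>set ls. blue_packed t) \<and> (\<forall>t\<in>set rs. blue_packed t) \<and>
     ((rs = [] \<and> (i, \<alpha>) = (1, Circ)) \<or>
      (\<exists>r. rs = [r] \<and> (i, \<alpha>) \<noteq> (1, Circ) \<and> 1 \<le> i \<and> i \<le> weight r))"

definition blue_packed_forest :: "label biplane list \<Rightarrow> bool" where
  "blue_packed_forest f \<longleftrightarrow> (\<forall>t\<in>set f. blue_packed t)"

fun \<OO>_tree :: "label biplane \<Rightarrow> (word \<Rightarrow>\<^sub>0 'k::field)" where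
  "\<OO>_tree (Node x ls rs) =
     (let p = Psi x (prec_comb (rev (map \<OO>_tree rs)))
      in if ls = [] then p else brace (map \<OO>_tree ls) p)"

definition \<OO>_forest :: "label biplane list \<Rightarrow> (word \<Rightarrow>\<^sub>0 'k::field)" where
  "\<OO>_forest f = prec_comb (rev (map \<OO>_tree f))"

lemma \<OO>_tree_Node:
  "\<OO>_tree (Node x [] rs) = Psi x (\<OO>_forest rs)"
  "ls \<noteq> [] \<Longrightarrow> \<OO>_tree (Node x ls rs) = brace (map \<OO>_tree ls) (\<OO>_tree (Node x [] rs))"
  by (simp_all add: \<OO>_forest_def)

end

theory Submission
  imports Defs
begin

text \<open>An element \<open>x\<close> is replaced by the function \<open>hat x\<close> on all words sending \<open>w\<close> to the coefficient of \<open>x\<close> at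
  \<open>pack w\<close>. The half products become sums over the ways of cutting \<open>w\<close> into two words without
  common letters, and the coproduct becomes the sum of the function over all shuffles of a word in small
  letters with a word in large letters; neither involves packing any more.

  Trees are primitive: the alternating sum in a brace is an antipode identity. Labels other than
  \<open>1\<^sup>\<circ>\<close> and those exceeding the weight turn primitive into totally primitive elements. The coproduct of a forest is
  deconcatenation, so a linear relation involves only single trees. On a tree with nonempty left forest
  \<open>l\<close> and remaining root part \<open>r\<close>, the part \<open>\<Delta>\<^sub>\<succ>\<close> has leading term \<open>O(rev l) \<otimes> O(r)\<close>, the right
  factor having least degree, so only trees without left forest survive; these are
  separated by the last letter of words. Both packed words and forests of size \<open>n + 1\<close> and weight
  \<open>m\<close> are counted by \<open>c(n + 1, m) = m c(n, m - 1) + m c(n, m)\<close> (for forests an inequality suffices),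
  whence independent families span.\<close>


section \<open>Splittings of lists\<close>

text \<open>Factors of a packed word, and its letters above a cut, are in general not packed, so
  identities with three factors would compare nested packings. Functions invariant under increasing
  relabelling need no such bookkeeping; the price is that they live on all words, including those
  that contain the letter 0. The unit \<open>empty_ind\<close> is two-sided for neither half
  product, but its one-sided laws absorb the boundary summands of a brace.

  Everything about the coproduct rests on one observation: if the high word is nonempty, the maximum
  of a shuffle is a high letter, so the comparison that decides between the half products sees high
  letters only. A primitive factor that contains the maximum is then entirely high.

  Coefficients are shown to vanish from the vanishing of a coproduct, not of the combination itself.
  The same lemmas \<open>forest_coeffs\<close> and \<open>tree_coeffs\<close> therefore yield linear
  independence and also show that primitive elements are combinations of trees, and totally
  primitive ones combinations of trees without left forest.\<close>

definition splits :: "'a list \<Rightarrow> ('a list \<times> 'a list) set" where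
  "splits w = {(u, v). u @ v = w}"

text \<open>A common index set for both nestings of a threefold product, so that associativity laws
  can be compared summand by summand.\<close>

definition splits3 :: "'a list \<Rightarrow> ('a list \<times> 'a list \<times> 'a list) set" where
  "splits3 w = {(x, y, z). x @ y @ z = w}"

lemma in_splits [simp]: "(u, v) \<in> splits w \<longleftrightarrow> u @ v = w"
  by (simp add: splits_def)

lemma splits_Nil [simp]: "splits [] = {([], [])}"
  by (auto simp: splits_def)

lemma splits_Cons: "splits (x # w) = insert ([], x # w) ((\<lambda>(u, v). (x # u, v)) ` splits w)"
  by (auto simp: splits_def append_eq_Cons_conv image_iff)

lemma splits_snoc: "splits (w @ [x]) = insert (w @ [x], []) ((\<lambda>(u, v). (u, v @ [x])) ` splits w)"
proof (intro set_eqI iffI)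
  fix p assume "p \<in> splits (w @ [x])"
  then show "p \<in> insert (w @ [x], []) ((\<lambda>(u, v). (u, v @ [x])) ` splits w)"
    by (cases p; cases "snd p" rule: rev_cases) (auto simp: splits_def image_iff)
qed (auto simp: splits_def)

lemma finite_splits [simp]: "finite (splits w)"
  by (induction w) (simp_all add: splits_Cons)

lemma sum_splits_Cons:
  "(\<Sum>(u, v)\<in>splits (x # w). F u v) = F [] (x # w) + (\<Sum>(u, v)\<in>splits w. F (x # u) v)"
proof -
  have "inj_on (\<lambda>(u, v). (x # u, v)) (splits w)"
    by (auto simp: inj_on_def)
  then show ?thesis
    by (subst splits_Cons, subst sum.insert) (auto simp: sum.reindex case_prod_unfold)
qed

lemma sum_splits_snoc:
  "(\<Sum>(u, v)\<in>splits (w @ [x]). F u v) = F (w @ [x]) [] + (\<Sum>(u, v)\<in>splits w. F u (v @ [x]))"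
proof -
  have "inj_on (\<lambda>(u, v). (u, v @ [x])) (splits w)"
    by (auto simp: inj_on_def)
  then show ?thesis
    by (subst splits_snoc, subst sum.insert) (auto simp: sum.reindex case_prod_unfold)
qed

lemma sum_splits_left:
  "(\<Sum>(u, z)\<in>splits w. \<Sum>(x, y)\<in>splits u. F x y z) = (\<Sum>(x, y, z)\<in>splits3 w. F x y z)"
proof -
  have "(\<Sum>(u, z)\<in>splits w. \<Sum>(x, y)\<in>splits u. F x y z)
      = (\<Sum>p\<in>splits w. \<Sum>q\<in>splits (fst p). F (fst q) (snd q) (snd p))"
    by (simp add: case_prod_unfold)
  also have "\<dots> = (\<Sum>(p, q)\<in>(SIGMA p:splits w. splits (fst p)). F (fst q) (snd q) (snd p))"
    by (subst sum.Sigma) auto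
  also have "\<dots> = (\<Sum>(x, y, z)\<in>splits3 w. F x y z)"
    by (rule sum.reindex_bij_witness[where i = "\<lambda>(x, y, z). ((x @ y, z), (x, y))" and
          j = "\<lambda>((u, z), (x, y)). (x, y, z)"]) (auto simp: splits3_def splits_def)
  finally show ?thesis .
qed

lemma sum_splits_right:
  "(\<Sum>(x, u)\<in>splits w. \<Sum>(y, z)\<in>splits u. F x y z) = (\<Sum>(x, y, z)\<in>splits3 w. F x y z)"
proof -
  have "(\<Sum>(x, u)\<in>splits w. \<Sum>(y, z)\<in>splits u. F x y z)
      = (\<Sum>p\<in>splits w. \<Sum>q\<in>splits (snd p). F (fst p) (fst q) (snd q))"
    by (simp add: case_prod_unfold)
  also have "\<dots> = (\<Sum>(p, q)\<in>(SIGMA p:splits w. splits (snd p)). F (fst p) (fst q) (snd q))"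
    by (subst sum.Sigma) auto
  also have "\<dots> = (\<Sum>(x, y, z)\<in>splits3 w. F x y z)"
    by (rule sum.reindex_bij_witness[where i = "\<lambda>(x, y, z). ((x, y @ z), (y, z))" and
          j = "\<lambda>((x, u), (y, z)). (x, y, z)"]) (auto simp: splits3_def splits_def)
  finally show ?thesis .
qed


section \<open>Half products of functions on words\<close>

text \<open>For words without the letter 0 this is \<open>wmax v < wmax u\<close>. Avoiding
  \<open>wmax\<close> makes it invariant under increasing relabelling even when 0 occurs:
  \<open>[0]\<close> dominates the empty word although both have \<open>wmax\<close> equal to
  0.\<close>

definition dominates :: "word \<Rightarrow> word \<Rightarrow> bool" where
  "dominates u v \<longleftrightarrow> (\<exists>x\<in>set u. \<forall>y\<in>set v. y < x)"

text \<open>The relation is a parameter so that the two half products and the full product share one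
  set of bilinearity and nesting lemmas.\<close>

definition conv :: "(word \<Rightarrow> word \<Rightarrow> bool) \<Rightarrow> (word \<Rightarrow> 'k::field) \<Rightarrow> (word \<Rightarrow> 'k) \<Rightarrow> word \<Rightarrow> 'k" where
  "conv R f g w =
     (\<Sum>(u, v)\<in>splits w. of_bool (set u \<inter> set v = {} \<and> R u v) * (f u * g v))"

abbreviation lprod :: "(word \<Rightarrow> 'k::field) \<Rightarrow> (word \<Rightarrow> 'k) \<Rightarrow> word \<Rightarrow> 'k" (infixr \<open>\<lhd>\<close> 72) where
  "f \<lhd> g \<equiv> conv dominates f g"

abbreviation rprod :: "(word \<Rightarrow> 'k::field) \<Rightarrow> (word \<Rightarrow> 'k) \<Rightarrow> word \<Rightarrow> 'k" (infixl \<open>\<rhd>\<close> 72) where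
  "f \<rhd> g \<equiv> conv (\<lambda>u v. dominates v u) f g"

abbreviation fprod :: "(word \<Rightarrow> 'k::field) \<Rightarrow> (word \<Rightarrow> 'k) \<Rightarrow> word \<Rightarrow> 'k" (infixl \<open>\<odot>\<close> 72) where
  "f \<odot> g \<equiv> conv (\<lambda>u v. True) f g"

definition empty_ind :: "word \<Rightarrow> 'k::field" where
  "empty_ind w = (if w = [] then 1 else 0)"

lemma empty_ind_simps [simp]: "empty_ind [] = 1" "w \<noteq> [] \<Longrightarrow> empty_ind w = 0"
  by (simp_all add: empty_ind_def)

lemma dominates_Nil [simp]: "\<not> dominates [] v" "dominates u [] \<longleftrightarrow> u \<noteq> []"
  by (simp_all add: dominates_def ex_in_conv)

text \<open>Without common letters, the maximum of \<open>u @ v\<close> belongs to exactly one of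
  the two words, and dominating means owning it.\<close>

lemma dominates_total:
  assumes "set u \<inter> set v = {}" "u @ v \<noteq> []"
  shows "dominates v u \<longleftrightarrow> \<not> dominates u v"
proof -
  let ?M = "Max (set (u @ v))"
  have M: "?M \<in> set (u @ v)" "\<And>x. x \<in> set (u @ v) \<Longrightarrow> x \<le> ?M"
    using assms(2) by (auto simp del: set_append intro: Max_in)
  have "dominates p q \<longleftrightarrow> ?M \<in> set p" if "set p \<union> set q = set (u @ v)" "set p \<inter> set q = {}" for p q
  proof
    assume "dominates p q"
    then obtain x where x: "x \<in> set p" "\<forall>y\<in>set q. y < x"
      by (auto simp: dominates_def)
    then have "x \<le> ?M"
      using M that by blast
    then have "?M \<notin> set q"
      using x by force
    then show "?M \<in> set p"
      using M(1) that by blast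
  next
    assume "?M \<in> set p"
    moreover have "y < ?M" if "y \<in> set q" for y
    proof -
      have "y \<noteq> ?M"
        using \<open>?M \<in> set p\<close> \<open>set p \<inter> set q = {}\<close> that by blast
      moreover have "y \<le> ?M"
        using M(2) that \<open>set p \<union> set q = set (u @ v)\<close> by blast
      ultimately show ?thesis
        by simp
    qed
    ultimately show "dominates p q"
      by (auto simp: dominates_def)
  qed
  from this[of u v] this[of v u] show ?thesis
    using M(1) assms(1) by (auto simp: Un_commute Int_commute)
qed

lemma conv_Nil_half [simp]: "(f \<lhd> g) [] = 0" "(f \<rhd> g) [] = 0"
  by (simp_all add: conv_def)

lemma conv_sum_left:
  "conv R (\<lambda>w. \<Sum>i\<in>I. F i w) g w = (\<Sum>i\<in>I. conv R (F i) g w)"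
  unfolding conv_def
  by (subst sum.swap) (simp add: sum_distrib_right sum_distrib_left case_prod_unfold)

lemma conv_sum_right:
  "conv R f (\<lambda>w. \<Sum>i\<in>I. G i w) w = (\<Sum>i\<in>I. conv R f (G i) w)"
  unfolding conv_def
  by (subst sum.swap) (simp add: sum_distrib_left case_prod_unfold)

lemma conv_scale_left: "conv R (\<lambda>w. c * f w) g w = c * conv R f g w"
  unfolding conv_def by (simp add: sum_distrib_left case_prod_unfold mult_ac)

lemma conv_scale_right: "conv R f (\<lambda>w. c * g w) w = c * conv R f g w"
  unfolding conv_def by (simp add: sum_distrib_left case_prod_unfold mult_ac)

lemma conv_zero [simp]: "conv R (\<lambda>w. 0) g w = 0" "conv R f (\<lambda>w. 0) w = 0"
  unfolding conv_def by (simp_all add: case_prod_unfold)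

text \<open>The third summand is the value at the empty word, where both half products
  vanish.\<close>

lemma fprod_eq: "(f \<odot> g) w = (f \<lhd> g) w + (f \<rhd> g) w + f [] * g [] * empty_ind w"
proof (cases "w = []")
  case True
  then show ?thesis by (simp add: conv_def)
next
  case False
  then have "(f \<odot> g) w = (f \<lhd> g) w + (f \<rhd> g) w"
    unfolding conv_def sum.distrib[symmetric]
    by (intro sum.cong refl) (auto simp: dominates_total)
  then show ?thesis using False by simp
qed

text \<open>The empty word dominates nothing and is dominated by every nonempty word. Hence two of
  the four half products with the unit vanish, and the other two are the identity away from the
  empty word.\<close>

lemma empty_ind_lprod [simp]: "(empty_ind \<lhd> g) w = 0"
  unfolding conv_def by (rule sum.neutral) (auto simp: empty_ind_def)

lemma rprod_empty_ind [simp]: "(f \<rhd> empty_ind) w = 0"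
  unfolding conv_def by (rule sum.neutral) (auto simp: empty_ind_def)

lemma lprod_empty_ind: "(f \<lhd> empty_ind) w = (if w = [] then 0 else f w)"
proof -
  have "(f \<lhd> empty_ind) w = (\<Sum>p\<in>splits w. if p = (w, []) then (if w = [] then 0 else f w) else 0)"
    unfolding conv_def
    by (rule sum.cong) (simp_all add: empty_ind_def case_prod_unfold prod_eq_iff, auto)
  then show ?thesis by simp
qed

lemma empty_ind_rprod: "(empty_ind \<rhd> f) w = (if w = [] then 0 else f w)"
proof -
  have "(empty_ind \<rhd> f) w = (\<Sum>p\<in>splits w. if p = ([], w) then (if w = [] then 0 else f w) else 0)"
    unfolding conv_def
    by (rule sum.cong) (simp_all add: empty_ind_def case_prod_unfold prod_eq_iff, auto)
  then show ?thesis by simp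
qed

lemma conv_conv_left:
  "conv R (conv S f g) h w = (\<Sum>(x, y, z)\<in>splits3 w.
     of_bool (set x \<inter> set y = {} \<and> (set x \<union> set y) \<inter> set z = {} \<and> R (x @ y) z \<and> S x y)
       * (f x * g y * h z))"
proof -
  have "conv R (conv S f g) h w = (\<Sum>(u, z)\<in>splits w. \<Sum>(x, y)\<in>splits u.
     of_bool (set x \<inter> set y = {} \<and> (set x \<union> set y) \<inter> set z = {} \<and> R (x @ y) z \<and> S x y)
       * (f x * g y * h z))"
    unfolding conv_def sum_distrib_left sum_distrib_right case_prod_unfold
    by (intro sum.cong refl) (auto simp: of_bool_conj mult_ac simp flip: set_append)
  then show ?thesis by (simp add: sum_splits_left)
qed

lemma conv_conv_right:
  "conv R f (conv S g h) w = (\<Sum>(x, y, z)\<in>splits3 w.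
     of_bool (set y \<inter> set z = {} \<and> set x \<inter> (set y \<union> set z) = {} \<and> R x (y @ z) \<and> S y z)
       * (f x * g y * h z))"
proof -
  have "conv R f (conv S g h) w = (\<Sum>(x, u)\<in>splits w. \<Sum>(y, z)\<in>splits u.
     of_bool (set y \<inter> set z = {} \<and> set x \<inter> (set y \<union> set z) = {} \<and> R x (y @ z) \<and> S y z)
       * (f x * g y * h z))"
    unfolding conv_def sum_distrib_left sum_distrib_right case_prod_unfold
    by (intro sum.cong refl) (auto simp: of_bool_conj mult_ac simp flip: set_append)
  then show ?thesis by (simp add: sum_splits_right)
qed

lemma dominates_append_right: "dominates x (y @ z) \<longleftrightarrow> dominates x y \<and> dominates x z"
proof
  assume "dominates x y \<and> dominates x z"
  then obtain a b where ab: "a \<in> set x" "\<forall>c\<in>set y. c < a" "b \<in> set x" "\<forall>c\<in>set z. c < b"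
    by (auto simp: dominates_def)
  then have "max a b \<in> set x" "\<forall>c\<in>set (y @ z). c < max a b"
    by (auto simp: max_def)
  then show "dominates x (y @ z)"
    unfolding dominates_def by blast
qed (auto simp: dominates_def)

lemma dominates_append_left: "dominates (x @ y) z \<longleftrightarrow> dominates x z \<or> dominates y z"
  unfolding dominates_def by auto

lemma dominates_trans: "dominates x y \<Longrightarrow> dominates y z \<Longrightarrow> dominates x z"
  unfolding dominates_def by (meson less_trans)

text \<open>A dendriform axiom: both sides select the factorizations \<open>x @ y @ z\<close> whose
  maximum lies in \<open>x\<close>, with no condition between \<open>y\<close> and
  \<open>z\<close>.\<close>

lemma lprod_lprod: "((f \<lhd> g) \<lhd> h) w = (f \<lhd> (g \<odot> h)) w"
proof -
  have "dominates (x @ y) z \<and> dominates x y \<longleftrightarrow> dominates x (y @ z)" for x y z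
    using dominates_trans by (auto simp: dominates_append_left dominates_append_right)
  then show ?thesis
    unfolding conv_conv_left conv_conv_right by (intro sum.cong) auto
qed

text \<open>The mirror axiom: the maximum lies in the last factor.\<close>

lemma rprod_rprod: "((f \<odot> g) \<rhd> h) w = (f \<rhd> (g \<rhd> h)) w"
proof -
  have "dominates (y @ z) x \<and> dominates z y \<longleftrightarrow> dominates z (x @ y)" for x y z
    using dominates_trans by (auto simp: dominates_append_left dominates_append_right)
  then show ?thesis
    unfolding conv_conv_left conv_conv_right by (intro sum.cong) auto
qed

section \<open>Iterated half products and the antipode identity\<close>

fun prec_fold :: "(word \<Rightarrow> 'k::field) list \<Rightarrow> word \<Rightarrow> 'k" where
  "prec_fold [] = empty_ind"
| "prec_fold (p # ps) = p \<lhd> prec_fold ps"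

definition succ_fold :: "(word \<Rightarrow> 'k::field) list \<Rightarrow> word \<Rightarrow> 'k" where
  "succ_fold = foldl (\<rhd>) empty_ind"

lemma succ_fold_simps [simp]:
  "succ_fold [] = empty_ind" "succ_fold (ps @ [p]) = succ_fold ps \<rhd> p"
  by (simp_all add: succ_fold_def)

lemma prec_fold_Nil: "ps \<noteq> [] \<Longrightarrow> prec_fold ps [] = 0"
  by (cases ps) auto

lemma succ_fold_Nil: "ps \<noteq> [] \<Longrightarrow> succ_fold ps [] = 0"
  by (cases ps rule: rev_cases) auto

text \<open>On nonempty words \<open>empty_ind \<rhd> p\<close> is \<open>p\<close> and
  \<open>f \<lhd> empty_ind\<close> is \<open>f\<close>, so the first and last summands of a brace
  are instances of the general one.\<close>

definition fbrace :: "(word \<Rightarrow> 'k::field) list \<Rightarrow> (word \<Rightarrow> 'k) \<Rightarrow> word \<Rightarrow> 'k" where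
  "fbrace ps p w =
     (\<Sum>(A, B)\<in>splits ps. (-1) ^ length B * ((prec_fold A \<rhd> p) \<lhd> succ_fold B) w)"

lemma conv_splits_left:
  "conv R (\<lambda>w. \<Sum>(A, B)\<in>splits ps. c A B * F A B w) g w
    = (\<Sum>(A, B)\<in>splits ps. c A B * conv R (F A B) g w)"
  using conv_sum_left[of R "\<lambda>p w. c (fst p) (snd p) * F (fst p) (snd p) w" "splits ps" g w]
  by (simp add: case_prod_unfold conv_scale_left)

lemma conv_splits_right:
  "conv R g (\<lambda>w. \<Sum>(A, B)\<in>splits ps. c A B * F A B w) w
    = (\<Sum>(A, B)\<in>splits ps. c A B * conv R g (F A B) w)"
  using conv_sum_right[of R g "\<lambda>p w. c (fst p) (snd p) * F (fst p) (snd p) w" "splits ps" w]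
  by (simp add: case_prod_unfold conv_scale_right)

text \<open>The left-nested \<open>\<rhd>\<close>-products are, up to sign, the convolution inverse of the
  right-nested \<open>\<lhd>\<close>-products.\<close>

lemma antipode:
  fixes ps :: "(word \<Rightarrow> 'k::field) list"
  shows "(\<Sum>(A, B)\<in>splits ps. (-1) ^ length B * (prec_fold A \<odot> succ_fold B) w)
    = (if ps = [] then empty_ind w else 0)"
proof (induction "length ps" arbitrary: ps w rule: less_induct)
  case less
  show ?case
  proof (cases ps)
    case Nil
    then show ?thesis
      by (simp add: fprod_eq)
  next
    case (Cons p qs)
    obtain rs r where snoc: "ps = rs @ [r]"
      using Cons by (metis list.distinct(1) rev_exhaust)
    \<comment> \<open>The summand with empty \<open>A\<close> is zero because
      \<open>empty_ind\<close> annihilates from the left. In all others the leading \<open>p\<close>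
      can be pulled out by the dendriform axiom, leaving the alternating sum for the shorter list
      \<open>qs\<close>. The other half peels off the last factor in the same way.\<close>
    have L: "(\<Sum>(A, B)\<in>splits ps. (-1) ^ length B * (prec_fold A \<lhd> succ_fold B) w)
        = (if qs = [] then (p \<lhd> empty_ind) w else 0)"
    proof -
      have "(\<Sum>(A, B)\<in>splits ps. (-1) ^ length B * (prec_fold A \<lhd> succ_fold B) w)
        = (\<Sum>(A, B)\<in>splits qs. (-1) ^ length B * (p \<lhd> (prec_fold A \<odot> succ_fold B)) w)"
        unfolding Cons sum_splits_Cons by (simp add: lprod_lprod)
      also have "\<dots> = (p \<lhd> (\<lambda>w. \<Sum>(A, B)\<in>splits qs. (-1) ^ length B * (prec_fold A \<odot> succ_fold B) w)) w"
        by (simp add: conv_splits_right)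
      also have "\<dots> = (if qs = [] then (p \<lhd> empty_ind) w else 0)"
        using less[of qs] Cons by simp
      finally show ?thesis .
    qed
    have R: "(\<Sum>(A, B)\<in>splits ps. (-1) ^ length B * (prec_fold A \<rhd> succ_fold B) w)
        = (if rs = [] then - (empty_ind \<rhd> r) w else 0)"
    proof -
      have "(\<Sum>(A, B)\<in>splits ps. (-1) ^ length B * (prec_fold A \<rhd> succ_fold B) w)
        = - (\<Sum>(A, B)\<in>splits rs. (-1) ^ length B * ((prec_fold A \<odot> succ_fold B) \<rhd> r) w)"
        unfolding snoc sum_splits_snoc by (simp add: rprod_rprod sum_negf case_prod_unfold)
      also have "\<dots> = - ((\<lambda>w. \<Sum>(A, B)\<in>splits rs. (-1) ^ length B * (prec_fold A \<odot> succ_fold B) w) \<rhd> r) w"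
        by (simp add: conv_splits_left)
      also have "\<dots> = (if rs = [] then - (empty_ind \<rhd> r) w else 0)"
        using less[of rs] snoc by simp
      finally show ?thesis .
    qed
    have Z: "prec_fold A [] * succ_fold B [] = (0 :: 'k)" if "(A, B) \<in> splits ps" for A B
      using that Cons prec_fold_Nil[of A] succ_fold_Nil[of B] by (cases "A = []") auto
    have "(\<Sum>(A, B)\<in>splits ps. (-1) ^ length B * (prec_fold A \<odot> succ_fold B) w)
       = (\<Sum>(A, B)\<in>splits ps. (-1) ^ length B * (prec_fold A \<lhd> succ_fold B) w)
       + (\<Sum>(A, B)\<in>splits ps. (-1) ^ length B * (prec_fold A \<rhd> succ_fold B) w)"
      unfolding sum.distrib[symmetric]
      by (intro sum.cong refl) (auto simp: fprod_eq Z distrib_left)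
    \<comment> \<open>Both halves vanish separately for lists of length at least two; for a single
      \<open>p\<close> they are \<open>p\<close> and \<open>- p\<close> on nonempty words and
      cancel.\<close>
    also have "\<dots> = 0"
      unfolding L R using Cons snoc
      by (cases rs) (auto simp: lprod_empty_ind empty_ind_rprod)
    finally show ?thesis using Cons by simp
  qed
qed


section \<open>The coproduct\<close>

text \<open>The interleavings of a word in letters at most \<open>i\<close> with a word in larger
  letters, described by the two subwords to which they restrict. The set is empty unless
  \<open>low i a\<close> and \<open>high i b\<close>.\<close>

definition shuf :: "nat \<Rightarrow> word \<Rightarrow> word \<Rightarrow> word set" where
  "shuf i a b = {u. filter (\<lambda>x. x \<le> i) u = a \<and> filter (\<lambda>x. i < x) u = b}"

text \<open>If \<open>i = wmax a\<close> and \<open>b\<close> is a packed word shifted up by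
  \<open>i\<close>, this is a coefficient of the coproduct. Leaving \<open>i\<close> free keeps
  shifts and packings out of the calculations.\<close>

definition cop :: "nat \<Rightarrow> (word \<Rightarrow> 'k::field) \<Rightarrow> word \<Rightarrow> word \<Rightarrow> 'k" where
  "cop i f a b = (\<Sum>u\<in>shuf i a b. f u)"

definition low :: "nat \<Rightarrow> word \<Rightarrow> bool" where
  "low i a \<longleftrightarrow> (\<forall>x\<in>set a. x \<le> i)"

definition high :: "nat \<Rightarrow> word \<Rightarrow> bool" where
  "high i b \<longleftrightarrow> (\<forall>x\<in>set b. i < x)"

lemma low_simps [simp]: "low i []" "low i (a @ b) \<longleftrightarrow> low i a \<and> low i b"
  by (auto simp: low_def)

lemma high_simps [simp]: "high i []" "high i (a @ b) \<longleftrightarrow> high i a \<and> high i b"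
  by (auto simp: high_def)

lemma set_shuf:
  assumes "u \<in> shuf i a b" shows "set u = set a \<union> set b"
proof -
  have "a = filter (\<lambda>x. x \<le> i) u" "b = filter (\<lambda>x. i < x) u"
    using assms by (auto simp: shuf_def)
  then show ?thesis by auto
qed

lemma length_shuf:
  assumes "u \<in> shuf i a b" shows "length u = length a + length b"
  using sum_length_filter_compl[of "\<lambda>x. x \<le> i" u] assms by (simp add: shuf_def not_le)

lemma finite_shuf [simp]: "finite (shuf i a b)"
  by (rule finite_subset[OF _ finite_lists_length_eq[of "set a \<union> set b" "length a + length b"]])
     (auto simp: length_shuf set_shuf)

lemma shuf_Nil_right:
  assumes "low i a" shows "shuf i a [] = {a}"
proof -
  have "filter (\<lambda>x. x \<le> i) u = u" if "filter (\<lambda>x. i < x) u = []" for u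
    using that by (auto simp: filter_empty_conv filter_id_conv)
  moreover have "filter (\<lambda>x. x \<le> i) a = a" "filter (\<lambda>x. i < x) a = []"
    using assms by (auto simp: low_def filter_empty_conv filter_id_conv)
  ultimately show ?thesis
    unfolding shuf_def by auto
qed

lemma shuf_Nil_left:
  assumes "high i b" shows "shuf i [] b = {b}"
proof -
  have "filter (\<lambda>x. i < x) u = u" if "filter (\<lambda>x. x \<le> i) u = []" for u
    using that by (auto simp: filter_empty_conv filter_id_conv)
  moreover have "filter (\<lambda>x. i < x) b = b" "filter (\<lambda>x. x \<le> i) b = []"
    using assms by (auto simp: high_def filter_empty_conv filter_id_conv)
  ultimately show ?thesis
    unfolding shuf_def by auto
qed

lemma cop_Nil [simp]: "low i a \<Longrightarrow> cop i f a [] = f a" "high i b \<Longrightarrow> cop i f [] b = f b"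
  by (simp_all add: cop_def shuf_Nil_left shuf_Nil_right)

lemma cop_empty_ind:
  "cop i empty_ind a b = empty_ind a * empty_ind b"
proof (cases "a = [] \<and> b = []")
  case True
  then show ?thesis by simp
next
  case False
  then have "[] \<notin> shuf i a b" by (auto simp: shuf_def)
  then have "cop i empty_ind a b = 0"
    unfolding cop_def by (intro sum.neutral) (auto simp: empty_ind_def)
  then show ?thesis using False by (auto simp: empty_ind_def)
qed

text \<open>Cutting a shuffle cuts both constituents, and the two pieces are shuffles of the
  corresponding pieces. This is the compatibility of coproduct and product in combinatorial
  form.\<close>

lemma sum_shuf_splits:
  "(\<Sum>u\<in>shuf i a b. \<Sum>(x, y)\<in>splits u. F x y)
   = (\<Sum>(a1, a2)\<in>splits a. \<Sum>(b1, b2)\<in>splits b. \<Sum>x\<in>shuf i a1 b1. \<Sum>y\<in>shuf i a2 b2. F x y)"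
proof -
  let ?lo = "filter (\<lambda>x. x \<le> i)" and ?hi = "filter (\<lambda>x. i < x)"
  have "(\<Sum>u\<in>shuf i a b. \<Sum>(x, y)\<in>splits u. F x y)
      = (\<Sum>(u, x, y)\<in>(SIGMA u:shuf i a b. splits u). F x y)"
    by (subst sum.Sigma) auto
  also have "\<dots> = (\<Sum>(((a1, a2), (b1, b2)), (x, y))\<in>
       (SIGMA p:splits a \<times> splits b. shuf i (fst (fst p)) (fst (snd p)) \<times> shuf i (snd (fst p)) (snd (snd p))).
       F x y)"
    by (rule sum.reindex_bij_witness[where
          j = "\<lambda>(u, x, y). (((?lo x, ?lo y), (?hi x, ?hi y)), (x, y))" and
          i = "\<lambda>(((a1, a2), (b1, b2)), (x, y)). (x @ y, x, y)"])
       (auto simp: shuf_def splits_def)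
  also have "\<dots> = (\<Sum>p\<in>splits a \<times> splits b. \<Sum>q\<in>shuf i (fst (fst p)) (fst (snd p)) \<times> shuf i (snd (fst p)) (snd (snd p)).
       F (fst q) (snd q))"
    by (subst sum.Sigma) (auto simp: case_prod_unfold)
  also have "\<dots> = (\<Sum>(a1, a2)\<in>splits a. \<Sum>(b1, b2)\<in>splits b. \<Sum>x\<in>shuf i a1 b1. \<Sum>y\<in>shuf i a2 b2. F x y)"
    by (simp only: sum.cartesian_product' case_prod_unfold fst_conv snd_conv)
  finally show ?thesis .
qed

text \<open>A low letter never equals a high one, so disjointness of the factors splits into a low
  and a high condition. The assumption that \<open>R\<close> can be read off the high parts is what
  lets the sum factorize.\<close>

lemma cop_conv:
  fixes f g :: "word \<Rightarrow> 'k::field"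
  assumes "low i a" "high i b"
    and R: "\<And>x y a1 a2 b1 b2. a1 @ a2 = a \<Longrightarrow> b1 @ b2 = b \<Longrightarrow> x \<in> shuf i a1 b1 \<Longrightarrow> y \<in> shuf i a2 b2 \<Longrightarrow>
        R x y \<longleftrightarrow> R b1 b2"
  shows "cop i (conv R f g) a b =
    (\<Sum>(a1, a2)\<in>splits a. \<Sum>(b1, b2)\<in>splits b.
       of_bool (set a1 \<inter> set a2 = {}) * (of_bool (set b1 \<inter> set b2 = {} \<and> R b1 b2)
         * (cop i f a1 b1 * cop i g a2 b2)))"
proof -
  have key: "(\<Sum>x\<in>shuf i (fst p) (fst q). \<Sum>y\<in>shuf i (snd p) (snd q).
        of_bool (set x \<inter> set y = {} \<and> R x y) * (f x * g y))
      = of_bool (set (fst p) \<inter> set (snd p) = {}) * (of_bool (set (fst q) \<inter> set (snd q) = {} \<and> R (fst q) (snd q))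
         * (cop i f (fst p) (fst q) * cop i g (snd p) (snd q)))"
    if "p \<in> splits a" "q \<in> splits b" for p q
  proof -
    obtain a1 a2 b1 b2 where pq: "p = (a1, a2)" "q = (b1, b2)"
      by (cases p, cases q) auto
    then have ab: "a1 @ a2 = a" "b1 @ b2 = b"
      using that by auto
    have *: "of_bool (set x \<inter> set y = {} \<and> R x y)
        = (of_bool (set a1 \<inter> set a2 = {}) * of_bool (set b1 \<inter> set b2 = {} \<and> R b1 b2) :: 'k)"
      if xy: "x \<in> shuf i a1 b1" "y \<in> shuf i a2 b2" for x y
    proof -
      have "set a1 \<inter> set b2 = {}" "set b1 \<inter> set a2 = {}"
        using assms(1,2) unfolding ab[symmetric] low_def high_def
        by (auto simp: disjoint_iff dest: leD)
      then have "set x \<inter> set y = {} \<longleftrightarrow> set a1 \<inter> set a2 = {} \<and> set b1 \<inter> set b2 = {}"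
        unfolding set_shuf[OF xy(1)] set_shuf[OF xy(2)] by blast
      then show ?thesis
        using R[OF ab xy] by (simp add: of_bool_conj)
    qed
    have prod: "cop i f a1 b1 * cop i g a2 b2 = (\<Sum>x\<in>shuf i a1 b1. \<Sum>y\<in>shuf i a2 b2. f x * g y)"
      by (simp add: cop_def sum_product)
    show ?thesis
      unfolding pq fst_conv snd_conv
      by (simp only: * prod sum_distrib_left mult.assoc cong: sum.cong)
  qed
  show ?thesis
    unfolding cop_def[of i "conv R f g"] conv_def sum_shuf_splits unfolding case_prod_unfold
    by (intro sum.cong refl key)
qed

text \<open>A high letter exists, so the overall maximum is high, whichever factor contains it. If
  both high parts were empty, the low letters would decide instead.\<close>

lemma dominates_shuf:
  assumes "low i (a1 @ a2)" "high i (b1 @ b2)" "b1 @ b2 \<noteq> []"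
    and "x \<in> shuf i a1 b1" "y \<in> shuf i a2 b2"
  shows "dominates x y \<longleftrightarrow> dominates b1 b2"
proof -
  have s: "set x = set a1 \<union> set b1" "set y = set a2 \<union> set b2"
    using assms set_shuf by auto
  have ab: "c < d" if "c \<in> set a1 \<union> set a2" "d \<in> set b1 \<union> set b2" for c d
  proof -
    have "c \<le> i" "i < d"
      using that assms(1,2) by (auto simp: low_def high_def)
    then show ?thesis by simp
  qed
  show ?thesis
  proof
    assume "dominates x y"
    then obtain c where c: "c \<in> set a1 \<union> set b1" "\<And>d. d \<in> set a2 \<union> set b2 \<Longrightarrow> d < c"
      unfolding dominates_def s by blast
    show "dominates b1 b2"
    proof (cases "c \<in> set b1")
      case True
      then show ?thesis
        using c(2) unfolding dominates_def by blast
    next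
      case False
      then have "c \<in> set a1" using c(1) by blast
      then have "d \<notin> set b2" for d
        using c(2)[of d] ab[of c d] by auto
      then have "b2 = []"
        by (cases b2) auto
      then show ?thesis using assms(3) by simp
    qed
  next
    assume "dominates b1 b2"
    then obtain c where c: "c \<in> set b1" "\<And>d. d \<in> set b2 \<Longrightarrow> d < c"
      unfolding dominates_def by blast
    then have "\<And>d. d \<in> set y \<Longrightarrow> d < c" "c \<in> set x"
      using ab[of _ c] unfolding s by blast+
    then show "dominates x y"
      unfolding dominates_def by blast
  qed
qed

lemma cop_lprod:
  assumes "low i a" "high i b" "b \<noteq> []"
  shows "cop i (f \<lhd> g) a b =
    (\<Sum>(a1, a2)\<in>splits a. \<Sum>(b1, b2)\<in>splits b.
       of_bool (set a1 \<inter> set a2 = {}) * (of_bool (set b1 \<inter> set b2 = {} \<and> dominates b1 b2)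
         * (cop i f a1 b1 * cop i g a2 b2)))"
proof (rule cop_conv[OF assms(1,2)])
  fix x y a1 a2 b1 b2
  assume "a1 @ a2 = a" "b1 @ b2 = b" "x \<in> shuf i a1 b1" "y \<in> shuf i a2 b2"
  then show "dominates x y \<longleftrightarrow> dominates b1 b2"
    using assms by (intro dominates_shuf[of i a1 a2 b1 b2]) auto
qed

lemma cop_rprod:
  assumes "low i a" "high i b" "b \<noteq> []"
  shows "cop i (f \<rhd> g) a b =
    (\<Sum>(a1, a2)\<in>splits a. \<Sum>(b1, b2)\<in>splits b.
       of_bool (set a1 \<inter> set a2 = {}) * (of_bool (set b1 \<inter> set b2 = {} \<and> dominates b2 b1)
         * (cop i f a1 b1 * cop i g a2 b2)))"
proof (rule cop_conv[OF assms(1,2)])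
  fix x y a1 a2 b1 b2
  assume "a1 @ a2 = a" "b1 @ b2 = b" "x \<in> shuf i a1 b1" "y \<in> shuf i a2 b2"
  then show "dominates y x \<longleftrightarrow> dominates b2 b1"
    using assms by (intro dominates_shuf[of i a2 a1 b2 b1]) auto
qed

section \<open>Primitivity and iterated half products of primitive functions\<close>

definition prim_at :: "nat \<Rightarrow> (word \<Rightarrow> 'k::field) \<Rightarrow> bool" where
  "prim_at i f \<longleftrightarrow> (\<forall>a b. low i a \<longrightarrow> high i b \<longrightarrow> a \<noteq> [] \<longrightarrow> b \<noteq> [] \<longrightarrow> cop i f a b = 0)"

text \<open>Keeping only words whose last letter lies above the cut singles out the summands of
  \<open>Delta_succ\<close>, whose cut positions are those below \<open>last u\<close>. In the same
  way \<open>last_low\<close> corresponds to \<open>Delta_prec\<close>.\<close>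

definition last_high :: "nat \<Rightarrow> (word \<Rightarrow> 'k::field) \<Rightarrow> word \<Rightarrow> 'k" where
  "last_high i f u = (if u \<noteq> [] \<and> i < last u then f u else 0)"

definition last_low :: "nat \<Rightarrow> (word \<Rightarrow> 'k::field) \<Rightarrow> word \<Rightarrow> 'k" where
  "last_low i f u = (if u \<noteq> [] \<and> last u \<le> i then f u else 0)"

definition tprim_at :: "nat \<Rightarrow> (word \<Rightarrow> 'k::field) \<Rightarrow> bool" where
  "tprim_at i f \<longleftrightarrow> prim_at i (last_high i f) \<and> prim_at i (last_low i f)"

lemma cop_halves:
  assumes "b \<noteq> []"
  shows "cop i f a b = cop i (last_low i f) a b + cop i (last_high i f) a b"
  unfolding cop_def sum.distrib[symmetric]
  by (intro sum.cong) (use assms in \<open>auto simp: last_low_def last_high_def shuf_def\<close>)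

lemma tprim_imp_prim: "tprim_at i f \<Longrightarrow> prim_at i f"
  unfolding tprim_at_def prim_at_def by (metis cop_halves add_0)

lemma cop_sum: "cop i (\<lambda>w. \<Sum>j\<in>J. c j * F j w) a b = (\<Sum>j\<in>J. c j * cop i (F j) a b)"
  unfolding cop_def by (subst sum.swap) (simp add: sum_distrib_left)

lemma cop_splits:
  "cop i (\<lambda>w. \<Sum>(A, B)\<in>splits ps. c A B * F A B w) a b = (\<Sum>(A, B)\<in>splits ps. c A B * cop i (F A B) a b)"
  using cop_sum[of i "\<lambda>p. c (fst p) (snd p)" "\<lambda>p. F (fst p) (snd p)" "splits ps" a b]
  by (simp add: case_prod_unfold)

lemma last_high_sum:
  "last_high i (\<lambda>w. \<Sum>j\<in>J. c j * F j w) = (\<lambda>w. \<Sum>j\<in>J. c j * last_high i (F j) w)"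
  by (auto simp: last_high_def)

lemma sum_splits_first:
  assumes "\<And>u v. u @ v = w \<Longrightarrow> u \<noteq> [] \<Longrightarrow> F u v = 0"
  shows "(\<Sum>(u, v)\<in>splits w. F u v) = F [] w"
proof -
  have "(\<Sum>(u, v)\<in>splits w. F u v) = (\<Sum>(u, v)\<in>{([], w)}. F u v)"
    by (rule sum.mono_neutral_right) (auto, (metis assms)+)
  then show ?thesis by simp
qed

lemma sum_splits_second:
  assumes "\<And>u v. u @ v = w \<Longrightarrow> v \<noteq> [] \<Longrightarrow> F u v = 0"
  shows "(\<Sum>(u, v)\<in>splits w. F u v) = F w []"
proof -
  have "(\<Sum>(u, v)\<in>splits w. F u v) = (\<Sum>(u, v)\<in>{(w, [])}. F u v)"
    by (rule sum.mono_neutral_right) (auto, (metis assms)+)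
  then show ?thesis by simp
qed

lemma dominates_nonempty: "dominates u v \<Longrightarrow> u \<noteq> []"
  by auto

text \<open>The dominating high part \<open>b1\<close> is nonempty, so a primitive \<open>f\<close>
  has no low part beside it and contributes to \<open>b\<close> alone.\<close>

lemma cop_lprod_prim:
  assumes "prim_at i f" "low i a" "high i b" "b \<noteq> []"
  shows "cop i (f \<lhd> g) a b =
    (\<Sum>(b1, b2)\<in>splits b. of_bool (set b1 \<inter> set b2 = {} \<and> dominates b1 b2) * (f b1 * cop i g a b2))"
proof -
  have "cop i (f \<lhd> g) a b = (\<Sum>(b1, b2)\<in>splits b.
       of_bool (set [] \<inter> set a = {}) * (of_bool (set b1 \<inter> set b2 = {} \<and> dominates b1 b2)
         * (cop i f [] b1 * cop i g a b2)))"
    unfolding cop_lprod[OF assms(2-4)]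
    by (rule sum_splits_first, rule sum.neutral) (use assms in \<open>auto simp: prim_at_def dest!: dominates_nonempty\<close>)
  also have "\<dots> = (\<Sum>(b1, b2)\<in>splits b. of_bool (set b1 \<inter> set b2 = {} \<and> dominates b1 b2) * (f b1 * cop i g a b2))"
    by (intro sum.cong refl) (use assms in auto)
  finally show ?thesis .
qed

lemma cop_rprod_prim:
  assumes "prim_at i g" "low i a" "high i b" "b \<noteq> []"
  shows "cop i (f \<rhd> g) a b =
    (\<Sum>(b1, b2)\<in>splits b. of_bool (set b1 \<inter> set b2 = {} \<and> dominates b2 b1) * (cop i f a b1 * g b2))"
proof -
  have "cop i (f \<rhd> g) a b = (\<Sum>(b1, b2)\<in>splits b.
       of_bool (set a \<inter> set [] = {}) * (of_bool (set b1 \<inter> set b2 = {} \<and> dominates b2 b1)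
         * (cop i f a b1 * cop i g [] b2)))"
    unfolding cop_rprod[OF assms(2-4)]
    by (rule sum_splits_second, rule sum.neutral) (use assms in \<open>auto simp: prim_at_def dest!: dominates_nonempty\<close>)
  also have "\<dots> = (\<Sum>(b1, b2)\<in>splits b. of_bool (set b1 \<inter> set b2 = {} \<and> dominates b2 b1) * (cop i f a b1 * g b2))"
    by (intro sum.cong refl) (use assms in auto)
  finally show ?thesis .
qed

text \<open>As long as high letters remain, the leading factor contains the maximum and goes
  entirely to the high side. The high factors therefore form an initial segment \<open>J\<close>,
  the low ones the remaining \<open>A\<close>.\<close>

lemma cop_prec_fold:
  assumes "\<And>p. p \<in> set ps \<Longrightarrow> prim_at i p" "low i a" "high i b"
  shows "cop i (prec_fold ps) a b = (\<Sum>(J, A)\<in>splits ps. prec_fold A a * prec_fold J b)"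
  using assms
proof (induction ps arbitrary: b)
  case Nil
  then show ?case by (simp add: cop_empty_ind)
next
  case (Cons p ps)
  show ?case
  proof (cases "b = []")
    case True
    have "(\<Sum>(J, A)\<in>splits (p # ps). prec_fold A a * prec_fold J ([]::word)) = prec_fold (p # ps) a * prec_fold [] []"
      by (rule sum_splits_first) (simp add: prec_fold_Nil)
    then show ?thesis using True Cons.prems by simp
  next
    case False
    have "cop i (prec_fold (p # ps)) a b = (p \<lhd> (\<lambda>w. \<Sum>(J, A)\<in>splits ps. prec_fold A a * prec_fold J w)) b"
      unfolding prec_fold.simps using False Cons.prems
      by (subst cop_lprod_prim) (auto simp: conv_def Cons.IH intro!: sum.cong)
    also have "\<dots> = (\<Sum>(J, A)\<in>splits (p # ps). prec_fold A a * prec_fold J b)"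
      using False by (simp add: conv_splits_right sum_splits_Cons)
    finally show ?thesis .
  qed
qed

text \<open>Here the maximum sits in the last factor, so the high factors form a final
  segment.\<close>

lemma cop_succ_fold:
  assumes "\<And>p. p \<in> set ps \<Longrightarrow> prim_at i p" "low i a" "high i b"
  shows "cop i (succ_fold ps) a b = (\<Sum>(A, B)\<in>splits ps. succ_fold A a * succ_fold B b)"
  using assms
proof (induction ps arbitrary: b rule: rev_induct)
  case Nil
  then show ?case by (simp add: cop_empty_ind)
next
  case (snoc p ps)
  show ?case
  proof (cases "b = []")
    case True
    have "(\<Sum>(A, B)\<in>splits (ps @ [p]). succ_fold A a * succ_fold B ([]::word)) = succ_fold (ps @ [p]) a * succ_fold [] []"
      by (rule sum_splits_second) (simp add: succ_fold_Nil)
    then show ?thesis using True snoc.prems by simp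
  next
    case False
    have "cop i (succ_fold (ps @ [p])) a b = ((\<lambda>w. \<Sum>(A, B)\<in>splits ps. succ_fold A a * succ_fold B w) \<rhd> p) b"
      unfolding succ_fold_simps using False snoc.prems
      by (subst cop_rprod_prim) (auto simp: conv_def snoc.IH intro!: sum.cong)
    also have "\<dots> = (\<Sum>(A, B)\<in>splits (ps @ [p]). succ_fold A a * succ_fold B b)"
      using False by (simp add: conv_splits_left sum_splits_snoc)
    finally show ?thesis .
  qed
qed

lemma cop_prec_fold_rprod:
  assumes "\<And>p. p \<in> set ps \<Longrightarrow> prim_at i p" "prim_at i q" "low i a" "high i b" "b \<noteq> []"
  shows "cop i (prec_fold ps \<rhd> q) a b = (\<Sum>(J, A)\<in>splits ps. prec_fold A a * (prec_fold J \<rhd> q) b)"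
proof -
  have "cop i (prec_fold ps \<rhd> q) a b = ((\<lambda>w. \<Sum>(J, A)\<in>splits ps. prec_fold A a * prec_fold J w) \<rhd> q) b"
    using assms by (subst cop_rprod_prim) (auto simp: conv_def cop_prec_fold intro!: sum.cong)
  then show ?thesis by (simp add: conv_splits_left)
qed

text \<open>Cutting a list and then both halves amounts to choosing the outer parts \<open>J\<close>
  and \<open>K\<close> and a cut of the middle \<open>S\<close>. For fixed \<open>J\<close> and
  \<open>K\<close> the inner sum has the shape treated in \<open>antipode\<close>.\<close>

lemma sum_splits_splits:
  "(\<Sum>(A, B)\<in>splits w. \<Sum>(J, A')\<in>splits A. \<Sum>(B', K)\<in>splits B. F J A' B' K)
    = (\<Sum>(J, S, K)\<in>splits3 w. \<Sum>(A', B')\<in>splits S. F J A' B' K)"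
proof -
  have "(\<Sum>(A, B)\<in>splits w. \<Sum>(J, A')\<in>splits A. \<Sum>(B', K)\<in>splits B. F J A' B' K)
      = (\<Sum>(J, A', B)\<in>splits3 w. \<Sum>(B', K)\<in>splits B. F J A' B' K)"
    by (rule sum_splits_left)
  also have "\<dots> = (\<Sum>(J, U)\<in>splits w. \<Sum>(A', B)\<in>splits U. \<Sum>(B', K)\<in>splits B. F J A' B' K)"
    by (rule sum_splits_right[symmetric])
  also have "\<dots> = (\<Sum>(J, U)\<in>splits w. \<Sum>(S, K)\<in>splits U. \<Sum>(A', B')\<in>splits S. F J A' B' K)"
    unfolding sum_splits_right sum_splits_left ..
  also have "\<dots> = (\<Sum>(J, S, K)\<in>splits3 w. \<Sum>(A', B')\<in>splits S. F J A' B' K)"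
    by (rule sum_splits_right)
  finally show ?thesis .
qed

lemma sum_swap_factor:
  fixes c :: "'x \<Rightarrow> 'k::comm_ring"
  shows "(\<Sum>x\<in>X. c x * (\<Sum>p\<in>S. \<Sum>q\<in>T. u p x * (v q x * Y p q)))
    = (\<Sum>p\<in>S. \<Sum>q\<in>T. (\<Sum>x\<in>X. c x * (u p x * v q x)) * Y p q)"
proof -
  have "(\<Sum>x\<in>X. c x * (\<Sum>p\<in>S. \<Sum>q\<in>T. u p x * (v q x * Y p q)))
      = (\<Sum>x\<in>X. \<Sum>p\<in>S. \<Sum>q\<in>T. c x * (u p x * (v q x * Y p q)))"
    by (simp only: sum_distrib_left)
  also have "\<dots> = (\<Sum>p\<in>S. \<Sum>x\<in>X. \<Sum>q\<in>T. c x * (u p x * (v q x * Y p q)))"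
    by (rule sum.swap)
  also have "\<dots> = (\<Sum>p\<in>S. \<Sum>q\<in>T. \<Sum>x\<in>X. c x * (u p x * (v q x * Y p q)))"
    by (intro sum.cong refl sum.swap)
  finally show ?thesis
    by (simp only: sum_distrib_right mult.assoc)
qed

text \<open>The arguments that reach the low side are those next to \<open>p\<close>: a tail
  \<open>A'\<close> of the left ones and a head \<open>B'\<close> of the right ones. Their low parts
  are joined by the full product, since the choice between the half products has been decided by the
  high parts.\<close>

lemma cop_brace_term:
  fixes p :: "word \<Rightarrow> 'k::field"
  assumes "\<And>q. q \<in> set (A @ B) \<Longrightarrow> prim_at i q" "prim_at i p" "low i a" "high i b" "b \<noteq> []"
  shows "cop i ((prec_fold A \<rhd> p) \<lhd> succ_fold B) a b =
    (\<Sum>(J, A')\<in>splits A. \<Sum>(B', K)\<in>splits B.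
       (prec_fold A' \<odot> succ_fold B') a * ((prec_fold J \<rhd> p) \<lhd> succ_fold K) b)"
proof -
  let ?X = "\<lambda>J. prec_fold J \<rhd> p"
  have inner: "(\<Sum>(b1, b2)\<in>splits b. of_bool (set b1 \<inter> set b2 = {} \<and> dominates b1 b2)
         * (cop i (?X A) a1 b1 * cop i (succ_fold B) a2 b2))
      = (\<Sum>P\<in>splits A. \<Sum>Q\<in>splits B. prec_fold (snd P) a1 * (succ_fold (fst Q) a2 * (?X (fst P) \<lhd> succ_fold (snd Q)) b))"
    if "low i a1" "low i a2" for a1 a2
  proof -
    have "(\<Sum>(b1, b2)\<in>splits b. of_bool (set b1 \<inter> set b2 = {} \<and> dominates b1 b2)
         * (cop i (?X A) a1 b1 * cop i (succ_fold B) a2 b2))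
      = ((\<lambda>w. \<Sum>(J, A')\<in>splits A. prec_fold A' a1 * ?X J w) \<lhd>
         (\<lambda>w. \<Sum>(B', K)\<in>splits B. succ_fold B' a2 * succ_fold K w)) b"
      unfolding conv_def[of dominates "\<lambda>w. \<Sum>(J, A')\<in>splits A. prec_fold A' a1 * ?X J w"]
    proof (intro sum.cong refl, clarify)
      fix b1 b2 assume "(b1, b2) \<in> splits b"
      then have hb: "high i b1" "high i b2"
        using assms(4) by auto
      show "of_bool (set b1 \<inter> set b2 = {} \<and> dominates b1 b2)
          * (cop i (?X A) a1 b1 * cop i (succ_fold B) a2 b2)
        = of_bool (set b1 \<inter> set b2 = {} \<and> dominates b1 b2)
          * ((\<Sum>(J, A')\<in>splits A. prec_fold A' a1 * ?X J b1) * (\<Sum>(B', K)\<in>splits B. succ_fold B' a2 * succ_fold K b2))"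
      \<comment> \<open>The formula \<open>cop_prec_fold_rprod\<close> needs a nonempty high word.
        An empty \<open>b1\<close> dominates nothing, so that both sides are zero.\<close>
      proof (cases "b1 = []")
        case False
        then show ?thesis
          using that hb assms by (simp add: cop_prec_fold_rprod cop_succ_fold)
      qed simp
    qed
    then show ?thesis
      by (simp only: conv_splits_left conv_splits_right) (simp add: sum_distrib_left case_prod_unfold)
  qed
  have "cop i (?X A \<lhd> succ_fold B) a b = (\<Sum>x\<in>splits a. of_bool (set (fst x) \<inter> set (snd x) = {}) *
     (\<Sum>P\<in>splits A. \<Sum>Q\<in>splits B. prec_fold (snd P) (fst x) *
        (succ_fold (fst Q) (snd x) * (?X (fst P) \<lhd> succ_fold (snd Q)) b)))"
    unfolding cop_lprod[OF assms(3-5)] case_prod_unfold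
  proof (rule sum.cong)
    fix x assume "x \<in> splits a"
    then have "low i (fst x)" "low i (snd x)"
      using assms(3) by (cases x; auto)+
    from inner[OF this]
    show "(\<Sum>y\<in>splits b. of_bool (set (fst x) \<inter> set (snd x) = {}) *
         (of_bool (set (fst y) \<inter> set (snd y) = {} \<and> dominates (fst y) (snd y)) *
          (cop i (?X A) (fst x) (fst y) * cop i (succ_fold B) (snd x) (snd y)))) =
       of_bool (set (fst x) \<inter> set (snd x) = {}) *
       (\<Sum>P\<in>splits A. \<Sum>Q\<in>splits B. prec_fold (snd P) (fst x) *
        (succ_fold (fst Q) (snd x) * (?X (fst P) \<lhd> succ_fold (snd Q)) b))"
      by (simp add: sum_distrib_left[symmetric] case_prod_unfold)
  qed simp
  also have "\<dots> = (\<Sum>P\<in>splits A. \<Sum>Q\<in>splits B.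
      (prec_fold (snd P) \<odot> succ_fold (fst Q)) a * (?X (fst P) \<lhd> succ_fold (snd Q)) b)"
    unfolding sum_swap_factor by (simp add: conv_def[of "\<lambda>u v. True"] case_prod_unfold)
  finally show ?thesis
    by (simp add: case_prod_unfold)
qed

section \<open>Brace brackets of primitive functions\<close>

lemma fbrace_fun:
  "fbrace ps p = (\<lambda>w. \<Sum>(A, B)\<in>splits ps. (-1) ^ length B * ((prec_fold A \<rhd> p) \<lhd> succ_fold B) w)"
  by (rule ext) (rule fbrace_def)

text \<open>The sign of \<open>B\<close> splits into those of \<open>B'\<close> and
  \<open>K\<close>. Collecting terms with the same outer parts \<open>J\<close> and
  \<open>K\<close>, the low factor becomes the antipode sum of the block between them, which is zero
  at the nonempty word \<open>a\<close>.\<close>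

lemma prim_fbrace:
  fixes p :: "word \<Rightarrow> 'k::field"
  assumes "\<And>q. q \<in> set ps \<Longrightarrow> prim_at i q" "prim_at i p"
  shows "prim_at i (fbrace ps p)"
  unfolding prim_at_def
proof (intro allI impI)
  fix a b assume ab: "low i a" "high i b" "a \<noteq> []" "b \<noteq> []"
  let ?Y = "\<lambda>J K. ((prec_fold J \<rhd> p) \<lhd> succ_fold K) b"
  have "cop i (fbrace ps p) a b = (\<Sum>(A, B)\<in>splits ps. (-1) ^ length B *
     cop i ((prec_fold A \<rhd> p) \<lhd> succ_fold B) a b)"
    unfolding fbrace_fun by (rule cop_splits)
  also have "\<dots> = (\<Sum>(A, B)\<in>splits ps. \<Sum>(J, A')\<in>splits A. \<Sum>(B', K)\<in>splits B.
       ((-1) ^ length K * ?Y J K) * ((-1) ^ length B' * (prec_fold A' \<odot> succ_fold B') a))"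
  proof (intro sum.cong refl, clarify)
    fix A B assume AB: "(A, B) \<in> splits ps"
    have "(-1) ^ length B * cop i ((prec_fold A \<rhd> p) \<lhd> succ_fold B) a b
       = (\<Sum>P\<in>splits A. \<Sum>Q\<in>splits B. (-1) ^ length B *
       ((prec_fold (snd P) \<odot> succ_fold (fst Q)) a * ?Y (fst P) (snd Q)))"
      by (subst cop_brace_term) (use AB assms ab in \<open>auto simp: sum_distrib_left case_prod_unfold\<close>)
    also have "\<dots> = (\<Sum>P\<in>splits A. \<Sum>Q\<in>splits B.
       ((-1) ^ length (snd Q) * ?Y (fst P) (snd Q)) * ((-1) ^ length (fst Q) * (prec_fold (snd P) \<odot> succ_fold (fst Q)) a))"
      by (intro sum.cong refl) (auto simp: power_add)
    finally show "(-1) ^ length B * cop i ((prec_fold A \<rhd> p) \<lhd> succ_fold B) a b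
       = (\<Sum>(J, A')\<in>splits A. \<Sum>(B', K)\<in>splits B.
       ((-1) ^ length K * ?Y J K) * ((-1) ^ length B' * (prec_fold A' \<odot> succ_fold B') a))"
      by (simp add: case_prod_unfold)
  qed
  also have "\<dots> = (\<Sum>(J, S, K)\<in>splits3 ps. ((-1) ^ length K * ?Y J K) *
      (\<Sum>(A', B')\<in>splits S. (-1) ^ length B' * (prec_fold A' \<odot> succ_fold B') a))"
    unfolding sum_splits_splits by (simp add: sum_distrib_left case_prod_unfold)
  also have "\<dots> = 0"
    unfolding antipode using ab by (auto intro!: sum.neutral)
  finally show "cop i (fbrace ps p) a b = 0" .
qed

text \<open>The last letter of \<open>u @ v\<close> is that of \<open>v\<close> unless
  \<open>v\<close> is empty. The assumption on \<open>g\<close> excludes this case; for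
  \<open>\<rhd>\<close> it is excluded by domination.\<close>

lemma last_high_lprod:
  assumes "g [] = 0"
  shows "last_high i (f \<lhd> g) = f \<lhd> last_high i g"
proof
  fix w
  have "of_bool P * (f u * last_high i g v) = (if i < last w then of_bool P * (f u * g v) else 0)"
    if "(u, v) \<in> splits w" for u v P
    using that assms by (cases "v = []") (auto simp: last_high_def)
  then have "(f \<lhd> last_high i g) w = (if i < last w then (f \<lhd> g) w else 0)"
    unfolding conv_def by (auto intro!: sum.cong sum.neutral)
  then show "last_high i (f \<lhd> g) w = (f \<lhd> last_high i g) w"
    by (simp add: last_high_def)
qed

lemma last_high_rprod: "last_high i (f \<rhd> g) = f \<rhd> last_high i g"
proof
  fix w
  have "of_bool (P \<and> dominates v u) * (f u * last_high i g v)
      = (if i < last w then of_bool (P \<and> dominates v u) * (f u * g v) else 0)"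
    if "(u, v) \<in> splits w" for u v P
    using that by (cases "v = []") (auto simp: last_high_def)
  then have "(f \<rhd> last_high i g) w = (if i < last w then (f \<rhd> g) w else 0)"
    unfolding conv_def by (auto intro!: sum.cong sum.neutral)
  then show "last_high i (f \<rhd> g) w = (f \<rhd> last_high i g) w"
    by (simp add: last_high_def)
qed

lemma last_high_high: "high i b \<Longrightarrow> b \<noteq> [] \<Longrightarrow> last_high i f b = f b"
  by (simp add: last_high_def high_def)

lemma last_high_low: "low i a \<Longrightarrow> last_high i f a = 0"
  by (auto simp: last_high_def low_def dest!: last_in_set)

text \<open>The last letter of \<open>(a \<rhd> p) \<lhd> s\<close> lies in the factor \<open>s\<close>, and so its high part is longer than
  that of \<open>p\<close>; only the summand without a right factor reaches degree \<open>d\<close>.\<close>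

lemma last_high_fbrace_leading:
  fixes p :: "word \<Rightarrow> 'k::field"
  assumes "\<And>q. q \<in> set ps \<Longrightarrow> prim_at i q" "tprim_at i p"
    and len: "\<And>w. p w \<noteq> 0 \<Longrightarrow> length w = d"
    and ab: "low i a" "high i b" "b \<noteq> []" "length b \<le> d"
  shows "cop i (last_high i (fbrace ps p)) a b = prec_fold ps a * p b"
proof -
  have p: "prim_at i p" "prim_at i (last_high i p)"
    using assms(2) tprim_imp_prim by (auto simp: tprim_at_def)
  have short: "p w = 0" if "length w < d" for w
    using len[of w] that by auto
  let ?T = "\<lambda>A B. cop i (last_high i ((prec_fold A \<rhd> p) \<lhd> succ_fold B)) a b"
  have lin: "last_high i (fbrace ps p) = (\<lambda>w. \<Sum>(A, B)\<in>splits ps. (-1) ^ length B *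
      last_high i ((prec_fold A \<rhd> p) \<lhd> succ_fold B) w)"
    using last_high_sum[of i "\<lambda>P. (-1) ^ length (snd P)" "\<lambda>P. (prec_fold (fst P) \<rhd> p) \<lhd> succ_fold (snd P)" "splits ps"]
    by (simp add: fbrace_fun case_prod_unfold)
  have "cop i (last_high i (fbrace ps p)) a b = (\<Sum>(A, B)\<in>splits ps. (-1) ^ length B * ?T A B)"
    unfolding lin by (rule cop_splits)
  also have "\<dots> = (-1) ^ length ([] :: (word \<Rightarrow> 'k) list) * ?T ps []"
  proof (rule sum_splits_second)
    fix A B :: "(word \<Rightarrow> 'k) list" assume AB: "A @ B = ps" "B \<noteq> []"
    have z: "cop i (prec_fold A \<rhd> p) a1 b1 * cop i (last_high i (succ_fold B)) a2 b2 = 0"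
      if "low i a1" "low i a2" "b1 @ b2 = b" "dominates b1 b2" for a1 a2 b1 b2
    proof (cases "b2 = []")
      case True
      then show ?thesis using that by (simp add: last_high_low)
    next
      case False
      have "length b1 < length b"
        unfolding that(3)[symmetric] using False by simp
      then have hb: "high i b1" "b1 \<noteq> []" "length b1 < d"
        using that ab by auto
      then have "cop i (prec_fold A \<rhd> p) a1 b1 = 0"
        unfolding cop_rprod_prim[OF p(1) that(1) hb(1,2)]
        by (intro sum.neutral) (auto simp: short)
      then show ?thesis by simp
    qed
    have "?T A B = 0"
      unfolding last_high_lprod[where g = "succ_fold B", OF succ_fold_Nil[OF AB(2)]] cop_lprod[OF ab(1-3)]
      by (intro sum.neutral) (use ab(1) z in \<open>auto intro!: sum.neutral simp del: mult_eq_0_iff simp: of_bool_def\<close>)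
    then show "(-1) ^ length B * ?T A B = 0" by simp
  qed
  also have "\<dots> = cop i (prec_fold ps \<rhd> last_high i p) a b"
  proof -
    have "(prec_fold ps \<rhd> p) \<lhd> empty_ind = prec_fold ps \<rhd> p"
      by (rule ext) (simp add: lprod_empty_ind)
    then show ?thesis by (simp add: last_high_rprod)
  qed
  also have "\<dots> = (\<Sum>(b1, b2)\<in>splits b. of_bool (set b1 \<inter> set b2 = {} \<and> dominates b2 b1) *
      (cop i (prec_fold ps) a b1 * last_high i p b2))"
    by (rule cop_rprod_prim[OF p(2) ab(1-3)])
  also have "\<dots> = of_bool (set [] \<inter> set b = {} \<and> dominates b []) * (cop i (prec_fold ps) a [] * last_high i p b)"
  proof (rule sum_splits_first)
    fix b1 b2 :: word assume "b1 @ b2 = b" "b1 \<noteq> []"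
    then have "length b2 < length b"
      by auto
    then have "p b2 = 0" using ab(4) by (intro short) simp
    then show "of_bool (set b1 \<inter> set b2 = {} \<and> dominates b2 b1) * (cop i (prec_fold ps) a b1 * last_high i p b2) = 0"
      by (simp add: last_high_def)
  qed
  also have "\<dots> = prec_fold ps a * p b"
    using ab by (simp add: last_high_high)
  finally show ?thesis .
qed

section \<open>Homogeneous functions\<close>

text \<open>The first index is the degree. The second is the number of distinct letters, which is
  the maximum of a packed word and corresponds to the weight of a tree.\<close>

definition homog :: "nat \<Rightarrow> nat \<Rightarrow> (word \<Rightarrow> 'k::field) \<Rightarrow> bool" where
  "homog n m f \<longleftrightarrow> (\<forall>w. f w \<noteq> 0 \<longrightarrow> length w = n \<and> card (set w) = m)"

lemma homogD: "homog n m f \<Longrightarrow> f w \<noteq> 0 \<Longrightarrow> length w = n \<and> card (set w) = m"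
  by (simp add: homog_def)

lemma homog_conv:
  assumes "homog n m f" "homog n' m' g"
  shows "homog (n + n') (m + m') (conv R f g)"
  unfolding homog_def
proof (intro allI impI)
  fix w assume "conv R f g w \<noteq> 0"
  then obtain p where "p \<in> splits w" "(case p of (u, v) \<Rightarrow>
      of_bool (set u \<inter> set v = {} \<and> R u v) * (f u * g v)) \<noteq> 0"
    unfolding conv_def by (meson sum.neutral)
  then obtain u v where "u @ v = w" "set u \<inter> set v = {}" "f u \<noteq> 0" "g v \<noteq> 0"
    by (cases p) auto
  then show "length w = n + n' \<and> card (set w) = m + m'"
    using homogD[OF assms(1), of u] homogD[OF assms(2), of v] by (auto simp: card_Un_disjoint)
qed

lemma homog_empty_ind: "homog 0 0 empty_ind"
  by (auto simp: homog_def empty_ind_def split: if_splits)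

lemma homog_prec_fold:
  assumes "\<And>t. t \<in> set ts \<Longrightarrow> homog (N t) (W t) (h t)"
  shows "homog (sum_list (map N ts)) (sum_list (map W ts)) (prec_fold (map h ts))"
  using assms by (induction ts) (auto intro!: homog_conv homog_empty_ind)

lemma homog_succ_fold:
  assumes "\<And>t. t \<in> set ts \<Longrightarrow> homog (N t) (W t) (h t)"
  shows "homog (sum_list (map N ts)) (sum_list (map W ts)) (succ_fold (map h ts))"
  using assms by (induction ts rule: rev_induct) (auto intro!: homog_conv homog_empty_ind)

lemma homog_fbrace:
  assumes "\<And>t. t \<in> set ts \<Longrightarrow> homog (N t) (W t) (h t)" "homog n m p"
  shows "homog (n + sum_list (map N ts)) (m + sum_list (map W ts)) (fbrace (map h ts) p)"
proof -
  have *: "homog (n + sum_list (map N ts)) (m + sum_list (map W ts)) ((prec_fold A \<rhd> p) \<lhd> succ_fold B)"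
    if AB: "(A, B) \<in> splits (map h ts)" for A B
  proof -
    obtain us vs where uv: "A = map h us" "B = map h vs" "ts = us @ vs"
      using AB by (auto simp: append_eq_map_conv)
    have "homog (sum_list (map N us) + n + sum_list (map N vs))
        (sum_list (map W us) + m + sum_list (map W vs)) ((prec_fold A \<rhd> p) \<lhd> succ_fold B)"
      unfolding uv by (intro homog_conv homog_prec_fold homog_succ_fold) (use assms uv in auto)
    then show ?thesis
      by (simp add: uv add_ac)
  qed
  show ?thesis
    unfolding homog_def
  proof (intro allI impI)
    fix w assume "fbrace (map h ts) p w \<noteq> 0"
    then obtain P where "P \<in> splits (map h ts)" "(case P of (A, B) \<Rightarrow>
        (-1) ^ length B * ((prec_fold A \<rhd> p) \<lhd> succ_fold B) w) \<noteq> 0"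
      unfolding fbrace_def by (meson sum.neutral)
    then obtain A B where "(A, B) \<in> splits (map h ts)" "((prec_fold A \<rhd> p) \<lhd> succ_fold B) w \<noteq> 0"
      by (cases P) auto
    with homogD[OF *] show "length w = n + sum_list (map N ts) \<and> card (set w) = m + sum_list (map W ts)"
      by blast
  qed
qed


section \<open>Appending a letter\<close>

text \<open>The letter rank \<open>card {b \<in> set w. b \<le> a}\<close> is the value of \<open>a\<close> after packing \<open>w\<close>.\<close>

definition fPsi :: "label \<Rightarrow> (word \<Rightarrow> 'k::field) \<Rightarrow> word \<Rightarrow> 'k" where
  "fPsi x f w = (if w \<noteq> [] \<and> (last w \<notin> set (butlast w)) = (snd x = Circ)
     \<and> card {b \<in> set w. b \<le> last w} = fst x then f (butlast w) else 0)"

lemma fPsi_Nil [simp]: "fPsi x f [] = 0"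
  by (simp add: fPsi_def)

lemma fPsi_snoc: "fPsi x f (v @ [c]) =
    of_bool ((c \<notin> set v) = (snd x = Circ) \<and> card {b \<in> insert c (set v). b \<le> c} = fst x) * f v"
  by (simp add: fPsi_def)

lemma homog_fPsi:
  assumes "homog n m f"
  shows "homog (Suc n) (of_bool (snd x = Circ) + m) (fPsi x f)"
  unfolding homog_def
proof (intro allI impI)
  fix w assume "fPsi x f w \<noteq> 0"
  then show "length w = Suc n \<and> card (set w) = of_bool (snd x = Circ) + m"
    using homogD[OF assms]
    by (cases w rule: rev_cases) (auto simp: fPsi_snoc card_insert_if split: if_splits)
qed

text \<open>A shuffle of \<open>a\<close> with \<open>b @ [c]\<close> that ends in a high letter
  must end in \<open>c\<close>; the other shuffles are discarded by
  \<open>last_high\<close>.\<close>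

lemma cop_last_high_snoc:
  assumes "i < c"
  shows "cop i (last_high i F) a (b @ [c]) = cop i (\<lambda>v. F (v @ [c])) a b"
proof -
  have "cop i (\<lambda>v. F (v @ [c])) a b = (\<Sum>u\<in>(\<lambda>v. v @ [c]) ` shuf i a b. last_high i F u)"
    unfolding cop_def using assms by (subst sum.reindex) (auto simp: last_high_def inj_on_def)
  also have "\<dots> = cop i (last_high i F) a (b @ [c])"
    unfolding cop_def
  proof (rule sum.mono_neutral_left)
    show "(\<lambda>v. v @ [c]) ` shuf i a b \<subseteq> shuf i a (b @ [c])"
      using assms by (auto simp: shuf_def)
    show "\<forall>u\<in>shuf i a (b @ [c]) - (\<lambda>v. v @ [c]) ` shuf i a b. last_high i F u = 0"
    proof
      fix u assume u: "u \<in> shuf i a (b @ [c]) - (\<lambda>v. v @ [c]) ` shuf i a b"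
      show "last_high i F u = 0"
        using u by (cases u rule: rev_cases) (auto simp: last_high_def shuf_def split: if_splits)
    qed
  qed simp
  finally show ?thesis ..
qed

lemma cop_last_low_snoc:
  assumes "c \<le> i"
  shows "cop i (last_low i F) (a @ [c]) b = cop i (\<lambda>v. F (v @ [c])) a b"
proof -
  have "cop i (\<lambda>v. F (v @ [c])) a b = (\<Sum>u\<in>(\<lambda>v. v @ [c]) ` shuf i a b. last_low i F u)"
    unfolding cop_def using assms by (subst sum.reindex) (auto simp: last_low_def inj_on_def)
  also have "\<dots> = cop i (last_low i F) (a @ [c]) b"
    unfolding cop_def
  proof (rule sum.mono_neutral_left)
    show "(\<lambda>v. v @ [c]) ` shuf i a b \<subseteq> shuf i (a @ [c]) b"
      using assms by (auto simp: shuf_def)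
    show "\<forall>u\<in>shuf i (a @ [c]) b - (\<lambda>v. v @ [c]) ` shuf i a b. last_low i F u = 0"
    proof
      fix u assume u: "u \<in> shuf i (a @ [c]) b - (\<lambda>v. v @ [c]) ` shuf i a b"
      show "last_low i F u = 0"
        using u by (cases u rule: rev_cases) (auto simp: last_low_def shuf_def split: if_splits)
    qed
  qed simp
  finally show ?thesis ..
qed

text \<open>The condition on the last letter depends only on the set of letters before it, which is
  the same for all shuffles of \<open>a\<close> and \<open>b\<close>.\<close>

lemma cop_fPsi_snoc:
  "cop i (\<lambda>v. fPsi x f (v @ [c])) a b =
    of_bool ((c \<notin> set a \<union> set b) = (snd x = Circ) \<and> card {y \<in> insert c (set a \<union> set b). y \<le> c} = fst x) * cop i f a b"
  unfolding cop_def sum_distrib_left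
  by (intro sum.cong refl) (simp add: fPsi_snoc set_shuf del: insert_iff Un_iff)

text \<open>Removing the last letter reduces a half coproduct of \<open>fPsi x f\<close> to the coproduct of \<open>f\<close>; the
  two boundary cases, where the high or the low part consists of that letter alone, are the
  labels \<open>(m + 1)\<^sup>\<circ>\<close> and \<open>1\<^sup>\<circ>\<close>.\<close>

lemma tprim_fPsi:
  assumes "prim_at i f" "homog n m f" "fst x \<le> m" "x \<noteq> (1, Circ)"
  shows "tprim_at i (fPsi x f)"
  unfolding tprim_at_def prim_at_def
proof (intro conjI allI impI)
  fix a b assume ab: "low i a" "high i b" "a \<noteq> []" "b \<noteq> []"
  obtain b' c where b: "b = b' @ [c]"
    using ab(4) by (metis rev_exhaust)
  have c: "i < c" "high i b'"
    using ab(2) b by (auto simp: high_def)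
  show "cop i (last_high i (fPsi x f)) a b = 0"
  proof (cases "b' = []")
    case True
    have "c \<notin> set a" "{y \<in> insert c (set a). y \<le> c} = insert c (set a)"
      using ab(1) c(1) by (auto simp: low_def)
    moreover have "f a \<noteq> 0 \<Longrightarrow> card (set a) = m"
      using homogD[OF assms(2)] by blast
    ultimately show ?thesis
      unfolding b cop_last_high_snoc[OF c(1)] cop_fPsi_snoc using True ab(1) assms(3)
      by (cases "f a = 0") (auto simp del: insert_iff)
  next
    case False
    then show ?thesis
      unfolding b cop_last_high_snoc[OF c(1)] cop_fPsi_snoc
      using assms(1) ab c by (simp add: prim_at_def)
  qed
next
  fix a b assume ab: "low i a" "high i b" "a \<noteq> []" "b \<noteq> []"
  obtain a' c where a: "a = a' @ [c]"
    using ab(3) by (metis rev_exhaust)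
  have c: "c \<le> i" "low i a'"
    using ab(1) a by (auto simp: low_def)
  show "cop i (last_low i (fPsi x f)) a b = 0"
  proof (cases "a' = []")
    case True
    have "c \<notin> set b" "{y \<in> insert c (set b). y \<le> c} = {c}"
      using ab(2) c(1) by (auto simp: high_def)
    then show ?thesis
      unfolding a cop_last_low_snoc[OF c(1)] cop_fPsi_snoc using True ab(2) assms(4)
      by (cases x) (auto simp del: insert_iff)
  next
    case False
    then show ?thesis
      unfolding a cop_last_low_snoc[OF c(1)] cop_fPsi_snoc
      using assms(1) ab c by (simp add: prim_at_def)
  qed
qed

text \<open>A word of length one cannot be distributed over two nonempty words. This settles the
  leaves, whose label \<open>1\<^sup>\<circ>\<close> is excluded from
  \<open>tprim_fPsi\<close>.\<close>

lemma tprim_homog_1: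
  assumes "homog 1 m f"
  shows "tprim_at i f"
proof -
  have "f u = 0" if "u \<in> shuf i a b" "a \<noteq> []" "b \<noteq> []" for u a b
  proof (rule ccontr)
    assume "f u \<noteq> 0"
    then have "length a + length b = 1"
      using length_shuf[OF that(1)] homogD[OF assms] by auto
    then show False
      using that(2,3) by (cases a; cases b) auto
  qed
  then show ?thesis
    unfolding tprim_at_def prim_at_def cop_def
    by (auto intro!: sum.neutral simp: last_low_def last_high_def)
qed

section \<open>Packing\<close>

definition rank :: "word \<Rightarrow> nat \<Rightarrow> nat" where
  "rank w a = card {b \<in> set w. b \<le> a}"

lemma pack_eq: "pack w = map (rank w) w"
  by (simp add: pack_def rank_def)

lemma length_pack [simp]: "length (pack w) = length w"
  by (simp add: pack_def)

lemma pack_Nil_iff [simp]: "pack w = [] \<longleftrightarrow> w = []" "pack [] = []"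
  by (simp_all add: pack_def)

lemma strict_mono_on_rank: "strict_mono_on (set w) (rank w)"
proof (rule strict_mono_onI)
  fix a b assume "a \<in> set w" "b \<in> set w" "a < b"
  then have "{c \<in> set w. c \<le> a} \<subseteq> {c \<in> set w. c \<le> b}" "b \<in> {c \<in> set w. c \<le> b} - {c \<in> set w. c \<le> a}"
    by auto
  then have "{c \<in> set w. c \<le> a} \<subset> {c \<in> set w. c \<le> b}"
    by blast
  then show "rank w a < rank w b"
    unfolding rank_def by (intro psubset_card_mono) auto
qed

lemma strict_mono_on_leq:
  fixes g :: "nat \<Rightarrow> nat"
  assumes "strict_mono_on S g" "a \<in> S" "b \<in> S"
  shows "g a \<le> g b \<longleftrightarrow> a \<le> b" "g a < g b \<longleftrightarrow> a < b"
  using assms strict_mono_onD[OF assms(1), of a b] strict_mono_onD[OF assms(1), of b a]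
  by (cases a b rule: linorder_cases; force)+

lemma rank_map:
  assumes "strict_mono_on (set w) g" "a \<in> set w"
  shows "rank (map g w) (g a) = rank w a"
proof -
  have "{b \<in> set (map g w). b \<le> g a} = g ` {b \<in> set w. b \<le> a}"
    using strict_mono_on_leq[OF assms(1) _ assms(2)] by auto
  moreover have "inj_on g {b \<in> set w. b \<le> a}"
    using strict_mono_on_imp_inj_on[OF assms(1)] by (rule inj_on_subset) auto
  ultimately show ?thesis
    by (simp add: rank_def card_image)
qed

text \<open>The rank of a letter depends only on the relative order of the letters.\<close>

lemma pack_map:
  assumes "strict_mono_on (set w) g"
  shows "pack (map g w) = pack w"
  unfolding pack_eq by (simp add: rank_map[OF assms])

lemma pack_map_rank:
  assumes "set v \<subseteq> set w"
  shows "pack (map (rank w) v) = pack v"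
  by (rule pack_map, rule monotone_on_subset[OF strict_mono_on_rank assms])

lemma set_pack: "set (pack w) = {1..card (set w)}"
proof (rule card_subset_eq)
  have "rank w a \<in> {1..card (set w)}" if "a \<in> set w" for a
  proof -
    have "{b \<in> set w. b \<le> a} \<noteq> {}" using that by auto
    then have "0 < rank w a" unfolding rank_def by (simp add: card_gt_0_iff)
    moreover have "rank w a \<le> card (set w)"
      unfolding rank_def by (intro card_mono) auto
    ultimately show ?thesis by simp
  qed
  then show "set (pack w) \<subseteq> {1..card (set w)}"
    by (auto simp: pack_eq)
  show "card (set (pack w)) = card {1..card (set w)}"
    using card_image[OF strict_mono_on_imp_inj_on[OF strict_mono_on_rank]] by (simp add: pack_eq)
qed simp

lemma wmax_interval: "set w = {1..k} \<Longrightarrow> wmax w = k"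
  unfolding wmax_def by (intro Max_eqI) auto

lemma packedI: "set w = {1..k} \<Longrightarrow> packed w"
  using wmax_interval[of w k] by (simp add: packed_def)

lemma packed_pack: "packed (pack w)"
  by (rule packedI) (rule set_pack)

lemma packed_card: "packed w \<Longrightarrow> card (set w) = wmax w"
  by (simp add: packed_def)

lemma wmax_pack: "wmax (pack w) = card (set w)"
  by (rule wmax_interval) (rule set_pack)

lemma pack_packed:
  assumes "packed w" shows "pack w = w"
proof -
  have "rank w a = a" if "a \<in> set w" for a
  proof -
    have "{b \<in> set w. b \<le> a} = {1..a}"
      using assms that by (auto simp: packed_def)
    then show ?thesis by (simp add: rank_def)
  qed
  then show ?thesis by (simp add: pack_eq map_idI)
qed

lemma finite_PW: "finite (PW n)"
proof (rule finite_subset)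
  show "PW n \<subseteq> {w. set w \<subseteq> {1..n} \<and> length w = n}"
  proof
    fix w assume "w \<in> PW n"
    then have w: "set w = {1..wmax w}" "length w = n"
      by (auto simp: PW_def packed_def)
    then have "wmax w \<le> n"
      using card_length[of w] by simp
    then show "w \<in> {w. set w \<subseteq> {1..n} \<and> length w = n}"
      using w by auto
  qed
  show "finite {w. set w \<subseteq> {1..n} \<and> length w = n}"
    by (rule finite_lists_length_eq) simp
qed


section \<open>From quasi-symmetric functions to functions on words\<close>

definition hat :: "(word \<Rightarrow>\<^sub>0 'k::field) \<Rightarrow> word \<Rightarrow> 'k" where
  "hat x w = Poly_Mapping.lookup x (pack w)"

lemma hat_pack [simp]: "hat x (pack w) = hat x w"
  by (simp add: hat_def pack_packed packed_pack)

lemma hat_map: "strict_mono_on (set w) g \<Longrightarrow> hat x (map g w) = hat x w"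
  by (simp add: hat_def pack_map)

lemma hat_sum: "hat (\<Sum>i\<in>I. fscale (c i) (F i)) w = (\<Sum>i\<in>I. c i * hat (F i) w)"
  by (simp add: hat_def lookup_sum)

lemma lookup_lin_ext:
  "Poly_Mapping.lookup (lin_ext f x) w = (\<Sum>a\<in>Poly_Mapping.keys x. Poly_Mapping.lookup x a * Poly_Mapping.lookup (f a) w)"
  by (simp add: lin_ext_def lookup_sum)

lemma sum_keys_of_bool:
  "(\<Sum>u\<in>Poly_Mapping.keys x. of_bool (v = u) * (Poly_Mapping.lookup x u * c)) = Poly_Mapping.lookup x v * (c :: 'k::field)"
proof -
  have "(\<Sum>u\<in>Poly_Mapping.keys x. of_bool (v = u) * (Poly_Mapping.lookup x u * c))
      = (\<Sum>u\<in>Poly_Mapping.keys x. if v = u then Poly_Mapping.lookup x u * c else 0)"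
    by (intro sum.cong) auto
  then show ?thesis
    by (auto simp: in_keys_iff)
qed

text \<open>A factorization of \<open>w\<close> into words without common letters stems from exactly
  one pair of basis elements, the packings of its two factors.\<close>

lemma lookup_half_product:
  fixes x y :: "word \<Rightarrow>\<^sub>0 'k::field"
  shows "Poly_Mapping.lookup (bilin_ext (\<lambda>u v. \<Sum>(u', v')\<in>{(u', v') \<in> split_words u v. R u' v'}. \<QQ> (u' @ v')) x y) w
    = of_bool (packed w) * (\<Sum>(u, v)\<in>splits w. of_bool (set u \<inter> set v = {} \<and> R u v)
        * (Poly_Mapping.lookup x (pack u) * Poly_Mapping.lookup y (pack v)))"
proof -
  let ?G = "\<lambda>u v. {(u', v') \<in> split_words u v. R u' v'}"
  let ?K = "\<lambda>p. packed w \<and> set (fst p) \<inter> set (snd p) = {} \<and> R (fst p) (snd p)"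
  \<comment> \<open>A sum over an infinite set would be 0 by convention. Here the lengths of
    \<open>u\<close> and \<open>v\<close> fix that of the concatenation, and there are finitely many
    packed words of a given length.\<close>
  have fin: "finite (?G u v)" for u v
  proof (rule finite_subset)
    show "?G u v \<subseteq> (\<Union>w\<in>PW (length u + length v). splits w)"
    proof
      fix p assume p: "p \<in> ?G u v"
      obtain u' v' where uv: "p = (u', v')" by (cases p)
      have "length u = length u'" "length v = length v'" "packed (u' @ v')"
        using p length_pack unfolding uv split_words_def by auto
      then show "p \<in> (\<Union>w\<in>PW (length u + length v). splits w)"
        unfolding uv by (intro UN_I[of "u' @ v'"]) (auto simp: PW_def)
    qed
  qed (simp add: finite_PW)
  have coeff: "Poly_Mapping.lookup (\<Sum>(u', v')\<in>?G u v. \<QQ> (u' @ v')) w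
      = (\<Sum>p\<in>splits w. of_bool (?K p) * (of_bool (pack (fst p) = u) * of_bool (pack (snd p) = v)) :: 'k)" for u v
  proof -
    have "Poly_Mapping.lookup (\<Sum>(u', v')\<in>?G u v. \<QQ> (u' @ v')) w
        = (\<Sum>p\<in>?G u v. if p \<in> splits w then 1 else 0 :: 'k)"
      unfolding lookup_sum
      by (intro sum.cong refl) (simp add: lookup_single when_def case_prod_unfold splits_def)
    also have "\<dots> = (\<Sum>p\<in>splits w. if p \<in> ?G u v then 1 else 0)"
      by (simp add: sum.If_cases fin Int_commute)
    also have "\<dots> = (\<Sum>p\<in>splits w. of_bool (?K p) * (of_bool (pack (fst p) = u) * of_bool (pack (snd p) = v)))"
    proof (intro sum.cong refl)
      fix p assume "p \<in> splits w"
      then have "p \<in> ?G u v \<longleftrightarrow> ?K p \<and> pack (fst p) = u \<and> pack (snd p) = v"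
        by (cases p) (auto simp: split_words_def)
      then show "(if p \<in> ?G u v then 1 else 0 :: 'k)
          = of_bool (?K p) * (of_bool (pack (fst p) = u) * of_bool (pack (snd p) = v))"
        by (simp only: of_bool_def) simp
    qed
    finally show ?thesis .
  qed
  have "Poly_Mapping.lookup (bilin_ext (\<lambda>u v. \<Sum>(u', v')\<in>?G u v. \<QQ> (u' @ v')) x y) w
      = (\<Sum>u\<in>Poly_Mapping.keys x. \<Sum>v\<in>Poly_Mapping.keys y.
          (\<Sum>p\<in>splits w. of_bool (?K p) * (of_bool (pack (fst p) = u) * of_bool (pack (snd p) = v)))
          * (Poly_Mapping.lookup x u * Poly_Mapping.lookup y v))"
    unfolding bilin_ext_def lookup_lin_ext coeff
    by (intro sum.cong refl, subst sum_distrib_left, intro sum.cong refl, simp only: mult_ac)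
  also have "\<dots> = (\<Sum>p\<in>splits w. of_bool (?K p) * (\<Sum>u\<in>Poly_Mapping.keys x. \<Sum>v\<in>Poly_Mapping.keys y.
      of_bool (pack (fst p) = u) * (of_bool (pack (snd p) = v) * (Poly_Mapping.lookup x u * Poly_Mapping.lookup y v))))"
    by (rule sum_swap_factor[symmetric])
  also have "\<dots> = (\<Sum>p\<in>splits w. of_bool (?K p) * (Poly_Mapping.lookup x (pack (fst p)) * Poly_Mapping.lookup y (pack (snd p))))"
  proof (intro sum.cong refl)
    fix p assume "p \<in> splits w"
    have "(\<Sum>v\<in>Poly_Mapping.keys y. of_bool (pack (fst p) = u) * (of_bool (pack (snd p) = v) * (Poly_Mapping.lookup x u * Poly_Mapping.lookup y v)))
        = of_bool (pack (fst p) = u) * (Poly_Mapping.lookup x u * Poly_Mapping.lookup y (pack (snd p)))" for u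
      using sum_keys_of_bool[of "pack (snd p)" y "Poly_Mapping.lookup x u"]
      by (simp add: sum_distrib_left[symmetric] mult.commute)
    then show "of_bool (?K p) * (\<Sum>u\<in>Poly_Mapping.keys x. \<Sum>v\<in>Poly_Mapping.keys y.
      of_bool (pack (fst p) = u) * (of_bool (pack (snd p) = v) * (Poly_Mapping.lookup x u * Poly_Mapping.lookup y v)))
      = of_bool (?K p) * (Poly_Mapping.lookup x (pack (fst p)) * Poly_Mapping.lookup y (pack (snd p)))"
      by (simp only: sum_keys_of_bool)
  qed
  finally show ?thesis
    by (simp only: case_prod_unfold sum_distrib_left of_bool_conj mult.assoc)
qed

lemma splits_map: "splits (map g w) = (\<lambda>(u, v). (map g u, map g v)) ` splits w"
  by (auto simp: splits_def append_eq_map_conv image_iff)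

lemma sum_splits_map:
  "(\<Sum>(u, v)\<in>splits (map g w). F u v) = (\<Sum>(u, v)\<in>splits w. F (map g u) (map g v))"
proof -
  have "inj_on (\<lambda>(u, v). (map g u, map g v)) (splits w)"
  proof (rule inj_onI, clarify)
    fix u v u' v' assume "(u, v) \<in> splits w" "(u', v') \<in> splits w" "map g u = map g u'"
    then have "u @ v = u' @ v'" "length u = length u'"
      by (auto dest: map_eq_imp_length_eq)
    then show "u = u' \<and> v = v'"
      by simp
  qed
  then show ?thesis
    unfolding splits_map by (simp add: sum.reindex case_prod_unfold)
qed

lemma wmax_less_iff_dominates:
  assumes "0 \<notin> set u"
  shows "wmax v < wmax u \<longleftrightarrow> dominates u v"
proof
  assume *: "wmax v < wmax u"
  have "wmax u \<in> insert 0 (set u)"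
    unfolding wmax_def by (rule Max_in) auto
  then have "wmax u \<in> set u" using * by auto
  moreover have "y \<le> wmax v" if "y \<in> set v" for y
    unfolding wmax_def using that by (intro Max_ge) auto
  ultimately show "dominates u v"
    using * unfolding dominates_def by (meson le_less_trans)
next
  assume "dominates u v"
  then obtain x where x: "x \<in> set u" "\<And>y. y \<in> set v \<Longrightarrow> y < x"
    by (auto simp: dominates_def)
  have "wmax v \<in> insert 0 (set v)"
    unfolding wmax_def by (rule Max_in) auto
  then have "wmax v < x"
    using x assms by (cases "x = 0") auto
  moreover have "x \<le> wmax u"
    unfolding wmax_def using x by (intro Max_ge) auto
  ultimately show "wmax v < wmax u" by simp
qed

lemma dominates_map:
  assumes "strict_mono_on (set u \<union> set v) g"
  shows "dominates (map g u) (map g v) \<longleftrightarrow> dominates u v"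
  unfolding dominates_def using strict_mono_on_leq(2)[OF assms] by auto

text \<open>The left side is evaluated at \<open>pack w\<close>, hence on ranks, while
  \<open>conv\<close> refers to the letters of \<open>w\<close>. Passing to ranks is increasing, so
  it preserves disjointness and the packings of the factors, and by assumption it turns
  \<open>R\<close> into \<open>S\<close>.\<close>

lemma hat_half_product:
  fixes x y :: "word \<Rightarrow>\<^sub>0 'k::field"
  assumes R: "\<And>u v. u @ v = w \<Longrightarrow> R (map (rank w) u) (map (rank w) v) \<longleftrightarrow> S u v"
  shows "hat (bilin_ext (\<lambda>u v. \<Sum>(u', v')\<in>{(u', v') \<in> split_words u v. R u' v'}. \<QQ> (u' @ v')) x y) w
    = conv S (hat x) (hat y) w"
proof -
  have "set (map (rank w) u) \<inter> set (map (rank w) v) = {} \<longleftrightarrow> set u \<inter> set v = {}" if "u @ v = w" for u v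
  proof -
    have "inj_on (rank w) (set u \<union> set v)"
      using strict_mono_on_imp_inj_on[OF strict_mono_on_rank[of w]] that by auto
    then show ?thesis
      by (simp add: inj_on_image_Int[symmetric])
  qed
  note disj = this
  have "hat (bilin_ext (\<lambda>u v. \<Sum>(u', v')\<in>{(u', v') \<in> split_words u v. R u' v'}. \<QQ> (u' @ v')) x y) w
      = (\<Sum>(u, v)\<in>splits (map (rank w) w). of_bool (set u \<inter> set v = {} \<and> R u v)
          * (Poly_Mapping.lookup x (pack u) * Poly_Mapping.lookup y (pack v)))"
    by (simp only: hat_def lookup_half_product packed_pack of_bool_eq mult_1 pack_eq[of w, symmetric])
  also have "\<dots> = conv S (hat x) (hat y) w"
    unfolding sum_splits_map conv_def
  proof (intro sum.cong refl, clarify)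
    fix u v assume uv: "(u, v) \<in> splits w"
    then have "set u \<subseteq> set w" "set v \<subseteq> set w"
      by auto
    then show "of_bool (set (map (rank w) u) \<inter> set (map (rank w) v) = {} \<and> R (map (rank w) u) (map (rank w) v))
          * (Poly_Mapping.lookup x (pack (map (rank w) u)) * Poly_Mapping.lookup y (pack (map (rank w) v)))
        = of_bool (set u \<inter> set v = {} \<and> S u v) * (hat x u * hat y v)"
      using uv disj[of u v] R[of u v] by (simp only: pack_map_rank hat_def in_splits)
  qed
  finally show ?thesis .
qed

text \<open>Ranks start at 1, which makes \<open>wmax_less_iff_dominates\<close> applicable to the
  relabelled factors.\<close>

lemma zero_notin_rank: "u @ v = w \<Longrightarrow> 0 \<notin> set (map (rank w) u) \<and> 0 \<notin> set (map (rank w) v)"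
proof -
  assume "u @ v = w"
  then have "set (map (rank w) u) \<subseteq> set (pack w)" "set (map (rank w) v) \<subseteq> set (pack w)"
    by (auto simp: pack_eq)
  then show ?thesis
    unfolding set_pack by (auto simp del: set_map)
qed

lemma strict_mono_on_rank_append: "u @ v = w \<Longrightarrow> strict_mono_on (set u \<union> set v) (rank w)"
  using strict_mono_on_rank[of w] by auto

lemma hat_prec: "hat (x \<prec> y) = hat x \<lhd> hat y"
  unfolding prec_def
  by (rule ext, rule hat_half_product)
    (metis wmax_less_iff_dominates zero_notin_rank dominates_map strict_mono_on_rank_append)

lemma hat_succ: "hat (x \<succ> y) = hat x \<rhd> hat y"
  unfolding succ_def
  by (rule ext, rule hat_half_product)
    (metis wmax_less_iff_dominates zero_notin_rank dominates_map strict_mono_on_rank_append Un_commute)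

section \<open>Coefficients of the operators appending a letter\<close>

abbreviation raise :: "nat \<Rightarrow> nat \<Rightarrow> nat" where
  "raise i a \<equiv> (if i \<le> a then a + 1 else a)"

text \<open>Deleting the last letter and packing undoes \<open>psi_circ\<close>, so \<open>u\<close>
  and \<open>i\<close> can be read off \<open>w\<close>. This is how \<open>Psi\<close>, defined on
  basis elements, becomes the pointwise \<open>fPsi\<close>.\<close>

lemma psi_circ_iff:
  assumes "packed w" "packed u" "1 \<le> i"
  shows "i \<le> wmax u + 1 \<and> psi_circ i u = w \<longleftrightarrow>
    w \<noteq> [] \<and> last w = i \<and> i \<notin> set (butlast w) \<and> pack (butlast w) = u"
proof
  assume L: "i \<le> wmax u + 1 \<and> psi_circ i u = w"
  then have w: "w = map (raise i) u @ [i]"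
    by (simp add: psi_circ_def)
  have "strict_mono_on (set u) (raise i)"
    by (rule strict_mono_onI) auto
  then have "pack (map (raise i) u) = u"
    using assms(2) by (simp only: pack_map pack_packed)
  moreover have "i \<notin> raise i ` set u"
    by auto
  ultimately show "w \<noteq> [] \<and> last w = i \<and> i \<notin> set (butlast w) \<and> pack (butlast w) = u"
    unfolding w by simp
next
  assume R: "w \<noteq> [] \<and> last w = i \<and> i \<notin> set (butlast w) \<and> pack (butlast w) = u"
  then obtain v where w: "w = v @ [i]" "i \<notin> set v" "pack v = u"
    by (metis append_butlast_last_id)
  define M where "M = wmax w"
  have "set w = {1..M}"
    using assms(1) unfolding packed_def M_def .
  then have sw: "insert i (set v) = {1..M}"
    unfolding w(1) by simp
  then have sv: "set v = {1..M} - {i}" and i: "i \<in> {1..M}"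
    using w(2) by blast+
  have "card (set v) = M - 1"
    unfolding sv using i by simp
  then have M: "wmax u = M - 1"
    unfolding w(3)[symmetric] wmax_pack .
  \<comment> \<open>The letter \<open>i\<close> is the only one missing from \<open>v\<close>, so
    packing lowers exactly the letters above \<open>i\<close> by one, and \<open>raise\<close>
    restores them.\<close>
  have "raise i (rank v a) = a" if "a \<in> set v" for a
  proof -
    have a: "1 \<le> a" "a \<le> M" "a \<noteq> i"
      using that unfolding sv by auto
    show ?thesis
    proof (cases "a < i")
      case True
      then have "{b \<in> set v. b \<le> a} = {1..a}"
        unfolding sv using a by auto
      then show ?thesis using True by (simp add: rank_def)
    next
      case False
      then have "{b \<in> set v. b \<le> a} = {1..a} - {i}"
        unfolding sv using a by auto
      then have "rank v a = a - 1"
        using False a i by (simp add: rank_def)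
      then show ?thesis using False a by simp
    qed
  qed
  then have "map (raise i) (pack v) = v"
    by (simp add: pack_eq map_idI del: split_paired_All)
  then have "psi_circ i u = w"
    unfolding psi_circ_def w by simp
  then show "i \<le> wmax u + 1 \<and> psi_circ i u = w"
    using M i by simp
qed

lemma psi_bullet_iff:
  assumes "packed w" "packed u" "1 \<le> i"
  shows "i \<le> wmax u \<and> psi_bullet i u = w \<longleftrightarrow>
    w \<noteq> [] \<and> last w = i \<and> i \<in> set (butlast w) \<and> pack (butlast w) = u"
proof
  assume "i \<le> wmax u \<and> psi_bullet i u = w"
  then show "w \<noteq> [] \<and> last w = i \<and> i \<in> set (butlast w) \<and> pack (butlast w) = u"
    using assms by (auto simp: psi_bullet_def pack_packed packed_def)
next
  assume R: "w \<noteq> [] \<and> last w = i \<and> i \<in> set (butlast w) \<and> pack (butlast w) = u"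
  define v where "v = butlast w"
  have w: "w = v @ [i]" "i \<in> set v" "pack v = u"
    using R append_butlast_last_id[of w] by (auto simp: v_def)
  then have "set v = {1..wmax w}"
    using assms(1) by (auto simp: packed_def)
  then have "packed v"
    by (rule packedI)
  then have "u = v" using w(3) by (simp add: pack_packed)
  then show "i \<le> wmax u \<and> psi_bullet i u = w"
    using w \<open>packed v\<close> by (auto simp: psi_bullet_def packed_def)
qed

lemma packed_psi_circ:
  assumes "packed u" "1 \<le> i" "i \<le> wmax u + 1"
  shows "packed (psi_circ i u)"
proof (rule packedI)
  have su: "set u = {1..wmax u}"
    using assms(1) unfolding packed_def .
  have "y \<in> insert i (raise i ` {1..wmax u})" if "y \<in> {1..wmax u + 1}" for y
  proof (cases y i rule: linorder_cases)
    case less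
    then have "y \<in> raise i ` {1..wmax u}"
      using that assms(2,3) by (intro image_eqI[where x = y]) auto
    then show ?thesis by simp
  next
    case greater
    then have "y \<in> raise i ` {1..wmax u}"
      using that assms(2,3) by (intro image_eqI[where x = "y - 1"]) auto
    then show ?thesis by simp
  qed simp
  moreover have "insert i (raise i ` {1..wmax u}) \<subseteq> {1..wmax u + 1}"
    using assms(2,3) by auto
  ultimately have "insert i (raise i ` {1..wmax u}) = {1..wmax u + 1}"
    by (intro equalityI subsetI) auto
  then show "set (psi_circ i u) = {1..wmax u + 1}"
    unfolding psi_circ_def set_append set_map su by simp
qed

lemma packed_psi_bullet:
  assumes "packed u" "1 \<le> i" "i \<le> wmax u"
  shows "packed (psi_bullet i u)"
proof (rule packedI)
  have su: "set u = {1..wmax u}"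
    using assms(1) unfolding packed_def .
  show "set (psi_bullet i u) = {1..wmax u}"
    unfolding psi_bullet_def set_append su using assms(2,3) by auto
qed

text \<open>Coefficients at words that are not packed are invisible to \<open>hat\<close>; under
  this condition \<open>hat x\<close> determines \<open>x\<close>.\<close>

definition packed_supp :: "(word \<Rightarrow>\<^sub>0 'k::field) \<Rightarrow> bool" where
  "packed_supp x \<longleftrightarrow> Poly_Mapping.keys x \<subseteq> Collect packed"

lemma packed_supp_Psi:
  fixes x :: "word \<Rightarrow>\<^sub>0 'k::field"
  assumes "packed_supp x"
  shows "packed_supp (Psi l x)"
  unfolding packed_supp_def
proof
  obtain i \<alpha> where l: "l = (i, \<alpha>)" by (cases l)
  fix w assume "w \<in> Poly_Mapping.keys (Psi l x)"
  then have "Poly_Mapping.lookup (Psi l x) w \<noteq> 0"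
    by (simp add: in_keys_iff)
  then obtain u where u: "u \<in> Poly_Mapping.keys x" and
    "Poly_Mapping.lookup (if \<alpha> = Circ \<and> 1 \<le> i \<and> i \<le> wmax u + 1 then \<QQ> (psi_circ i u)
     else if \<alpha> = Bullet \<and> 1 \<le> i \<and> i \<le> wmax u then \<QQ> (psi_bullet i u) else 0) w \<noteq> (0 :: 'k)"
    unfolding l Psi_def prod.case lookup_lin_ext by (metis (no_types, lifting) mult_zero_right sum.neutral)
  then show "w \<in> Collect packed"
    using assms packed_psi_circ packed_psi_bullet
    by (auto simp: packed_supp_def lookup_single when_def split: if_splits)
qed

lemma lookup_Psi:
  fixes x :: "word \<Rightarrow>\<^sub>0 'k::field"
  assumes "packed_supp x" "packed w" "1 \<le> i"
  shows "Poly_Mapping.lookup (Psi (i, \<alpha>) x) w =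
    of_bool (w \<noteq> [] \<and> last w = i \<and> (i \<notin> set (butlast w)) = (\<alpha> = Circ)) * Poly_Mapping.lookup x (pack (butlast w))"
proof -
  let ?P = "w \<noteq> [] \<and> last w = i \<and> (i \<notin> set (butlast w)) = (\<alpha> = Circ)"
  have "Poly_Mapping.lookup (Psi (i, \<alpha>) x) w =
    (\<Sum>u\<in>Poly_Mapping.keys x. of_bool (pack (butlast w) = u) * (Poly_Mapping.lookup x u * of_bool ?P))"
    unfolding Psi_def prod.case lookup_lin_ext
  proof (intro sum.cong refl)
    fix u assume "u \<in> Poly_Mapping.keys x"
    then have "packed u"
      using assms(1) by (auto simp: packed_supp_def)
    note iff = psi_circ_iff[OF assms(2) this assms(3)] psi_bullet_iff[OF assms(2) this assms(3)]
    have "Poly_Mapping.lookup (if \<alpha> = Circ \<and> 1 \<le> i \<and> i \<le> wmax u + 1 then \<QQ> (psi_circ i u)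
        else if \<alpha> = Bullet \<and> 1 \<le> i \<and> i \<le> wmax u then \<QQ> (psi_bullet i u) else 0) w
      = (of_bool (?P \<and> pack (butlast w) = u) :: 'k)"
      using iff assms(3) by (cases \<alpha>) (auto simp: lookup_single when_def)
    then show "Poly_Mapping.lookup x u * Poly_Mapping.lookup (if \<alpha> = Circ \<and> 1 \<le> i \<and> i \<le> wmax u + 1 then \<QQ> (psi_circ i u)
        else if \<alpha> = Bullet \<and> 1 \<le> i \<and> i \<le> wmax u then \<QQ> (psi_bullet i u) else 0) w
      = of_bool (pack (butlast w) = u) * (Poly_Mapping.lookup x u * of_bool ?P)"
      by (simp only: of_bool_conj mult_ac)
  qed
  also have "\<dots> = of_bool ?P * Poly_Mapping.lookup x (pack (butlast w))"
    unfolding sum_keys_of_bool by (rule mult.commute)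
  finally show ?thesis .
qed

lemma hat_Psi:
  assumes "packed_supp x" "1 \<le> fst l"
  shows "hat (Psi l x) = fPsi l (hat x)"
proof
  fix w
  obtain i \<alpha> where l: "l = (i, \<alpha>)" by (cases l)
  show "hat (Psi l x) w = fPsi l (hat x) w"
  proof (cases w rule: rev_cases)
    case Nil
    then show ?thesis
      using lookup_Psi[OF assms(1) packed_pack[of "[]"], of i] assms(2) by (simp add: l hat_def)
  next
    case (snoc v c)
    have p: "pack w = map (rank w) v @ [rank w c]"
      by (simp add: snoc pack_eq)
    have inj: "rank w c \<in> rank w ` set v \<longleftrightarrow> c \<in> set v"
      by (rule inj_on_image_mem_iff[OF strict_mono_on_imp_inj_on[OF strict_mono_on_rank[of w]]]) (auto simp: snoc)
    have "hat (Psi l x) w = of_bool (rank w c = i \<and> (i \<notin> rank w ` set v) = (\<alpha> = Circ)) * Poly_Mapping.lookup x (pack (map (rank w) v))"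
      unfolding hat_def l using lookup_Psi[OF assms(1) packed_pack[of w], of i] assms(2) by (simp add: p l)
    also have "pack (map (rank w) v) = pack v"
      by (rule pack_map_rank) (auto simp: snoc)
    also have "(rank w c = i \<and> (i \<notin> rank w ` set v) = (\<alpha> = Circ)) \<longleftrightarrow> (c \<notin> set v) = (\<alpha> = Circ) \<and> rank w c = i"
      using inj by blast
    finally show ?thesis
      unfolding snoc fPsi_snoc by (simp add: l hat_def rank_def snoc)
  qed
qed

section \<open>Coefficients of the half coproducts\<close>

lemma cut_packed:
  assumes "packed u" "i \<in> {1..<wmax u}" "cut u i = (a, b)"
  shows "packed a \<and> a \<noteq> [] \<and> wmax a = i \<and> packed b \<and> b \<noteq> [] \<and> u \<in> shuf i a (map ((+) i) b)"
proof -
  let ?h = "filter (\<lambda>x. i < x) u"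
  have su: "set u = {1..wmax u}"
    using assms(1) by (simp add: packed_def)
  have a: "a = filter (\<lambda>x. x \<le> i) u" and b: "b = pack ?h"
    using assms(3) by (auto simp: cut_def)
  have sa: "set a = {1..i}"
    unfolding a using su assms(2) by auto
  have sh: "set ?h = {i + 1..wmax u}"
    using su assms(2) by auto
  have "set (map (\<lambda>x. x - i) ?h) = (\<lambda>x. x - i) ` {i + 1..wmax u}"
    by (simp only: set_map sh)
  also have "\<dots> = {1..wmax u - i}"
  proof (intro set_eqI iffI)
    fix y assume "y \<in> {1..wmax u - i}"
    then have "y = (y + i) - i" "y + i \<in> {i + 1..wmax u}" by auto
    then show "y \<in> (\<lambda>x. x - i) ` {i + 1..wmax u}" by blast
  qed auto
  finally have "packed (map (\<lambda>x. x - i) ?h)"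
    by (rule packedI)
  moreover have "pack (map (\<lambda>x. x - i) ?h) = pack ?h"
    by (rule pack_map) (auto intro!: strict_mono_onI)
  ultimately have b': "b = map (\<lambda>x. x - i) ?h"
    using b pack_packed by metis
  have "map ((+) i) b = ?h"
    unfolding b' map_map by (rule map_idI) auto
  moreover have "?h \<noteq> []"
    using sh assms(2) by (metis add_leD1 atLeastAtMost_iff atLeastLessThan_iff empty_iff empty_set le_refl less_eq_Suc_le Suc_eq_plus1)
  moreover have "a \<noteq> []"
    using sa assms(2) by auto
  ultimately show ?thesis
    using packedI[OF sa] wmax_interval[OF sa] packed_pack[of ?h] b by (auto simp: shuf_def a[symmetric])
qed

text \<open>Together with \<open>cut_packed\<close>: the packed words with cut \<open>(a, b)\<close>
  are the shuffles of \<open>a\<close> with a copy of \<open>b\<close> shifted above it, and the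
  position of the cut is recovered as \<open>wmax a\<close>.\<close>

lemma cut_shuf:
  assumes "packed a" "packed b" "a \<noteq> []" "b \<noteq> []" "u \<in> shuf (wmax a) a (map ((+) (wmax a)) b)"
  shows "packed u \<and> u \<noteq> [] \<and> wmax a \<in> {1..<wmax u} \<and> cut u (wmax a) = (a, b)"
proof -
  let ?i = "wmax a"
  have pos: "1 \<le> wmax w" if "packed w" "w \<noteq> []" for w
    using that hd_in_set[of w] unfolding packed_def by (metis atLeastAtMost_iff order_trans)
  have "set u = {1..?i} \<union> (+) ?i ` {1..wmax b}"
    using set_shuf[OF assms(5)] assms(1,2) by (simp add: packed_def)
  also have "(+) ?i ` {1..wmax b} = {?i + 1..?i + wmax b}"
    by (simp add: add.commute)
  also have "{1..?i} \<union> {?i + 1..?i + wmax b} = {1..?i + wmax b}"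
    by auto
  finally have su: "set u = {1..?i + wmax b}" .
  have "pack (map ((+) ?i) b) = b"
    using assms(2) by (subst pack_map) (auto intro!: strict_mono_onI simp: pack_packed)
  then have "cut u ?i = (a, b)"
    using assms(5) unfolding cut_def shuf_def by simp
  moreover have "u \<noteq> []"
    using assms(3,5) by (auto simp: shuf_def)
  ultimately show ?thesis
    using packedI[OF su] wmax_interval[OF su] pos[OF assms(1,3)] pos[OF assms(2,4)] by simp
qed

text \<open>The predicate \<open>C\<close> records which positions a half coproduct admits, so both
  are treated at once. Since \<open>wmax a\<close> is the only possible position, a basis word
  contributes to a given pair at most once.\<close>

lemma lookup_half_coproduct:
  fixes x :: "word \<Rightarrow>\<^sub>0 'k::field"
  assumes "packed_supp x" "\<And>u. packed u \<Longrightarrow> u \<noteq> [] \<Longrightarrow> I u = {i \<in> {1..<wmax u}. C i u}"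
  defines "X \<equiv> lin_ext (\<lambda>u. if u = [] then 0 else \<Sum>i\<in>I u. \<QQ> (cut u i)) x"
  shows "Poly_Mapping.lookup X (a, b) \<noteq> 0 \<Longrightarrow> packed a \<and> a \<noteq> [] \<and> packed b \<and> b \<noteq> []"
    and "packed a \<Longrightarrow> packed b \<Longrightarrow> a \<noteq> [] \<Longrightarrow> b \<noteq> [] \<Longrightarrow>
      Poly_Mapping.lookup X (a, b) = cop (wmax a) (\<lambda>u. of_bool (C (wmax a) u) * hat x u) a (map ((+) (wmax a)) b)"
proof -
  have pk: "packed u" if "u \<in> Poly_Mapping.keys x" for u
    using that assms(1) by (auto simp: packed_supp_def)
  have X: "Poly_Mapping.lookup X (a, b) = (\<Sum>u\<in>Poly_Mapping.keys x. Poly_Mapping.lookup x u *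
      (if u = [] then 0 else \<Sum>i\<in>I u. of_bool (cut u i = (a, b))))"
    unfolding X_def lookup_lin_ext by (intro sum.cong refl) (auto simp: lookup_sum lookup_single when_def of_bool_def)
  show "packed a \<and> a \<noteq> [] \<and> packed b \<and> b \<noteq> []" if "Poly_Mapping.lookup X (a, b) \<noteq> 0"
  proof -
    let ?J = "\<lambda>u. if u = [] then 0 else \<Sum>i\<in>I u. of_bool (cut u i = (a, b)) :: 'k"
    have "\<exists>u\<in>Poly_Mapping.keys x. ?J u \<noteq> 0"
    proof (rule ccontr)
      assume "\<not> (\<exists>u\<in>Poly_Mapping.keys x. ?J u \<noteq> 0)"
      then have "?J u = 0" if "u \<in> Poly_Mapping.keys x" for u
        using that by blast
      then have "Poly_Mapping.lookup X (a, b) = 0"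
        unfolding X by (intro sum.neutral ballI) (simp only: mult_zero_right)
      then show False using that by blast
    qed
    then obtain u where u': "u \<in> Poly_Mapping.keys x" "?J u \<noteq> 0"
      by blast
    then have "u \<noteq> []"
      by (metis (full_types))
    then have u: "u \<in> Poly_Mapping.keys x" "u \<noteq> []" "(\<Sum>i\<in>I u. of_bool (cut u i = (a, b)) :: 'k) \<noteq> 0"
      using u' by (simp_all only: if_False not_False_eq_True)
    have "\<exists>i\<in>I u. cut u i = (a, b)"
    proof (rule ccontr)
      assume "\<not> (\<exists>i\<in>I u. cut u i = (a, b))"
      then have "(\<Sum>i\<in>I u. of_bool (cut u i = (a, b)) :: 'k) = 0"
        by (intro sum.neutral) simp
      then show False using u(3) by simp
    qed
    then obtain i where i: "i \<in> I u" "cut u i = (a, b)"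
      by blast
    then have "i \<in> {1..<wmax u}"
      unfolding assms(2)[OF pk[OF u(1)] u(2)] by simp
    then show ?thesis
      using cut_packed[OF pk[OF u(1)] _ i(2)] by blast
  qed
  assume ab: "packed a" "packed b" "a \<noteq> []" "b \<noteq> []"
  let ?S = "shuf (wmax a) a (map ((+) (wmax a)) b)"
  have *: "(if u = [] then 0 else \<Sum>i\<in>I u. of_bool (cut u i = (a, b)))
      = (of_bool (u \<in> ?S) * of_bool (C (wmax a) u) :: 'k)" if u: "packed u" for u
  proof (cases "u \<in> ?S")
    case True
    note cs = cut_shuf[OF ab True]
    then have I: "I u = {i \<in> {1..<wmax u}. C i u}"
      using assms(2)[OF u] by blast
    have "i \<in> {1..<wmax u} \<and> cut u i = (a, b) \<longleftrightarrow> i = wmax a" for i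
      using cs cut_packed[OF u, of i a b] by blast
    then have "(\<Sum>i\<in>I u. of_bool (cut u i = (a, b)) :: 'k) = (\<Sum>i\<in>I u. if i = wmax a then 1 else 0)"
      unfolding I by (intro sum.cong refl) auto
    also have "\<dots> = of_bool (C (wmax a) u)"
      using cs unfolding I by simp
    finally show ?thesis using True cs by simp
  next
    case False
    have "(\<Sum>i\<in>I u. of_bool (cut u i = (a, b)) :: 'k) = 0" if "u \<noteq> []"
      using cut_packed[OF u, of _ a b] False unfolding assms(2)[OF u that]
      by (intro sum.neutral) auto
    then show ?thesis using False by simp
  qed
  have "Poly_Mapping.lookup X (a, b) = (\<Sum>u\<in>Poly_Mapping.keys x. if u \<in> ?S then of_bool (C (wmax a) u) * Poly_Mapping.lookup x u else 0)"
    unfolding X by (intro sum.cong refl) (simp only: * pk, simp add: mult.commute)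
  also have "\<dots> = (\<Sum>u\<in>Poly_Mapping.keys x \<inter> ?S. of_bool (C (wmax a) u) * Poly_Mapping.lookup x u)"
    by (rule sum.inter_restrict[symmetric]) simp
  also have "\<dots> = (\<Sum>u\<in>?S. of_bool (C (wmax a) u) * Poly_Mapping.lookup x u)"
    by (rule sum.mono_neutral_left) (auto simp: in_keys_iff)
  also have "\<dots> = (\<Sum>u\<in>?S. of_bool (C (wmax a) u) * hat x u)"
    using cut_shuf[OF ab] by (intro sum.cong refl) (simp add: hat_def pack_packed)
  finally show "Poly_Mapping.lookup X (a, b) = cop (wmax a) (\<lambda>u. of_bool (C (wmax a) u) * hat x u) a (map ((+) (wmax a)) b)"
    by (simp add: cop_def)
qed

lemma last_packed:
  assumes "packed u" "u \<noteq> []" shows "1 \<le> last u" "last u \<le> wmax u"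
  using last_in_set[OF assms(2)] assms(1) by (auto simp: packed_def)

lemma
  fixes x :: "word \<Rightarrow>\<^sub>0 'k::field"
  assumes "packed_supp x"
  shows Delta_succ_nonzero: "Poly_Mapping.lookup (Delta_succ x) (a, b) \<noteq> 0 \<Longrightarrow> packed a \<and> a \<noteq> [] \<and> packed b \<and> b \<noteq> []"
    and lookup_Delta_succ: "packed a \<Longrightarrow> packed b \<Longrightarrow> a \<noteq> [] \<Longrightarrow> b \<noteq> [] \<Longrightarrow>
      Poly_Mapping.lookup (Delta_succ x) (a, b) = cop (wmax a) (last_high (wmax a) (hat x)) a (map ((+) (wmax a)) b)"
proof -
  have I: "{1..<last u} = {i \<in> {1..<wmax u}. u \<noteq> [] \<and> i < last u}" if "packed u" "u \<noteq> []" for u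
    using last_packed[OF that] that by auto
  have H: "last_high i f = (\<lambda>u. of_bool (u \<noteq> [] \<and> i < last u) * f u)" for i and f :: "word \<Rightarrow> 'k"
    by (auto simp: last_high_def)
  note L = lookup_half_coproduct[where x = x and I = "\<lambda>u. {1..<last u}" and C = "\<lambda>i u. u \<noteq> [] \<and> i < last u" and a = a and b = b]
  show "packed a \<and> a \<noteq> [] \<and> packed b \<and> b \<noteq> []" if "Poly_Mapping.lookup (Delta_succ x) (a, b) \<noteq> 0"
    by (rule L(1)[OF assms I]) (use that in \<open>simp_all only: Delta_succ_def not_False_eq_True\<close>)
  show "Poly_Mapping.lookup (Delta_succ x) (a, b) = cop (wmax a) (last_high (wmax a) (hat x)) a (map ((+) (wmax a)) b)"
    if "packed a" "packed b" "a \<noteq> []" "b \<noteq> []"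
    unfolding H Delta_succ_def by (rule L(2)[OF assms I that])
qed

lemma
  fixes x :: "word \<Rightarrow>\<^sub>0 'k::field"
  assumes "packed_supp x"
  shows Delta_prec_nonzero: "Poly_Mapping.lookup (Delta_prec x) (a, b) \<noteq> 0 \<Longrightarrow> packed a \<and> a \<noteq> [] \<and> packed b \<and> b \<noteq> []"
    and lookup_Delta_prec: "packed a \<Longrightarrow> packed b \<Longrightarrow> a \<noteq> [] \<Longrightarrow> b \<noteq> [] \<Longrightarrow>
      Poly_Mapping.lookup (Delta_prec x) (a, b) = cop (wmax a) (last_low (wmax a) (hat x)) a (map ((+) (wmax a)) b)"
proof -
  have I: "{last u..<wmax u} = {i \<in> {1..<wmax u}. u \<noteq> [] \<and> last u \<le> i}" if "packed u" "u \<noteq> []" for u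
    using last_packed[OF that] that by auto
  have H: "last_low i f = (\<lambda>u. of_bool (u \<noteq> [] \<and> last u \<le> i) * f u)" for i and f :: "word \<Rightarrow> 'k"
    by (auto simp: last_low_def)
  note L = lookup_half_coproduct[where x = x and I = "\<lambda>u. {last u..<wmax u}" and C = "\<lambda>i u. u \<noteq> [] \<and> last u \<le> i" and a = a and b = b]
  show "packed a \<and> a \<noteq> [] \<and> packed b \<and> b \<noteq> []" if "Poly_Mapping.lookup (Delta_prec x) (a, b) \<noteq> 0"
    by (rule L(1)[OF assms I]) (use that in \<open>simp_all only: Delta_prec_def not_False_eq_True\<close>)
  show "Poly_Mapping.lookup (Delta_prec x) (a, b) = cop (wmax a) (last_low (wmax a) (hat x)) a (map ((+) (wmax a)) b)"
    if "packed a" "packed b" "a \<noteq> []" "b \<noteq> []"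
    unfolding H Delta_prec_def by (rule L(2)[OF assms I that])
qed

section \<open>The elements indexed by trees and forests\<close>

lemma packed_suppI:
  "(\<And>w. Poly_Mapping.lookup x w \<noteq> 0 \<Longrightarrow> packed w) \<Longrightarrow> packed_supp x"
  by (auto simp: packed_supp_def in_keys_iff)

lemma packed_suppD: "packed_supp x \<Longrightarrow> Poly_Mapping.lookup x w \<noteq> 0 \<Longrightarrow> packed w"
  by (auto simp: packed_supp_def in_keys_iff)

lemma packed_supp_prec: "packed_supp (x \<prec> y)"
  by (rule packed_suppI) (simp add: prec_def lookup_half_product)

lemma packed_supp_succ: "packed_supp (x \<succ> y)"
  by (rule packed_suppI) (simp add: succ_def lookup_half_product)

lemma packed_supp_sum:
  assumes "\<And>i. i \<in> I \<Longrightarrow> packed_supp (F i)"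
  shows "packed_supp (\<Sum>i\<in>I. fscale (c i) (F i))"
proof (rule packed_suppI)
  fix w assume *: "Poly_Mapping.lookup (\<Sum>i\<in>I. fscale (c i) (F i)) w \<noteq> 0"
  show "packed w"
  proof (rule ccontr)
    assume "\<not> packed w"
    then have "Poly_Mapping.lookup (F i) w = 0" if "i \<in> I" for i
      using packed_suppD[OF assms[OF that]] by blast
    then show False
      using * by (simp add: lookup_sum)
  qed
qed

lemma packed_supp_empty: "packed_supp (\<QQ> [])"
  by (rule packed_suppI) (auto simp: lookup_single when_def packed_def wmax_def split: if_splits)

lemma packed_supp_prec_comb:
  "(\<And>p. p \<in> set ps \<Longrightarrow> packed_supp p) \<Longrightarrow> packed_supp (prec_comb ps)"
  by (cases ps rule: prec_comb.cases) (auto simp: packed_supp_prec packed_supp_empty)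

lemma packed_supp_brace:
  assumes "packed_supp p"
  shows "packed_supp (brace ps p)"
  unfolding brace_def Let_def
  by (rule packed_supp_sum) (use assms in \<open>auto simp: packed_supp_prec packed_supp_succ\<close>)

lemma hat_empty: "hat (\<QQ> []) = empty_ind"
proof
  fix w :: word show "hat (\<QQ> []) w = (empty_ind w :: 'a)"
    by (cases "w = []") (auto simp: hat_def lookup_single when_def dest!: sym[of "[]"])
qed

lemma lprod_unit: "f [] = 0 \<Longrightarrow> f \<lhd> empty_ind = f"
  by (rule ext) (simp add: lprod_empty_ind)

lemma rprod_unit: "f [] = 0 \<Longrightarrow> empty_ind \<rhd> f = f"
  by (rule ext) (simp add: empty_ind_rprod)

lemma hat_prec_comb:
  "(\<And>p. p \<in> set ps \<Longrightarrow> hat p [] = 0) \<Longrightarrow> hat (prec_comb ps) = prec_fold (map hat ps)"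
  by (induction ps rule: prec_comb.induct) (simp_all add: hat_empty hat_prec lprod_unit)

lemma hat_succ_comb:
  assumes "ps \<noteq> []" "\<And>p. p \<in> set ps \<Longrightarrow> hat p [] = 0"
  shows "hat (succ_comb ps) = succ_fold (map hat ps)"
proof -
  have fold: "hat (foldl (\<succ>) p qs) = foldl (\<rhd>) (hat p) (map hat qs)" for p qs
    by (induction qs arbitrary: p) (simp_all add: hat_succ)
  obtain p qs where "ps = p # qs"
    using assms(1) by (cases ps) auto
  then show ?thesis
    using assms(2) by (simp add: succ_comb_def succ_fold_def fold rprod_unit)
qed

lemma sum_splits_index:
  "(\<Sum>(A, B)\<in>splits w. F A B) = (\<Sum>i=0..length w. F (take i w) (drop i w))"
  by (rule sum.reindex_bij_witness[where i = "\<lambda>i. (take i w, drop i w)" and j = "\<lambda>(A, B). length A"])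
    (auto simp: splits_def)

text \<open>For functions that vanish at the empty word, \<open>empty_ind\<close> is a genuine
  one-sided unit, and the case distinctions of \<open>brace\<close> at \<open>i = 0\<close> and
  \<open>i = length ps\<close> disappear.\<close>

lemma hat_brace:
  assumes "\<And>p. p \<in> set ps \<Longrightarrow> hat p [] = 0" "hat q [] = 0"
  shows "hat (brace ps q) = fbrace (map hat ps) (hat q)"
proof
  fix w
  have "hat (brace ps q) w = (\<Sum>i=0..length ps. (-1) ^ (length ps - i) *
      ((prec_fold (map hat (take i ps)) \<rhd> hat q) \<lhd> succ_fold (map hat (drop i ps))) w)"
    unfolding brace_def hat_sum
  proof (intro sum.cong refl)
    fix i assume "i \<in> {0..length ps}"
    define r where "r = (if i = 0 then q else prec_comb (take i ps) \<succ> q)"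
    have "hat p [] = 0" if "p \<in> set (take i ps)" for p
      using assms(1) that by (meson in_set_takeD)
    then have r: "hat r = prec_fold (map hat (take i ps)) \<rhd> hat q"
      by (simp add: r_def hat_succ hat_prec_comb rprod_unit assms(2))
    have "hat p [] = 0" if "p \<in> set (drop i ps)" for p
      using assms(1) that by (meson in_set_dropD)
    then have "hat (if i = length ps then r else r \<prec> succ_comb (drop i ps))
        = hat r \<lhd> succ_fold (map hat (drop i ps))"
      using \<open>i \<in> {0..length ps}\<close> by (simp add: hat_prec hat_succ_comb lprod_unit r)
    then show "(-1) ^ (length ps - i) * hat (let q = if i = 0 then q else prec_comb (take i ps) \<succ> q
          in if i = length ps then q else q \<prec> succ_comb (drop i ps)) w
        = (-1) ^ (length ps - i) *
          ((prec_fold (map hat (take i ps)) \<rhd> hat q) \<lhd> succ_fold (map hat (drop i ps))) w"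
      unfolding Let_def r_def[symmetric] r by simp
  qed
  also have "\<dots> = fbrace (map hat ps) (hat q) w"
    unfolding fbrace_def sum_splits_index by (simp add: take_map drop_map)
  finally show "hat (brace ps q) w = fbrace (map hat ps) (hat q) w" .
qed

abbreviation hO :: "label biplane \<Rightarrow> word \<Rightarrow> 'k::field" where
  "hO t \<equiv> hat (\<OO>_tree t)"

abbreviation hF :: "label biplane list \<Rightarrow> word \<Rightarrow> 'k::field" where
  "hF f \<equiv> hat (\<OO>_forest f)"

lemma fbrace_empty [simp]: "fbrace ps p [] = 0"
  by (simp add: fbrace_def)

lemma fbrace_no_args: "p [] = 0 \<Longrightarrow> fbrace [] p = p"
  by (rule ext) (simp add: fbrace_def lprod_unit rprod_unit)

lemma blue_packed_label: "blue_packed (Node x ls rs) \<Longrightarrow> 1 \<le> fst x"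
  by (cases x) auto

lemma blue_packed_subtrees:
  "blue_packed (Node x ls rs) \<Longrightarrow> t \<in> set ls \<union> set rs \<Longrightarrow> blue_packed t"
  by (cases x) auto

lemma blue_packed_root: "blue_packed (Node x ls rs) \<Longrightarrow> blue_packed (Node x [] rs)"
  by (cases x) auto

lemma tree_basic:
  "blue_packed t \<Longrightarrow> packed_supp (\<OO>_tree t :: word \<Rightarrow>\<^sub>0 'k::field) \<and> hat (\<OO>_tree t :: word \<Rightarrow>\<^sub>0 'k) [] = 0"
proof (induction t rule: blue_packed.induct)
  case (1 i \<alpha> ls rs)
  let ?p = "Psi (i, \<alpha>) (prec_comb (rev (map \<OO>_tree rs))) :: word \<Rightarrow>\<^sub>0 'k"
  have l: "\<And>t. t \<in> set ls \<Longrightarrow> packed_supp (\<OO>_tree t :: word \<Rightarrow>\<^sub>0 'k) \<and> hat (\<OO>_tree t :: word \<Rightarrow>\<^sub>0 'k) [] = 0"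
    and r: "\<And>t. t \<in> set rs \<Longrightarrow> packed_supp (\<OO>_tree t :: word \<Rightarrow>\<^sub>0 'k) \<and> hat (\<OO>_tree t :: word \<Rightarrow>\<^sub>0 'k) [] = 0"
    using 1 by auto
  have q: "packed_supp (prec_comb (rev (map \<OO>_tree rs)) :: word \<Rightarrow>\<^sub>0 'k)"
    by (rule packed_supp_prec_comb) (use r in auto)
  then have p: "packed_supp ?p" "hat ?p [] = 0"
    using packed_supp_Psi hat_Psi[OF q, of "(i, \<alpha>)"] blue_packed_label[OF 1(3)] by auto
  have "hat (brace (map \<OO>_tree ls) ?p) [] = 0"
    by (subst hat_brace) (use l p in auto)
  then show ?case
    using p by (simp add: Let_def packed_supp_brace)
qed

lemma packed_supp_tree: "blue_packed t \<Longrightarrow> packed_supp (\<OO>_tree t)"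
  using tree_basic by blast

lemma hO_Nil: "blue_packed t \<Longrightarrow> hO t [] = 0"
  using tree_basic by blast

lemma packed_supp_forest: "blue_packed_forest f \<Longrightarrow> packed_supp (\<OO>_forest f)"
  unfolding \<OO>_forest_def blue_packed_forest_def
  by (rule packed_supp_prec_comb) (auto simp: packed_supp_tree)

lemma hF_eq: "blue_packed_forest f \<Longrightarrow> hF f = prec_fold (map hO (rev f))"
  unfolding \<OO>_forest_def blue_packed_forest_def
  by (subst hat_prec_comb) (auto simp: hO_Nil rev_map comp_def)

lemma hF_Nil [simp]: "hF [] = empty_ind"
  by (simp add: \<OO>_forest_def hat_empty)

lemma hF_single: "\<OO>_forest [t] = \<OO>_tree t"
  by (simp add: \<OO>_forest_def)

lemma blue_packed_forest_right: "blue_packed (Node x ls rs) \<Longrightarrow> blue_packed_forest rs"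
  using blue_packed_subtrees by (auto simp: blue_packed_forest_def)

lemma blue_packed_forest_left: "blue_packed (Node x ls rs) \<Longrightarrow> blue_packed_forest ls"
  using blue_packed_subtrees by (auto simp: blue_packed_forest_def)

lemma hO_root:
  assumes "blue_packed (Node x ls rs)"
  shows "hO (Node x [] rs) = fPsi x (hF rs)"
  unfolding \<OO>_tree_Node(1)
  by (rule hat_Psi) (use assms in \<open>auto simp: packed_supp_forest blue_packed_forest_right dest: blue_packed_label\<close>)

lemma hO_Node:
  assumes "blue_packed (Node x ls rs)"
  shows "hO (Node x ls rs) = fbrace (map hO ls) (hO (Node x [] rs) :: word \<Rightarrow> 'k::field)"
proof (cases "ls = []")
  case True
  have "hO (Node x [] rs) [] = (0 :: 'k)"
    by (rule hO_Nil[OF blue_packed_root[OF assms]])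
  then show ?thesis
    unfolding True list.map by (rule fbrace_no_args[symmetric])
next
  case False
  have "hat (brace (map \<OO>_tree ls) (\<OO>_tree (Node x [] rs)))
      = fbrace (map hat (map \<OO>_tree ls)) (hO (Node x [] rs) :: word \<Rightarrow> 'k)"
    using hO_Nil[OF blue_packed_root[OF assms]] blue_packed_subtrees[OF assms]
    by (intro hat_brace) (auto simp: hO_Nil)
  then show ?thesis
    unfolding \<OO>_tree_Node(2)[OF False] by (simp add: comp_def)
qed

section \<open>Degree, weight and primitivity of the tree elements\<close>

lemma homog_hO: "blue_packed t \<Longrightarrow> homog (nodes t) (weight t) (hO t :: word \<Rightarrow> 'k::field)"
proof (induction t rule: blue_packed.induct)
  case (1 i \<alpha> ls rs)
  let ?x = "(i, \<alpha>)" and ?O = "hO :: _ \<Rightarrow> word \<Rightarrow> 'k"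
  have IH: "homog (nodes t) (weight t) (?O t)" if "t \<in> set ls \<union> set rs" for t
    using 1 that by auto
  have "homog (sum_list (map nodes (rev rs))) (sum_list (map weight (rev rs))) (hF rs :: word \<Rightarrow> 'k)"
    unfolding hF_eq[OF blue_packed_forest_right[OF 1(3)]]
    by (rule homog_prec_fold) (use IH in auto)
  then have "homog (sum_list (map nodes rs)) (sum_list (map weight rs)) (hF rs :: word \<Rightarrow> 'k)"
    by (simp add: sum_list_rev flip: rev_map)
  from homog_fPsi[OF this, of ?x]
  have "homog (Suc (sum_list (map nodes rs))) (of_bool (\<alpha> = Circ) + sum_list (map weight rs)) (?O (Node ?x [] rs))"
    by (simp only: hO_root[OF 1(3)] snd_conv)
  from homog_fbrace[of ls nodes weight ?O, OF _ this]
  have "homog (Suc (sum_list (map nodes rs)) + sum_list (map nodes ls))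
     (of_bool (\<alpha> = Circ) + sum_list (map weight rs) + sum_list (map weight ls)) (?O (Node ?x ls rs))"
    unfolding hO_Node[OF 1(3)] using IH by blast
  then show ?case
    by (simp add: of_bool_def add_ac del: \<OO>_tree.simps)
qed

definition forest_weight :: "label biplane list \<Rightarrow> nat" where
  "forest_weight f = sum_list (map weight f)"

lemma homog_hF: "blue_packed_forest f \<Longrightarrow> homog (forest_nodes f) (forest_weight f) (hF f)"
  using homog_prec_fold[of "rev f" nodes weight hO]
  by (auto simp: hF_eq homog_hO blue_packed_forest_def forest_nodes_def forest_weight_def rev_map sum_list_rev
      simp flip: rev_map)

text \<open>The two shapes of a blue-packed root match the two criteria: a leaf has degree one, and
  with a right child the conditions on the label are the hypotheses of
  \<open>tprim_fPsi\<close>.\<close>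

lemma tprim_root:
  assumes "blue_packed (Node x ls rs)" "\<And>t. t \<in> set rs \<Longrightarrow> prim_at i (hO t :: word \<Rightarrow> 'k::field)"
  shows "tprim_at i (hO (Node x [] rs) :: word \<Rightarrow> 'k::field)"
proof -
  consider "rs = []" "x = (1, Circ)" | r where "rs = [r]" "x \<noteq> (1, Circ)" "fst x \<le> weight r" "blue_packed r"
    using assms(1) by (cases x) auto
  then show ?thesis
  proof cases
    case 1
    have "homog (nodes (Node x [] rs)) (weight (Node x [] rs)) (hO (Node x [] rs) :: word \<Rightarrow> 'k)"
      by (rule homog_hO) (use 1 in simp)
    moreover have "nodes (Node x [] rs) = 1"
      using 1 by simp
    ultimately show ?thesis
      by (metis tprim_homog_1)
  next
    case 2
    then show ?thesis
      unfolding hO_root[OF assms(1)]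
      by (intro tprim_fPsi[where n = "nodes r" and m = "weight r"]) (simp_all add: hF_single assms(2) homog_hO)
  qed
qed

lemma prim_hO: "blue_packed t \<Longrightarrow> prim_at i (hO t :: word \<Rightarrow> 'k::field)"
proof (induction t rule: blue_packed.induct)
  case (1 j \<alpha> ls rs)
  have "tprim_at i (hO (Node (j, \<alpha>) [] rs) :: word \<Rightarrow> 'k)"
    by (rule tprim_root[OF 1(3)]) (use 1 in auto)
  then show ?case
    unfolding hO_Node[OF 1(3)]
    by (intro prim_fbrace) (use 1 in \<open>auto intro: tprim_imp_prim simp del: \<OO>_tree.simps\<close>)
qed

lemma tprim_hO: "blue_packed (Node x ls rs) \<Longrightarrow> tprim_at i (hO (Node x [] rs))"
  by (rule tprim_root) (auto intro: prim_hO dest: blue_packed_subtrees)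

lemma blue_packed_forest_rev [simp]: "blue_packed_forest (rev f) \<longleftrightarrow> blue_packed_forest f"
  by (simp add: blue_packed_forest_def)

text \<open>The reversal appears because a brace nests its arguments in the given order, whereas
  \<open>\<OO>_forest\<close> starts from the last tree.\<close>

lemma last_high_hO:
  assumes t: "blue_packed (Node x ls rs)"
    and "low i a" "high i b" "b \<noteq> []" "length b \<le> nodes (Node x [] rs)"
  shows "cop i (last_high i (hO (Node x ls rs))) a b = hF (rev ls) a * (hO (Node x [] rs) b :: 'k::field)"
proof -
  have "hF (rev ls) = (prec_fold (map hO ls) :: word \<Rightarrow> 'k)"
    using hF_eq[of "rev ls"] blue_packed_forest_left[OF t] by simp
  moreover have "cop i (last_high i (fbrace (map hO ls) (hO (Node x [] rs)))) a b
      = prec_fold (map hO ls) a * (hO (Node x [] rs) b :: 'k)"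
  proof (rule last_high_fbrace_leading)
    show "length w = nodes (Node x [] rs)" if "hO (Node x [] rs) w \<noteq> (0 :: 'k)" for w
      using homogD[OF homog_hO[OF blue_packed_root[OF t]] that] by blast
  qed (use assms tprim_hO[OF t] blue_packed_subtrees[OF t] prim_hO in \<open>auto simp del: \<OO>_tree.simps\<close>)
  ultimately show ?thesis
    unfolding hO_Node[OF t] by (simp only:)
qed

lemma sum_splits_rev:
  "(\<Sum>(J, A)\<in>splits (rev w). F J A) = (\<Sum>(u, v)\<in>splits w. F (rev v) (rev u))"
  by (rule sum.reindex_bij_witness[where i = "\<lambda>(u, v). (rev v, rev u)" and j = "\<lambda>(J, A). (rev A, rev J)"])
    (auto simp: splits_def rev_swap simp flip: rev_append)

text \<open>The first trees of a forest are the innermost factors of the nested product, and by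
  \<open>cop_prec_fold\<close> these are the ones that go to the low side.\<close>

lemma cop_hF:
  assumes "blue_packed_forest f" "low i a" "high i b"
  shows "cop i (hF f) a b = (\<Sum>(f1, f2)\<in>splits f. hF f1 a * (hF f2 b :: 'k::field))"
proof -
  have "cop i (hF f) a b = (\<Sum>(J, A)\<in>splits (map hO (rev f)). prec_fold A a * (prec_fold J b :: 'k))"
    unfolding hF_eq[OF assms(1)]
    by (rule cop_prec_fold) (use assms prim_hO in \<open>auto simp: blue_packed_forest_def\<close>)
  also have "\<dots> = (\<Sum>(f1, f2)\<in>splits f. prec_fold (map hO (rev f1)) a * prec_fold (map hO (rev f2)) b)"
    unfolding sum_splits_map sum_splits_rev ..
  also have "\<dots> = (\<Sum>(f1, f2)\<in>splits f. hF f1 a * hF f2 b)"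
  proof (intro sum.cong refl, clarify)
    fix f1 f2 assume "(f1, f2) \<in> splits f"
    then have "blue_packed_forest f1" "blue_packed_forest f2"
      using assms(1) by (auto simp: blue_packed_forest_def)
    then show "prec_fold (map hO (rev f1)) a * prec_fold (map hO (rev f2)) b = (hF f1 a * hF f2 b :: 'k)"
      by (simp add: hF_eq)
  qed
  finally show ?thesis .
qed

section \<open>Counting packed words and blue-packed forests\<close>

definition forests :: "nat \<Rightarrow> label biplane list set" where
  "forests n = {f. blue_packed_forest f \<and> forest_nodes f = n}"

definition forests_of_weight :: "nat \<Rightarrow> nat \<Rightarrow> label biplane list set" where
  "forests_of_weight n m = {f \<in> forests n. forest_weight f = m}"

definition words_of_max :: "nat \<Rightarrow> nat \<Rightarrow> word set" where
  "words_of_max n m = {w \<in> PW n. wmax w = m}"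

fun push :: "'a biplane \<Rightarrow> 'a biplane list \<Rightarrow> 'a biplane list" where
  "push t [] = []"
| "push t (Node x ls rs # f) = Node x (t # ls) rs # f"

text \<open>\<open>new_circ g\<close> and \<open>new_bullet g\<close> are the forests from which deleting the root of the first tree,
  and concatenating what remains, leaves \<open>g\<close>; they mirror the words \<open>\<psi>\<^bsub>i\<^esub>(w)\<close> over a word \<open>w\<close>.\<close>

fun new_bullet :: "label biplane list \<Rightarrow> label biplane list set" where
  "new_bullet [] = {}"
| "new_bullet (t # g) = (\<lambda>i. Node (i, Bullet) [] [t] # g) ` {1..weight t} \<union> push t ` new_bullet g"

fun new_circ :: "label biplane list \<Rightarrow> label biplane list set" where
  "new_circ [] = {[Node (1, Circ) [] []]}"
| "new_circ (t # g) = insert (Node (1, Circ) [] [] # t # g)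
    ((\<lambda>i. Node (i, Circ) [] [t] # g) ` {2..weight t} \<union> push t ` new_circ g)"

fun contract :: "'a biplane list \<Rightarrow> 'a biplane list" where
  "contract [] = []"
| "contract (Node x ls rs # f) = ls @ rs @ f"

fun first_colour :: "label biplane list \<Rightarrow> colour" where
  "first_colour (Node x ls rs # f) = snd x"
| "first_colour [] = Circ"

lemma contract_push: "f \<noteq> [] \<Longrightarrow> contract (push t f) = t # contract f \<and> push t f \<noteq> [] \<and> first_colour (push t f) = first_colour f"
  by (cases "(t, f)" rule: push.cases) auto

lemma new_bullet_contract: "f \<in> new_bullet g \<Longrightarrow> f \<noteq> [] \<and> contract f = g \<and> first_colour f = Bullet"
  by (induction g arbitrary: f) (auto simp: contract_push)

lemma new_circ_contract: "f \<in> new_circ g \<Longrightarrow> f \<noteq> [] \<and> contract f = g \<and> first_colour f = Circ"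
  by (induction g arbitrary: f) (auto simp: contract_push)

lemma push_props:
  "f \<noteq> [] \<Longrightarrow> blue_packed_forest (push t f) \<longleftrightarrow> blue_packed t \<and> blue_packed_forest f"
  "f \<noteq> [] \<Longrightarrow> forest_nodes (push t f) = nodes t + forest_nodes f"
  "f \<noteq> [] \<Longrightarrow> forest_weight (push t f) = weight t + forest_weight f"
  by (cases "(t, f)" rule: push.cases; auto simp: blue_packed_forest_def forest_nodes_def forest_weight_def)+

lemma new_bullet_props:
  "f \<in> new_bullet g \<Longrightarrow> blue_packed_forest g \<Longrightarrow>
    blue_packed_forest f \<and> forest_nodes f = Suc (forest_nodes g) \<and> forest_weight f = forest_weight g"
proof (induction g arbitrary: f)
  case (Cons t g)
  show ?case
  proof (cases "f \<in> push t ` new_bullet g")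
    case True
    then obtain f' where f': "f = push t f'" "f' \<in> new_bullet g"
      by blast
    then have "f' \<noteq> []" using new_bullet_contract by blast
    then show ?thesis
      using Cons.IH[OF f'(2)] Cons.prems(2) unfolding f'(1)
      by (simp add: push_props) (simp add: blue_packed_forest_def forest_nodes_def forest_weight_def)
  next
    case False
    then show ?thesis
      using Cons.prems by (auto simp: blue_packed_forest_def forest_nodes_def forest_weight_def)
  qed
qed simp

lemma new_circ_props:
  "f \<in> new_circ g \<Longrightarrow> blue_packed_forest g \<Longrightarrow>
    blue_packed_forest f \<and> forest_nodes f = Suc (forest_nodes g) \<and> forest_weight f = Suc (forest_weight g)"
proof (induction g arbitrary: f)
  case (Cons t g)
  show ?case
  proof (cases "f \<in> push t ` new_circ g")
    case True
    then obtain f' where f': "f = push t f'" "f' \<in> new_circ g"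
      by blast
    then have "f' \<noteq> []" using new_circ_contract by blast
    then show ?thesis
      using Cons.IH[OF f'(2)] Cons.prems(2) unfolding f'(1)
      by (simp add: push_props) (simp add: blue_packed_forest_def forest_nodes_def forest_weight_def)
  next
    case False
    then show ?thesis
      using Cons.prems by (auto simp: blue_packed_forest_def forest_nodes_def forest_weight_def)
  qed
qed (simp add: blue_packed_forest_def forest_nodes_def forest_weight_def)

text \<open>Every chain of right children ends in a leaf \<open>1\<^sup>\<circ>\<close>. Positivity
  guarantees that \<open>{2..weight t}\<close> has exactly one element less than
  \<open>{1..weight t}\<close>.\<close>

lemma weight_pos: "blue_packed t \<Longrightarrow> 1 \<le> weight t"
  by (induction t rule: blue_packed.induct) auto

lemma nodes_pos: "1 \<le> nodes t"
  by (cases t) simp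

lemma inj_push: "inj_on (push t) {f. f \<noteq> []}"
proof (rule inj_onI)
  fix f g assume "f \<in> {f. f \<noteq> []}" "g \<in> {f. f \<noteq> []}" "push t f = push t g"
  then show "f = g"
    by (cases "(t, f)" rule: push.cases; cases "(t, g)" rule: push.cases) auto
qed

lemma finite_new [simp]: "finite (new_bullet g)" "finite (new_circ g)"
  by (induction g) auto

lemma push_ne: "f \<noteq> [] \<Longrightarrow> push t f \<noteq> Node x [] rs # g"
  by (cases "(t, f)" rule: push.cases) auto

lemma card_push: "S \<subseteq> {f. f \<noteq> []} \<Longrightarrow> card (push t ` S) = card S"
  by (rule card_image) (rule inj_on_subset[OF inj_push])

lemma new_nonempty: "new_bullet g \<subseteq> {f. f \<noteq> []}" "new_circ g \<subseteq> {f. f \<noteq> []}"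
  using new_bullet_contract new_circ_contract by blast+

text \<open>A new root takes one tree of \<open>g\<close> as right child and all trees before it as
  left forest; the right child then offers as many labels as its weight.\<close>

lemma card_new_bullet: "card (new_bullet g) = forest_weight g"
proof (induction g)
  case (Cons t g)
  let ?A = "(\<lambda>i. Node (i, Bullet) [] [t] # g) ` {1..weight t}"
  have "inj_on (\<lambda>i. Node (i, Bullet) [] [t] # g) {1..weight t}"
    by (auto simp: inj_on_def)
  from card_image[OF this] have A: "card ?A = weight t"
    by simp
  have B: "card (push t ` new_bullet g) = forest_weight g"
    using card_push[OF new_nonempty(1)] Cons by metis
  have "u \<notin> push t ` new_bullet g" if "u \<in> ?A" for u
  proof
    assume "u \<in> push t ` new_bullet g"
    then obtain f where f: "u = push t f" "f \<noteq> []"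
      using new_nonempty(1)[of g] by blast
    moreover obtain x rs h where "u = Node x [] rs # h"
      using \<open>u \<in> ?A\<close> by blast
    ultimately show False
      using push_ne by metis
  qed
  then have "?A \<inter> push t ` new_bullet g = {}"
    by blast
  then have "card (new_bullet (t # g)) = card ?A + card (push t ` new_bullet g)"
    unfolding new_bullet.simps by (intro card_Un_disjoint) simp_all
  then show ?case
    unfolding A B by (simp add: forest_weight_def)
qed (simp add: forest_weight_def)

text \<open>Label 1 is forbidden above a right child \<open>t\<close>, but a leaf placed just before
  \<open>t\<close> makes up for it, so each tree again offers as many choices as its weight. The
  additional choice is a leaf with all of \<open>g\<close> as left forest.\<close>

lemma card_new_circ:
  "blue_packed_forest g \<Longrightarrow> card (new_circ g) = Suc (forest_weight g)"
proof (induction g)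
  case (Cons t g)
  let ?A = "(\<lambda>i. Node (i, Circ) [] [t] # g) ` {2..weight t}"
  let ?N = "Node (1, Circ) [] [] # t # g"
  have "inj_on (\<lambda>i. Node (i, Circ) [] [t] # g) {2..weight t}"
    by (auto simp: inj_on_def)
  from card_image[OF this] have "card ?A = weight t - 1"
    by simp
  moreover have "1 \<le> weight t"
    using weight_pos[of t] Cons.prems by (simp add: blue_packed_forest_def)
  moreover have "card (insert ?N ?A) = Suc (card ?A)"
    by (rule card_insert_disjoint) auto
  ultimately have A: "card (insert ?N ?A) = weight t"
    by simp
  have "card (new_circ g) = Suc (forest_weight g)"
    using Cons by (simp add: blue_packed_forest_def)
  then have B: "card (push t ` new_circ g) = Suc (forest_weight g)"
    using card_push[OF new_nonempty(2)] by metis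
  have "u \<notin> push t ` new_circ g" if "u \<in> insert ?N ?A" for u
  proof
    assume "u \<in> push t ` new_circ g"
    then obtain f where f: "u = push t f" "f \<noteq> []"
      using new_nonempty(2)[of g] by blast
    moreover obtain x rs h where "u = Node x [] rs # h"
      using \<open>u \<in> insert ?N ?A\<close> by blast
    ultimately show False
      using push_ne by metis
  qed
  then have "insert ?N ?A \<inter> push t ` new_circ g = {}"
    by blast
  then have "card (insert ?N ?A \<union> push t ` new_circ g) = card (insert ?N ?A) + card (push t ` new_circ g)"
    by (intro card_Un_disjoint) simp_all
  then show ?case
    unfolding A B by (simp add: forest_weight_def)
qed (simp add: forest_weight_def)

text \<open>It serves to prove finiteness: every forest of size \<open>n + 1\<close> lies over one
  of size \<open>n\<close>, and only finitely many lie over each.\<close>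

lemma in_new_contract:
  "blue_packed_forest f \<Longrightarrow> f \<noteq> [] \<Longrightarrow> f \<in> new_bullet (contract f) \<union> new_circ (contract f)"
proof -
  have "Node x ls rs # f \<in> new_bullet (ls @ rs @ f) \<union> new_circ (ls @ rs @ f)"
    if "blue_packed (Node x ls rs)" for x ls rs f
    using that
  proof (induction ls)
    case Nil
    obtain i \<alpha> where x: "x = (i, \<alpha>)" by (cases x)
    show ?case
    proof (cases rs)
      case Nil
      then show ?thesis
        using Nil.prems x by (cases f) auto
    next
      case (Cons r rs')
      then have r: "rs = [r]" "(i, \<alpha>) \<noteq> (1, Circ)" "1 \<le> i" "i \<le> weight r"
        using Nil.prems x by auto
      show ?thesis
      proof (cases \<alpha>)
        case Circ
        then have "Node x [] rs # f \<in> (\<lambda>i. Node (i, Circ) [] [r] # f) ` {2..weight r}"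
          using r x by (intro image_eqI[where x = i]) auto
        then show ?thesis using r(1) by simp
      next
        case Bullet
        then have "Node x [] rs # f \<in> (\<lambda>i. Node (i, Bullet) [] [r] # f) ` {1..weight r}"
          using r x by (intro image_eqI[where x = i]) auto
        then show ?thesis using r(1) by simp
      qed
    qed
  next
    case (Cons t ls)
    have "blue_packed (Node x ls rs)"
      using Cons.prems by (cases x) auto
    from Cons.IH[OF this] have "push t (Node x ls rs # f) \<in> push t ` new_bullet (ls @ rs @ f) \<union> push t ` new_circ (ls @ rs @ f)"
      by blast
    then show ?case by auto
  qed
  then show "blue_packed_forest f \<Longrightarrow> f \<noteq> [] \<Longrightarrow> f \<in> new_bullet (contract f) \<union> new_circ (contract f)"
    by (cases f rule: contract.cases) (auto simp: blue_packed_forest_def)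
qed

lemma forests_0: "forests 0 = {[]}"
proof -
  have "f = []" if "forest_nodes f = 0" for f :: "label biplane list"
    using that nodes_pos[of "hd f"] by (cases f) (auto simp: forest_nodes_def)
  then show ?thesis
    by (auto simp: forests_def blue_packed_forest_def forest_nodes_def)
qed

lemma contract_props:
  assumes "blue_packed_forest f" "f \<noteq> []"
  shows "blue_packed_forest (contract f)" "forest_nodes f = Suc (forest_nodes (contract f))"
proof -
  obtain x ls rs g where f: "f = Node x ls rs # g"
    using assms(2) by (cases f rule: contract.cases) auto
  then show "blue_packed_forest (contract f)"
    using assms(1) blue_packed_subtrees[of x ls rs] by (auto simp: blue_packed_forest_def)
  show "forest_nodes f = Suc (forest_nodes (contract f))"
    by (simp add: f forest_nodes_def)
qed

lemma finite_forests: "finite (forests n)"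
proof (induction n)
  case 0
  then show ?case by (simp add: forests_0)
next
  case (Suc n)
  have "forests (Suc n) \<subseteq> (\<Union>g\<in>forests n. new_bullet g \<union> new_circ g)"
  proof
    fix f assume f: "f \<in> forests (Suc n)"
    then have "f \<noteq> []" by (auto simp: forests_def forest_nodes_def)
    then show "f \<in> (\<Union>g\<in>forests n. new_bullet g \<union> new_circ g)"
      using f contract_props[of f] in_new_contract[of f] by (auto simp: forests_def)
  qed
  then show ?case
    using Suc by (auto intro: finite_subset)
qed

text \<open>A forest of weight \<open>m - 1\<close> has \<open>m\<close> extensions by a circle, one
  of weight \<open>m\<close> has \<open>m\<close> by a bullet. They are all distinct, since
  \<open>contract\<close> recovers the smaller forest and \<open>first_colour\<close> the kind of
  extension.\<close>

lemma card_forests_Suc: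
  "m * card (forests_of_weight n (m - 1)) + m * card (forests_of_weight n m) \<le> card (forests_of_weight (Suc n) m)"
proof (cases "m = 0")
  case False
  have fin: "finite (forests_of_weight k j)" for k j
    by (simp add: forests_of_weight_def finite_forests)
  let ?B = "\<Union>g\<in>forests_of_weight n m. new_bullet g" and ?C = "\<Union>g\<in>forests_of_weight n (m - 1). new_circ g"
  have "card ?B = (\<Sum>g\<in>forests_of_weight n m. card (new_bullet g))"
  proof (rule card_UN_disjoint)
    show "\<forall>g\<in>forests_of_weight n m. \<forall>h\<in>forests_of_weight n m. g \<noteq> h \<longrightarrow> new_bullet g \<inter> new_bullet h = {}"
      using new_bullet_contract by blast
  qed (simp_all add: fin)
  also have "\<dots> = m * card (forests_of_weight n m)"
    by (simp add: card_new_bullet forests_of_weight_def)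
  finally have B: "card ?B = m * card (forests_of_weight n m)" .
  have "card ?C = (\<Sum>g\<in>forests_of_weight n (m - 1). card (new_circ g))"
  proof (rule card_UN_disjoint)
    show "\<forall>g\<in>forests_of_weight n (m - 1). \<forall>h\<in>forests_of_weight n (m - 1). g \<noteq> h \<longrightarrow> new_circ g \<inter> new_circ h = {}"
      using new_circ_contract by blast
  qed (simp_all add: fin)
  also have "\<dots> = m * card (forests_of_weight n (m - 1))"
    using False by (simp add: card_new_circ forests_of_weight_def forests_def)
  finally have C: "card ?C = m * card (forests_of_weight n (m - 1))" .
  have "?B \<inter> ?C = {}"
    using new_bullet_contract new_circ_contract by fastforce
  then have "card (?B \<union> ?C) = card ?B + card ?C"
    by (intro card_Un_disjoint) (use fin in auto)
  moreover have "?B \<union> ?C \<subseteq> forests_of_weight (Suc n) m"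
    using False new_bullet_props new_circ_props by (fastforce simp: forests_of_weight_def forests_def)
  then have "card (?B \<union> ?C) \<le> card (forests_of_weight (Suc n) m)"
    by (rule card_mono[OF fin])
  ultimately show ?thesis
    using B C by simp
qed simp

text \<open>The last letter takes one of \<open>m\<close> values. If it occurs only once, deleting
  it and packing lowers the maximum by one; otherwise the maximum stays.\<close>

lemma card_words_Suc:
  "card (words_of_max (Suc n) m) \<le> m * card (words_of_max n (m - 1)) + m * card (words_of_max n m)"
proof -
  have fin: "finite (words_of_max k j)" for k j
    by (simp add: words_of_max_def finite_PW)
  let ?C = "(\<lambda>(i, u). psi_circ i u) ` ({1..m} \<times> words_of_max n (m - 1))"
  let ?B = "(\<lambda>(i, u). psi_bullet i u) ` ({1..m} \<times> words_of_max n m)"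
  have "words_of_max (Suc n) m \<subseteq> ?C \<union> ?B"
  proof
    fix w assume "w \<in> words_of_max (Suc n) m"
    then have w: "packed w" "length w = Suc n" "wmax w = m"
      by (auto simp: words_of_max_def PW_def)
    then have "w \<noteq> []" by auto
    define v i where "v = butlast w" and "i = last w"
    have wv: "w = v @ [i]"
      using \<open>w \<noteq> []\<close> by (simp add: v_def i_def)
    have i: "1 \<le> i" "i \<le> m"
      using last_packed[OF w(1) \<open>w \<noteq> []\<close>] w(3) by (auto simp: i_def)
    have cm: "card (insert i (set v)) = m"
      using packed_card[OF w(1)] w(3) wv by simp
    have u: "packed (pack v)" "length (pack v) = n" "wmax (pack v) = card (set v)"
      using w(2) by (auto simp: packed_pack wmax_pack v_def)
    show "w \<in> ?C \<union> ?B"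
    proof (cases "i \<in> set v")
      case True
      have "psi_bullet i (pack v) = w"
        using psi_bullet_iff[OF w(1) u(1) i(1)] True \<open>w \<noteq> []\<close> by (simp add: v_def i_def)
      moreover have "pack v \<in> words_of_max n m"
        using u cm True by (simp add: words_of_max_def PW_def insert_absorb)
      ultimately have "w \<in> ?B"
        using i by (intro image_eqI[where x = "(i, pack v)"]) auto
      then show ?thesis ..
    next
      case False
      have "psi_circ i (pack v) = w"
        using psi_circ_iff[OF w(1) u(1) i(1)] False \<open>w \<noteq> []\<close> by (simp add: v_def i_def)
      moreover have "pack v \<in> words_of_max n (m - 1)"
        using u cm False by (simp add: words_of_max_def PW_def)
      ultimately have "w \<in> ?C"
        using i by (intro image_eqI[where x = "(i, pack v)"]) auto
      then show ?thesis ..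
    qed
  qed
  then have "card (words_of_max (Suc n) m) \<le> card (?C \<union> ?B)"
    by (rule card_mono[rotated]) (simp add: fin)
  also have "\<dots> \<le> card ?C + card ?B"
    by (rule card_Un_le)
  also have "\<dots> \<le> card ({1..m} \<times> words_of_max n (m - 1)) + card ({1..m} \<times> words_of_max n m)"
    by (intro add_mono card_image_le) (simp_all add: fin)
  finally show ?thesis
    by (simp add: card_cartesian_product)
qed

lemma card_words_le_forests: "card (words_of_max n m) \<le> card (forests_of_weight n m)"
proof (induction n arbitrary: m)
  case 0
  have "words_of_max 0 m = (if m = 0 then {[]} else {})"
    by (auto simp: words_of_max_def PW_def wmax_def packed_def)
  moreover have "forests_of_weight 0 0 = {[]}"
    by (auto simp: forests_of_weight_def forests_0 forest_weight_def)
  ultimately show ?case by simp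
next
  case (Suc n)
  have "card (words_of_max (Suc n) m) \<le> m * card (words_of_max n (m - 1)) + m * card (words_of_max n m)"
    by (rule card_words_Suc)
  also have "\<dots> \<le> m * card (forests_of_weight n (m - 1)) + m * card (forests_of_weight n m)"
    by (intro add_mono mult_le_mono2 Suc)
  also have "\<dots> \<le> card (forests_of_weight (Suc n) m)"
    by (rule card_forests_Suc)
  finally show ?case .
qed

lemma card_PW_le: "card (PW n) \<le> card (forests n)"
proof -
  define M where "M = insert 0 (wmax ` PW n)"
  have M: "finite M" by (simp add: M_def finite_PW)
  have "PW n = (\<Union>m\<in>M. words_of_max n m)"
    by (auto simp: words_of_max_def M_def)
  then have "card (PW n) \<le> (\<Sum>m\<in>M. card (words_of_max n m))"
    using card_UN_le[OF M] by metis
  also have "\<dots> \<le> (\<Sum>m\<in>M. card (forests_of_weight n m))"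
    by (rule sum_mono) (rule card_words_le_forests)
  also have "\<dots> = card (\<Union>m\<in>M. forests_of_weight n m)"
    by (rule card_UN_disjoint[symmetric]) (auto simp: M finite_forests forests_of_weight_def)
  also have "\<dots> \<le> card (forests n)"
    by (rule card_mono) (auto simp: finite_forests forests_of_weight_def)
  finally show ?thesis .
qed

section \<open>Linear independence\<close>

text \<open>Independence of a family rather than of a set: a function that occurs twice already
  gives a relation.\<close>

definition indep_fun :: "('i \<Rightarrow> 'w \<Rightarrow> 'k::field) \<Rightarrow> 'i set \<Rightarrow> bool" where
  "indep_fun F I \<longleftrightarrow> (\<forall>c. (\<forall>w. (\<Sum>i\<in>I. c i * F i w) = 0) \<longrightarrow> (\<forall>i\<in>I. c i = 0))"

lemma indep_funD: "indep_fun F I \<Longrightarrow> (\<And>w. (\<Sum>i\<in>I. c i * F i w) = 0) \<Longrightarrow> i \<in> I \<Longrightarrow> c i = 0"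
  by (auto simp: indep_fun_def)

lemma indep_fun_image:
  assumes "indep_fun F I" "finite I" "inj_on h J" "h ` J \<subseteq> I"
  shows "indep_fun (\<lambda>j. F (h j)) J"
  unfolding indep_fun_def
proof (intro allI impI ballI)
  fix c j assume c: "\<forall>w. (\<Sum>j\<in>J. c j * F (h j) w) = 0" and j: "j \<in> J"
  let ?c = "\<lambda>i. if i \<in> h ` J then c (the_inv_into J h i) else 0"
  have "(\<Sum>i\<in>I. ?c i * F i w) = 0" for w
  proof -
    have "(\<Sum>i\<in>I. ?c i * F i w) = (\<Sum>i\<in>h ` J. ?c i * F i w)"
      by (rule sum.mono_neutral_right) (use assms(2,4) in auto)
    also have "\<dots> = (\<Sum>j\<in>J. c j * F (h j) w)"
      by (subst sum.reindex[OF assms(3)]) (auto intro!: sum.cong simp: the_inv_into_f_f[OF assms(3)])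
    finally show ?thesis using c by simp
  qed
  then have "?c (h j) = 0"
    by (rule indep_funD[OF assms(1)]) (use j assms(4) in auto)
  then show "c j = 0"
    using j by (simp add: the_inv_into_f_f[OF assms(3)])
qed

text \<open>For fixed \<open>b\<close> the hypothesis is a relation among the \<open>F i\<close>,
  whose vanishing coefficients are in turn relations among the \<open>G j\<close>. This is the
  independence of tensor products.\<close>

lemma indep_fun_prod:
  assumes "indep_fun F I" "indep_fun G J"
    and c: "\<And>a b. (\<Sum>i\<in>I. \<Sum>j\<in>J. c i j * (F i a * G j b)) = 0" and ij: "i \<in> I" "j \<in> J"
  shows "c i j = 0"
proof -
  have "(\<Sum>j\<in>J. c i j * G j b) = 0" for b
  proof (rule indep_funD[OF assms(1) _ ij(1), where c = "\<lambda>i. \<Sum>j\<in>J. c i j * G j b"])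
    fix a
    show "(\<Sum>i\<in>I. (\<Sum>j\<in>J. c i j * G j b) * F i a) = 0"
      unfolding sum_distrib_right using c[of a b] by (simp only: mult_ac)
  qed
  then show ?thesis
    by (rule indep_funD[OF assms(2) _ ij(2)])
qed

section \<open>Coefficients that a vanishing coproduct forces to be zero\<close>

definition trees :: "nat \<Rightarrow> label biplane set" where
  "trees n = {t. blue_packed t \<and> nodes t = n}"

definition roots :: "nat \<Rightarrow> label biplane set" where
  "roots n = {t. blue_packed t \<and> nodes t = n \<and> left_forest t = []}"

lemma forests_append:
  "f @ g \<in> forests n \<longleftrightarrow> f \<in> forests (forest_nodes f) \<and> g \<in> forests (forest_nodes g) \<and> forest_nodes f + forest_nodes g = n"
  by (auto simp: forests_def blue_packed_forest_def forest_nodes_def)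

lemma single_forest: "[t] \<in> forests n \<longleftrightarrow> t \<in> trees n"
  by (simp add: forests_def trees_def blue_packed_forest_def forest_nodes_def)

lemma finite_trees: "finite (trees n)"
proof (rule finite_imageD)
  show "finite ((\<lambda>t. [t]) ` trees n)"
    by (rule finite_subset[OF _ finite_forests[of n]]) (auto simp: single_forest)
qed (auto simp: inj_on_def)

lemma roots_subset: "roots n \<subseteq> trees n"
  by (auto simp: roots_def trees_def)

lemma finite_roots: "finite (roots n)"
  using finite_subset[OF roots_subset finite_trees] .

lemma indep_roots_of_forests:
  assumes "indep_fun (hF :: _ \<Rightarrow> word \<Rightarrow> 'k::field) (forests n)"
  shows "indep_fun (hO :: _ \<Rightarrow> word \<Rightarrow> 'k) (roots n)"
proof -
  have "(\<lambda>t. [t]) ` roots n \<subseteq> forests n"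
    using roots_subset[of n] by (auto simp: single_forest)
  then show ?thesis
    using indep_fun_image[OF assms finite_forests, of "\<lambda>t. [t]" "roots n"]
    by (simp add: hF_single inj_on_def)
qed

lemma hF_length: "blue_packed_forest f \<Longrightarrow> hF f w \<noteq> (0 :: 'k::field) \<Longrightarrow> length w = forest_nodes f"
  using homogD[OF homog_hF] by blast

lemma hO_length: "blue_packed t \<Longrightarrow> hO t w \<noteq> (0 :: 'k::field) \<Longrightarrow> length w = nodes t"
  using homogD[OF homog_hO] by blast

text \<open>Pairs of packed words, the second one shifted above the first, index the coefficients of
  the coproduct; by invariance under packing nothing is lost.\<close>

lemma low_packed: "packed a \<Longrightarrow> low (wmax a) a"
  by (auto simp: low_def packed_def)

lemma high_shift: "packed b \<Longrightarrow> high i (map ((+) i) b)"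
  by (auto simp: high_def packed_def)

lemma hat_shift: "hat x (map ((+) i) b) = hat x b"
  by (rule hat_map) (auto intro: strict_mono_onI)

text \<open>In the component of degrees \<open>k\<close> and \<open>n - k\<close>, a forest
  contributes through its cut into forests of these sizes, and a pair of such forests determines
  their concatenation. The relation thus becomes one between products of two smaller independent
  families. Taking for \<open>k\<close> the size of the first tree makes \<open>c f\<close> one of
  its coefficients.\<close>

lemma forest_coeffs:
  fixes c :: "label biplane list \<Rightarrow> 'k::field"
  assumes IH: "\<And>k. k < n \<Longrightarrow> indep_fun (hF :: _ \<Rightarrow> word \<Rightarrow> 'k) (forests k)"
    and c: "\<And>a b. packed a \<Longrightarrow> packed b \<Longrightarrow> a \<noteq> [] \<Longrightarrow> b \<noteq> [] \<Longrightarrow>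
      (\<Sum>f\<in>forests n. c f * cop (wmax a) (hF f) a (map ((+) (wmax a)) b)) = 0"
    and f: "f \<in> forests n" "f = t # g" "g \<noteq> []"
  shows "c f = 0"
proof -
  define k where "k = nodes t"
  have "[t] @ g \<in> forests n"
    using f(1,2) by simp
  then have bt: "[t] \<in> forests k" "g \<in> forests (forest_nodes g)" "k + forest_nodes g = n"
    unfolding forests_append by (simp_all add: k_def forest_nodes_def)
  have "1 \<le> forest_nodes g"
    using f(3) nodes_pos[of "hd g"] by (cases g) (simp_all add: forest_nodes_def)
  then have k: "1 \<le> k" "k < n" "n - k < n" "1 \<le> n - k" "n - k = forest_nodes g"
    using nodes_pos[of t] bt(3) unfolding k_def by linarith+
  have zero: "(\<Sum>f1\<in>forests k. \<Sum>f2\<in>forests (n - k). c (f1 @ f2) * (hF f1 a * hF f2 b)) = 0" for a b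
  proof (cases "length a = k \<and> length b = n - k")
    case False
    have "hF f1 a * hF f2 b = (0 :: 'k)" if "f1 \<in> forests k" "f2 \<in> forests (n - k)" for f1 f2
      using that False hF_length[of f1 a] hF_length[of f2 b] by (auto simp: forests_def)
    then show ?thesis
      by (intro sum.neutral ballI) simp
  next
    case True
    have ne: "pack a \<noteq> []" "pack b \<noteq> []"
      using True k by auto
    let ?i = "wmax (pack a)"
    have "0 = (\<Sum>f\<in>forests n. c f * cop ?i (hF f) (pack a) (map ((+) ?i) (pack b)))"
      using c[OF packed_pack packed_pack ne] by simp
    also have "\<dots> = (\<Sum>f\<in>forests n. \<Sum>p\<in>splits f. c f * (hF (fst p) a * hF (snd p) b))"
    proof (intro sum.cong refl)
      fix f assume "f \<in> forests n"
      then have "blue_packed_forest f" by (simp add: forests_def)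
      then show "c f * cop ?i (hF f) (pack a) (map ((+) ?i) (pack b))
          = (\<Sum>p\<in>splits f. c f * (hF (fst p) a * hF (snd p) b))"
        by (simp add: cop_hF low_packed high_shift packed_pack hat_shift sum_distrib_left case_prod_unfold)
    qed
    also have "\<dots> = (\<Sum>(f, p)\<in>(SIGMA f:forests n. splits f). c f * (hF (fst p) a * hF (snd p) b))"
      by (rule sum.Sigma) (simp_all add: finite_forests)
    also have "\<dots> = (\<Sum>(f, p)\<in>(\<lambda>(f1, f2). (f1 @ f2, (f1, f2))) ` (forests k \<times> forests (n - k)). c f * (hF (fst p) a * hF (snd p) b))"
    proof (rule sum.mono_neutral_right)
      show "finite (SIGMA f:forests n. splits f)"
        by (simp add: finite_forests)
      show "(\<lambda>(f1, f2). (f1 @ f2, (f1, f2))) ` (forests k \<times> forests (n - k)) \<subseteq> (SIGMA f:forests n. splits f)"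
      proof
        fix q assume "q \<in> (\<lambda>(f1, f2). (f1 @ f2, (f1, f2))) ` (forests k \<times> forests (n - k))"
        then obtain f1 f2 where "q = (f1 @ f2, (f1, f2))" "f1 \<in> forests k" "f2 \<in> forests (n - k)"
          by auto
        moreover have "k + (n - k) = n"
          using k(2) by simp
        ultimately show "q \<in> (SIGMA f:forests n. splits f)"
          by (simp add: forests_def blue_packed_forest_def forest_nodes_def ball_Un)
      qed
      show "\<forall>q\<in>(SIGMA f:forests n. splits f) - (\<lambda>(f1, f2). (f1 @ f2, (f1, f2))) ` (forests k \<times> forests (n - k)).
          (case q of (f, p) \<Rightarrow> c f * (hF (fst p) a * hF (snd p) b)) = 0"
      proof (clarify, rule ccontr)
        fix f f1 f2
        assume q: "f \<in> forests n" "(f1, f2) \<in> splits f"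
          "(f, f1, f2) \<notin> (\<lambda>(f1, f2). (f1 @ f2, (f1, f2))) ` (forests k \<times> forests (n - k))"
          "c f * (hF (fst (f1, f2)) a * hF (snd (f1, f2)) b) \<noteq> 0"
        have b: "blue_packed_forest f1" "blue_packed_forest f2"
          using q(1,2) by (simp_all add: forests_def blue_packed_forest_def flip: q(2)[unfolded in_splits])
        have "hF f1 a \<noteq> (0 :: 'k)" "hF f2 b \<noteq> (0 :: 'k)"
          using q(4) by simp_all
        from hF_length[OF b(1) this(1)] hF_length[OF b(2) this(2)]
        have "f1 \<in> forests k" "f2 \<in> forests (n - k)"
          using b True by (simp_all add: forests_def)
        then have "(f1 @ f2, f1, f2) \<in> (\<lambda>(f1, f2). (f1 @ f2, (f1, f2))) ` (forests k \<times> forests (n - k))"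
          by (intro image_eqI[where x = "(f1, f2)"]) simp_all
        then show False
          using q(2,3) by simp
      qed
    qed
    also have "\<dots> = (\<Sum>(f1, f2)\<in>forests k \<times> forests (n - k). c (f1 @ f2) * (hF f1 a * hF f2 b))"
      by (subst sum.reindex) (auto simp: inj_on_def case_prod_unfold)
    also have "\<dots> = (\<Sum>f1\<in>forests k. \<Sum>f2\<in>forests (n - k). c (f1 @ f2) * (hF f1 a * hF f2 b))"
      by (simp add: sum.cartesian_product)
    finally show ?thesis ..
  qed
  have "c ([t] @ g) = 0"
    by (rule indep_fun_prod[OF IH[OF k(2)] IH[OF k(3)], where c = "\<lambda>f1 f2. c (f1 @ f2)"])
      (use zero bt k in simp_all)
  then show ?thesis using f(2) by simp
qed

definition root_part :: "'a biplane \<Rightarrow> 'a biplane" where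
  "root_part t = (case t of Node x ls rs \<Rightarrow> Node x [] rs)"

text \<open>The reversal matches the factor \<open>hF (rev ls)\<close> in
  \<open>last_high_hO\<close>: grafting \<open>rev ls\<close> onto the root part restores the
  tree.\<close>

definition graft :: "'a biplane list \<Rightarrow> 'a biplane \<Rightarrow> 'a biplane" where
  "graft g t = (case t of Node x ls rs \<Rightarrow> Node x (rev g) rs)"

lemma tree_coeffs:
  fixes c :: "label biplane \<Rightarrow> 'k::field"
  assumes IH: "\<And>k. k < n \<Longrightarrow> indep_fun (hF :: _ \<Rightarrow> word \<Rightarrow> 'k) (forests k)"
    and c: "\<And>a b. packed a \<Longrightarrow> packed b \<Longrightarrow> a \<noteq> [] \<Longrightarrow> b \<noteq> [] \<Longrightarrow>
      (\<Sum>t\<in>trees n. c t * cop (wmax a) (last_high (wmax a) (hO t)) a (map ((+) (wmax a)) b)) = 0"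
    and s: "s \<in> trees n" "left_forest s \<noteq> []"
  shows "c s = 0"
proof (rule ccontr)
  assume "c s \<noteq> 0"
  let ?P = "\<lambda>t. t \<in> trees n \<and> left_forest t \<noteq> [] \<and> c t \<noteq> 0"
  \<comment> \<open>Comparison takes place in degree \<open>d\<close>, the least size of a root part
    among the offending trees, because \<open>last_high_hO\<close> is exact only up to the size of
    the root part.\<close>
  obtain t where t: "?P t" and min: "\<And>t'. ?P t' \<Longrightarrow> nodes (root_part t) \<le> nodes (root_part t')"
    using ex_has_least_nat[of ?P s "\<lambda>t. nodes (root_part t)"] s \<open>c s \<noteq> 0\<close> by blast
  define d where "d = nodes (root_part t)"
  define e where "e = forest_nodes (left_forest t)"
  have n: "n = e + d" "1 \<le> d"
    using t by (cases t; simp add: trees_def d_def e_def root_part_def forest_nodes_def)+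
  have e: "1 \<le> e"
    using t nodes_pos[of "hd (left_forest t)"] by (cases "left_forest t") (auto simp: e_def forest_nodes_def)
  have de: "d < n" "e < n"
    using n e by auto
  have zero: "(\<Sum>g\<in>forests e. \<Sum>r\<in>roots d. c (graft g r) * (hF g a * hO r b)) = 0" for a b
  proof (cases "length a = e \<and> length b = d")
    case False
    have "hF g a * hO r b = (0 :: 'k)" if "g \<in> forests e" "r \<in> roots d" for g r
      using that False hF_length[of g a] hO_length[of r b] by (auto simp: forests_def roots_def)
    then show ?thesis
      by (intro sum.neutral ballI) simp
  next
    case True
    have ne: "pack a \<noteq> []" "pack b \<noteq> []"
      using True n e by auto
    let ?i = "wmax (pack a)"
    let ?C = "\<lambda>u. cop ?i (last_high ?i (hO u)) (pack a) (map ((+) ?i) (pack b)) :: 'k"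
    have C: "?C u = hF (rev (left_forest u)) a * hO (root_part u) b"
      if "u \<in> trees n" "d \<le> nodes (root_part u)" for u
    proof -
      obtain x ls rs where u: "u = Node x ls rs" by (cases u)
      have "?C u = hF (rev ls) (pack a) * hO (Node x [] rs) (map ((+) ?i) (pack b))"
        unfolding u by (rule last_high_hO)
          (use that True ne in \<open>auto simp: u trees_def low_packed high_shift packed_pack root_part_def simp del: nodes.simps\<close>)
      then show ?thesis
        by (simp add: u root_part_def hat_shift del: \<OO>_tree.simps)
    qed
    have "0 = (\<Sum>u\<in>trees n. c u * ?C u)"
      using c[OF packed_pack packed_pack ne] by simp
    also have "\<dots> = (\<Sum>u\<in>(\<lambda>(g, r). graft g r) ` (forests e \<times> roots d). c u * ?C u)"
    proof (rule sum.mono_neutral_right[OF finite_trees])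
      show "(\<lambda>(g, r). graft g r) ` (forests e \<times> roots d) \<subseteq> trees n"
      proof clarify
        fix g r assume gr: "g \<in> forests e" "r \<in> roots d"
        obtain x rs where r: "r = Node x [] rs"
          using gr(2) by (cases r) (auto simp: roots_def)
        obtain i \<alpha> where x: "x = (i, \<alpha>)" by (cases x)
        show "graft g r \<in> trees n"
          using gr n by (auto simp: graft_def r x trees_def roots_def forests_def blue_packed_forest_def forest_nodes_def sum_list_rev simp flip: rev_map)
      qed
      show "\<forall>u\<in>trees n - (\<lambda>(g, r). graft g r) ` (forests e \<times> roots d). c u * ?C u = 0"
      proof
        fix u assume u: "u \<in> trees n - (\<lambda>(g, r). graft g r) ` (forests e \<times> roots d)"
        obtain x ls rs where ux: "u = Node x ls rs" by (cases u)
        have bu: "blue_packed (Node x ls rs)" "nodes (Node x ls rs) = n"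
          using u ux by (auto simp: trees_def)
        have br: "blue_packed (root_part u)" "blue_packed_forest (rev ls)"
          using blue_packed_root[OF bu(1)] blue_packed_forest_left[OF bu(1)] by (simp_all add: ux root_part_def)
        have sz: "forest_nodes ls + nodes (root_part u) = n"
          using bu(2) by (simp add: ux root_part_def forest_nodes_def)
        \<comment> \<open>A tree without left forest has a root part of size \<open>n\<close>, which
          exceeds \<open>d\<close>. So a root part smaller than \<open>d\<close> belongs to a tree
          with left forest, and minimality gives \<open>c u = 0\<close>; a larger one vanishes at
          \<open>b\<close>, which has length \<open>d\<close>.\<close>
        show "c u * ?C u = 0"
        proof (cases "nodes (root_part u) = d")
          case True
          have "rev ls \<in> forests e"
            using br sz True n by (simp add: forests_def forest_nodes_def sum_list_rev flip: rev_map)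
          moreover have "root_part u \<in> roots d"
            using br True by (simp add: roots_def) (simp add: ux root_part_def)
          moreover have "u = graft (rev ls) (root_part u)"
            by (simp add: ux root_part_def graft_def)
          ultimately show ?thesis
            using u by (metis (no_types, lifting) DiffD2 SigmaI case_prod_conv image_eqI)
        next
          case False
          show ?thesis
          proof (cases "nodes (root_part u) < d")
            case less: True
            have "ls \<noteq> []"
              using less sz de by (auto simp: forest_nodes_def)
            then have "c u = 0"
              using min[of u] less u ux by (auto simp: d_def)
            then show ?thesis by simp
          next
            case nless: False
            then have "hO (root_part u) b = (0 :: 'k)"
              using hO_length[OF br(1), of b] True False \<open>length a = e \<and> length b = d\<close> by auto
            then show ?thesis
              using C[of u] u nless by simp
          qed
        qed
      qed
    qed
    also have "\<dots> = (\<Sum>(g, r)\<in>forests e \<times> roots d. c (graft g r) * ?C (graft g r))"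
    proof -
      have "inj_on (\<lambda>(g, r). graft g r) (forests e \<times> roots d)"
      proof (rule inj_onI, clarify)
        fix g r g' r' assume "r \<in> roots d" "r' \<in> roots d" "graft g r = graft g' r'"
        then show "g = g' \<and> r = r'"
          by (cases r; cases r') (auto simp: graft_def roots_def)
      qed
      then show ?thesis
        by (simp add: sum.reindex case_prod_unfold)
    qed
    also have "\<dots> = (\<Sum>(g, r)\<in>forests e \<times> roots d. c (graft g r) * (hF g a * hO r b))"
    proof (intro sum.cong refl, clarify)
      fix g r assume gr: "g \<in> forests e" "r \<in> roots d"
      obtain i \<alpha> rs where r: "r = Node (i, \<alpha>) [] rs"
        using gr(2) by (cases r) (auto simp: roots_def)
      have "graft g r \<in> trees n" "nodes (root_part (graft g r)) = d"
        using gr n by (auto simp: graft_def r trees_def roots_def forests_def blue_packed_forest_def forest_nodes_def root_part_def sum_list_rev simp flip: rev_map)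
      then show "c (graft g r) * ?C (graft g r) = c (graft g r) * (hF g a * hO r b)"
        by (subst C) (simp_all add: graft_def r root_part_def del: \<OO>_tree.simps)
    qed
    also have "\<dots> = (\<Sum>g\<in>forests e. \<Sum>r\<in>roots d. c (graft g r) * (hF g a * hO r b))"
      by (simp add: sum.cartesian_product)
    finally show ?thesis ..
  qed
  have "c (graft (rev (left_forest t)) (root_part t)) = 0"
  proof (rule indep_fun_prod[OF IH[OF de(2)] indep_roots_of_forests[OF IH[OF de(1)]], where c = "\<lambda>g r. c (graft g r)"])
    show "(\<Sum>g\<in>forests e. \<Sum>r\<in>roots d. c (graft g r) * (hF g a * hO r b)) = 0" for a b
      by (rule zero)
    obtain x ls rs where tx: "t = Node x ls rs" by (cases t)
    have bt: "blue_packed (Node x ls rs)"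
      using t tx by (auto simp: trees_def)
    show "rev (left_forest t) \<in> forests e"
      using blue_packed_forest_left[OF bt] by (simp add: forests_def e_def tx forest_nodes_def sum_list_rev flip: rev_map)
    show "root_part t \<in> roots d"
      using blue_packed_root[OF bt] by (simp add: roots_def d_def root_part_def tx)
  qed
  moreover have "graft (rev (left_forest t)) (root_part t) = t"
    by (cases t) (simp add: graft_def root_part_def)
  ultimately show False
    using t by simp
qed

text \<open>The word \<open>w\<close> exhibited here is \<open>\<psi>\<^bsub>i\<^esub>(pack v)\<close>; no other label contributes to it.\<close>

lemma fPsi_witness:
  assumes "1 \<le> i" "i \<le> card (set v) + of_bool (\<alpha> = Circ)"
  shows "\<exists>w. \<forall>y (x :: word \<Rightarrow>\<^sub>0 'k::field). fPsi y (hat x) w = of_bool (y = (i, \<alpha>)) * hat x v"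
proof (cases \<alpha>)
  case Circ
  let ?u = "map (raise i) (pack v)"
  have w: "packed (psi_circ i (pack v))" and i: "i \<le> wmax (pack v) + 1"
    using assms Circ by (auto intro!: packed_psi_circ simp: packed_pack wmax_pack)
  have "psi_circ i (pack v) = ?u @ [i]"
    by (simp add: psi_circ_def)
  then have p: "packed (?u @ [i])" using w by simp
  then have s: "insert i (set ?u) = {1..wmax (?u @ [i])}"
    unfolding packed_def by simp
  have "i \<in> {1..wmax (?u @ [i])}"
    unfolding s[symmetric] by simp
  then have "{b \<in> insert i (set ?u). b \<le> i} = {1..i}"
    unfolding s by auto
  then have "card {b \<in> insert i (set ?u). b \<le> i} = i"
    by simp
  moreover have "i \<notin> set ?u"
    by auto
  moreover have "hat x ?u = hat x v" for x :: "word \<Rightarrow>\<^sub>0 'k"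
    by (subst hat_map) (auto intro: strict_mono_onI)
  ultimately have "fPsi y (hat x) (?u @ [i]) = of_bool (y = (i, \<alpha>)) * hat x v" for y and x :: "word \<Rightarrow>\<^sub>0 'k"
    unfolding fPsi_snoc using Circ by (cases y) auto
  then show ?thesis by blast
next
  case Bullet
  let ?u = "pack v"
  have s: "set ?u = {1..card (set v)}"
    by (rule set_pack)
  have i: "i \<in> set ?u"
    unfolding s using assms Bullet by simp
  then have "{b \<in> insert i (set ?u). b \<le> i} = {1..i}"
    unfolding insert_absorb[OF i] unfolding s using assms by auto
  then have "card {b \<in> insert i (set ?u). b \<le> i} = i"
    by simp
  then have "fPsi y (hat x) (?u @ [i]) = of_bool (y = (i, \<alpha>)) * hat x v" for y and x :: "word \<Rightarrow>\<^sub>0 'k"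
    unfolding fPsi_snoc using Bullet i colour.exhaust[of "snd y"] by (cases y) auto
  then show ?thesis by blast
qed

section \<open>Trees without left forest, separated by the last letter\<close>

definition root_label :: "'a biplane \<Rightarrow> 'a" where
  "root_label t = (case t of Node x ls rs \<Rightarrow> x)"

lemma root_eq:
  assumes "r \<in> roots n"
  shows "r = Node (root_label r) [] (right_forest r)"
  using assms by (cases r) (simp add: roots_def root_label_def)

lemma right_forest_root:
  assumes "r \<in> roots n"
  shows "right_forest r \<in> forests (n - 1)"
proof -
  obtain x rs where r: "r = Node x [] rs"
    using root_eq[OF assms] by blast
  then show ?thesis
    using assms blue_packed_forest_right[of x "[]" rs] by (auto simp: roots_def forests_def forest_nodes_def)
qed

lemma hO_root_eq:
  assumes "r \<in> roots n"
  shows "hO r = fPsi (root_label r) (hF (right_forest r))"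
proof -
  have "blue_packed (Node (root_label r) [] (right_forest r))"
    using assms root_eq[OF assms] by (simp add: roots_def)
  from hO_root[OF this] show ?thesis
    using root_eq[OF assms] by metis
qed

text \<open>A word on which \<open>hF rs\<close> is nonzero has as many distinct letters as
  \<open>rs\<close> has weight, so the bound on the label becomes the hypothesis of
  \<open>fPsi_witness\<close>.\<close>

lemma root_hF_zero:
  assumes "Node (i, \<alpha>) [] rs \<in> roots n" "hF rs v \<noteq> (0 :: 'k::field)"
  shows "1 \<le> i \<and> i \<le> card (set v) + of_bool (\<alpha> = Circ)"
proof -
  have b: "blue_packed (Node (i, \<alpha>) [] rs)"
    using assms(1) by (simp add: roots_def)
  have w: "card (set v) = forest_weight rs"
    using homogD[OF homog_hF[OF blue_packed_forest_right[OF b]] assms(2)] by simp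
  from b consider "rs = []" "i = 1" "\<alpha> = Circ" | r where "rs = [r]" "1 \<le> i" "i \<le> weight r"
    by auto
  then show ?thesis
    using w by cases (auto simp: forest_weight_def)
qed

text \<open>Evaluating at the words of \<open>fPsi_witness\<close> isolates the trees with one fixed
  root label; what remains is a relation among their right forests, of size
  \<open>n - 1\<close>.\<close>

lemma indep_roots:
  assumes "indep_fun (hF :: _ \<Rightarrow> word \<Rightarrow> 'k::field) (forests (n - 1))"
  shows "indep_fun (hO :: _ \<Rightarrow> word \<Rightarrow> 'k) (roots n)"
  unfolding indep_fun_def
proof (intro allI impI ballI)
  fix c :: "label biplane \<Rightarrow> 'k" and r0
  assume c: "\<forall>w. (\<Sum>r\<in>roots n. c r * hO r w) = 0" and r0: "r0 \<in> roots n"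
  obtain i \<alpha> where l: "root_label r0 = (i, \<alpha>)" by (cases "root_label r0")
  let ?N = "\<lambda>rs. Node (i, \<alpha>) [] rs"
  \<comment> \<open>Extended by zero to all forests of size \<open>n - 1\<close>, including those
    with several trees, because independence is given for the whole family.\<close>
  let ?c = "\<lambda>rs. if ?N rs \<in> roots n then c (?N rs) else 0"
  have "(\<Sum>rs\<in>forests (n - 1). ?c rs * hF rs v) = 0" for v
  proof (cases "1 \<le> i \<and> i \<le> card (set v) + of_bool (\<alpha> = Circ)")
    case False
    then have "?c rs * hF rs v = 0" for rs
      using root_hF_zero[of i \<alpha> rs n v] by auto
    then show ?thesis
      by (intro sum.neutral ballI)
  next
    case True
    then obtain w where w: "\<And>y (x :: word \<Rightarrow>\<^sub>0 'k). fPsi y (hat x) w = of_bool (y = (i, \<alpha>)) * hat x v"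
      using fPsi_witness by blast
    let ?R = "{r \<in> roots n. root_label r = (i, \<alpha>)}"
    have "0 = (\<Sum>r\<in>roots n. c r * hO r w)"
      using c by simp
    also have "\<dots> = (\<Sum>r\<in>roots n. if root_label r = (i, \<alpha>) then ?c (right_forest r) * hF (right_forest r) v else 0)"
    proof (intro sum.cong refl)
      fix r assume r: "r \<in> roots n"
      show "c r * hO r w = (if root_label r = (i, \<alpha>) then ?c (right_forest r) * hF (right_forest r) v else 0)"
        unfolding hO_root_eq[OF r] w using r root_eq[OF r] by auto
    qed
    also have "\<dots> = (\<Sum>r\<in>?R. ?c (right_forest r) * hF (right_forest r) v)"
      by (rule sum.inter_filter[symmetric]) (rule finite_roots)
    also have "\<dots> = (\<Sum>rs\<in>right_forest ` ?R. ?c rs * hF rs v)"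
    proof -
      have "inj_on right_forest ?R"
        by (rule inj_onI) (metis (mono_tags, lifting) mem_Collect_eq root_eq)
      then show ?thesis
        by (simp add: sum.reindex)
    qed
    also have "\<dots> = (\<Sum>rs\<in>forests (n - 1). ?c rs * hF rs v)"
    proof (rule sum.mono_neutral_left[OF finite_forests])
      show "right_forest ` ?R \<subseteq> forests (n - 1)"
        using right_forest_root by blast
      show "\<forall>rs\<in>forests (n - 1) - right_forest ` ?R. ?c rs * hF rs v = 0"
      proof
        fix rs assume rs: "rs \<in> forests (n - 1) - right_forest ` ?R"
        have "?N rs \<notin> roots n"
        proof
          assume "?N rs \<in> roots n"
          then have "right_forest (?N rs) \<in> right_forest ` ?R"
            by (intro imageI) (simp add: root_label_def)
          then show False using rs by simp
        qed
        then show "?c rs * hF rs v = 0" by simp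
      qed
    qed
    finally show ?thesis ..
  qed
  then have "?c (right_forest r0) = 0"
    by (rule indep_funD[OF assms _ right_forest_root[OF r0]])
  then show "c r0 = 0"
    using root_eq[OF r0] r0 unfolding l by metis
qed

lemma forests_cases:
  assumes "f \<in> forests n" "1 \<le> n"
  obtains t where "f = [t]" "t \<in> trees n" | t g where "f = t # g" "g \<noteq> []"
proof (cases f)
  case Nil
  then show ?thesis using assms by (simp add: forests_def forest_nodes_def)
next
  case (Cons t g)
  then show ?thesis using that assms single_forest by (cases "g = []") auto
qed

lemma sum_forests_trees:
  assumes "1 \<le> n" "\<And>f t g. f \<in> forests n \<Longrightarrow> f = t # g \<Longrightarrow> g \<noteq> [] \<Longrightarrow> F f = (0 :: 'v::comm_monoid_add)"
  shows "(\<Sum>f\<in>forests n. F f) = (\<Sum>t\<in>trees n. F [t])"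
proof -
  have "(\<Sum>f\<in>forests n. F f) = (\<Sum>f\<in>(\<lambda>t. [t]) ` trees n. F f)"
  proof (rule sum.mono_neutral_right[OF finite_forests])
    show "(\<lambda>t. [t]) ` trees n \<subseteq> forests n"
      by (auto simp: single_forest)
    show "\<forall>f\<in>forests n - (\<lambda>t. [t]) ` trees n. F f = 0"
    proof
      fix f assume f: "f \<in> forests n - (\<lambda>t. [t]) ` trees n"
      then have "f \<in> forests n" by simp
      then show "F f = 0"
        by (rule forests_cases[OF _ assms(1)]) (use f assms(2) in auto)
    qed
  qed
  also have "\<dots> = (\<Sum>t\<in>trees n. F [t])"
    by (subst sum.reindex) (auto simp: inj_on_def)
  finally show ?thesis .
qed

lemma sum_trees_roots:
  assumes "\<And>t. t \<in> trees n \<Longrightarrow> left_forest t \<noteq> [] \<Longrightarrow> F t = (0 :: 'v::comm_monoid_add)"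
  shows "(\<Sum>t\<in>trees n. F t) = (\<Sum>t\<in>roots n. F t)"
  by (rule sum.mono_neutral_right[OF finite_trees roots_subset])
    (use assms in \<open>auto simp: trees_def roots_def\<close>)

lemma indep_forests: "indep_fun (hF :: _ \<Rightarrow> word \<Rightarrow> 'k::field) (forests n)"
proof (induction n rule: less_induct)
  case (less n)
  show ?case
  proof (cases "n = 0")
    case True
    have "c [] = 0" if "\<forall>w. (\<Sum>f\<in>forests 0. c f * hF f w) = 0" for c :: "_ \<Rightarrow> 'k"
      using that[rule_format, of "[]"] by (simp add: forests_0)
    then show ?thesis
      unfolding indep_fun_def True forests_0 by auto
  next
    case False
    then have n: "1 \<le> n" by simp
    show ?thesis
      unfolding indep_fun_def
    proof (intro allI impI ballI)
      fix c :: "label biplane list \<Rightarrow> 'k" and f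
      assume c: "\<forall>w. (\<Sum>f\<in>forests n. c f * hF f w) = 0" and f: "f \<in> forests n"
      have Z1: "c f = 0" if "f \<in> forests n" "f = t # g" "g \<noteq> []" for f t g
      proof (rule forest_coeffs[OF less _ that])
        fix a b :: word
        show "(\<Sum>f\<in>forests n. c f * cop (wmax a) (hF f) a (map ((+) (wmax a)) b)) = 0"
          unfolding cop_sum[symmetric] using c by (simp add: cop_def)
      qed
      have c2: "(\<Sum>t\<in>trees n. c [t] * hO t w) = 0" for w
        using c sum_forests_trees[OF n, of "\<lambda>f. c f * hF f w"] Z1 by (simp add: hF_single)
      have Z2: "c [t] = 0" if "t \<in> trees n" "left_forest t \<noteq> []" for t
      proof (rule tree_coeffs[OF less _ that, where c = "\<lambda>t. c [t]"])
        fix a b :: word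
        show "(\<Sum>t\<in>trees n. c [t] * cop (wmax a) (last_high (wmax a) (hO t)) a (map ((+) (wmax a)) b)) = 0"
          unfolding cop_sum[symmetric] last_high_sum[symmetric] c2 by (simp add: cop_def last_high_def)
      qed
      have c3: "(\<Sum>r\<in>roots n. c [r] * hO r w) = 0" for w
        using c2[of w] sum_trees_roots[of n "\<lambda>t. c [t] * hO t w"] Z2 by simp
      have Z3: "c [r] = 0" if "r \<in> roots n" for r
      proof -
        have "indep_fun (hF :: _ \<Rightarrow> word \<Rightarrow> 'k) (forests (n - 1))"
          using less[of "n - 1"] n by simp
        from indep_funD[OF indep_roots[OF this] c3 that] show ?thesis .
      qed
      from f n show "c f = 0"
      proof (cases rule: forests_cases)
        case (1 t)
        then show ?thesis
          using Z2[of t] Z3[of t] by (cases "left_forest t = []") (auto simp: trees_def roots_def)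
      qed (use Z1 f in blast)
    qed
  qed
qed


section \<open>The bases\<close>

text \<open>Since \<open>hat\<close> is linear, a relation among the elements passes to their
  functions. A coincidence \<open>e i = e j\<close> is itself such a relation, with coefficients 1
  and -1.\<close>

lemma free_family:
  fixes e :: "'i \<Rightarrow> (word \<Rightarrow>\<^sub>0 'k::field)"
  assumes "indep_fun (\<lambda>i. hat (e i)) I" "finite I"
  shows "inj_on e I" "free.independent (e ` I)"
proof -
  have lin: "\<forall>i\<in>I. c i = 0" if "(\<Sum>i\<in>I. fscale (c i) (e i)) = 0" for c
  proof
    fix i assume "i \<in> I"
    have "(\<Sum>i\<in>I. c i * hat (e i) w) = 0" for w
      using that hat_sum[of c e I w] by (simp add: hat_def)
    then show "c i = 0"
      by (rule indep_funD[OF assms(1) _ \<open>i \<in> I\<close>])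
  qed
  show inj: "inj_on e I"
  proof (rule inj_onI, rule ccontr)
    fix i j assume ij: "i \<in> I" "j \<in> I" "e i = e j" "i \<noteq> j"
    let ?c = "(\<lambda>_. 0)(i := 1, j := -1) :: 'i \<Rightarrow> 'k"
    have "(\<Sum>k\<in>I. fscale (?c k) (e k)) = (\<Sum>k\<in>{i, j}. fscale (?c k) (e k))"
      by (rule sum.mono_neutral_right) (use assms(2) ij in \<open>auto simp: free.scale_zero_left\<close>)
    also have "\<dots> = 0"
      using ij by (simp add: free.scale_minus_left)
    finally have "?c i = 0"
      using lin[of ?c] ij(1) by blast
    then show False using ij(4) by simp
  qed
  show "free.independent (e ` I)"
    unfolding free.dependent_finite[OF finite_imageI[OF assms(2)]]
  proof clarify
    fix u v assume "v \<in> I" "u (e v) \<noteq> 0" "(\<Sum>x\<in>e ` I. fscale (u x) x) = 0"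
    then have "(\<Sum>i\<in>I. fscale (u (e i)) (e i)) = 0"
      by (simp add: sum.reindex[OF inj])
    then have "u (e v) = 0"
      using lin[of "\<lambda>i. u (e i)"] \<open>v \<in> I\<close> by blast
    then show False using \<open>u (e v) \<noteq> 0\<close> by blast
  qed
qed

lemma in_span_family:
  assumes "inj_on e I" "finite I"
  shows "x \<in> free.span (e ` I) \<longleftrightarrow> (\<exists>c. x = (\<Sum>i\<in>I. fscale (c i) (e i)))"
proof
  assume "x \<in> free.span (e ` I)"
  then obtain u where "x = (\<Sum>v\<in>e ` I. fscale (u v) v)"
    unfolding free.span_finite[OF finite_imageI[OF assms(2)]] by blast
  then show "\<exists>c. x = (\<Sum>i\<in>I. fscale (c i) (e i))"
    by (intro exI[of _ "\<lambda>i. u (e i)"]) (simp add: sum.reindex[OF assms(1)])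
next
  assume "\<exists>c. x = (\<Sum>i\<in>I. fscale (c i) (e i))"
  then obtain c where c: "x = (\<Sum>i\<in>I. fscale (c i) (e i))"
    by blast
  show "x \<in> free.span (e ` I)"
    unfolding c by (intro free.span_sum free.span_scale free.span_base imageI)
qed

lemma WQSym_span: "WQSym n \<subseteq> free.span ((\<QQ> :: word \<Rightarrow> (word \<Rightarrow>\<^sub>0 'k::field)) ` PW n)"
proof
  fix x :: "word \<Rightarrow>\<^sub>0 'k" assume "x \<in> WQSym n"
  then have k: "Poly_Mapping.keys x \<subseteq> PW n"
    by (simp add: WQSym_def)
  have "x = (\<Sum>w\<in>Poly_Mapping.keys x. fscale (Poly_Mapping.lookup x w) (\<QQ> w))"
    by (rule poly_mapping_eqI)
      (auto simp: lookup_sum lookup_single when_def in_keys_iff if_distrib[of "(*) _"] cong: if_cong)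
  moreover have "(\<Sum>w\<in>Poly_Mapping.keys x. fscale (Poly_Mapping.lookup x w) (\<QQ> w)) \<in> free.span (\<QQ> ` PW n)"
    using k by (intro free.span_sum free.span_scale free.span_base) auto
  ultimately show "x \<in> free.span (\<QQ> ` PW n)" by simp
qed

lemma WQSym_iff:
  "x \<in> WQSym n \<longleftrightarrow> packed_supp x \<and> (\<forall>w. hat x w \<noteq> 0 \<longrightarrow> length w = n)"
proof
  assume "x \<in> WQSym n"
  then show "packed_supp x \<and> (\<forall>w. hat x w \<noteq> 0 \<longrightarrow> length w = n)"
    by (auto simp: WQSym_def packed_supp_def PW_def hat_def simp flip: in_keys_iff)
next
  assume *: "packed_supp x \<and> (\<forall>w. hat x w \<noteq> 0 \<longrightarrow> length w = n)"
  have "w \<in> PW n" if "w \<in> Poly_Mapping.keys x" for w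
  proof -
    have p: "packed w"
      using * that by (auto simp: packed_supp_def)
    then have "hat x w \<noteq> 0"
      using that by (simp add: hat_def pack_packed in_keys_iff)
    then show ?thesis
      using * p by (simp add: PW_def)
  qed
  then show "x \<in> WQSym n"
    by (auto simp: WQSym_def)
qed

lemma forest_in_WQSym: "f \<in> forests n \<Longrightarrow> \<OO>_forest f \<in> WQSym n"
  using hF_length by (auto simp: WQSym_iff forests_def packed_supp_forest)

lemma WQSym_sum: "(\<And>i. i \<in> I \<Longrightarrow> F i \<in> WQSym n) \<Longrightarrow> (\<Sum>i\<in>I. fscale (c i) (F i)) \<in> WQSym n"
  unfolding WQSym_iff
proof (intro conjI allI impI)
  assume F: "\<And>i. i \<in> I \<Longrightarrow> packed_supp (F i) \<and> (\<forall>w. hat (F i) w \<noteq> 0 \<longrightarrow> length w = n)"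
  show "packed_supp (\<Sum>i\<in>I. fscale (c i) (F i))"
    by (rule packed_supp_sum) (use F in blast)
  fix w assume "hat (\<Sum>i\<in>I. fscale (c i) (F i)) w \<noteq> 0"
  then obtain i where "i \<in> I" "c i * hat (F i) w \<noteq> 0"
    unfolding hat_sum by (meson sum.neutral)
  then show "length w = n" using F by auto
qed

text \<open>An element outside the span would enlarge an independent set that already has at least
  as many elements as \<open>PW n\<close>, although everything lies in the span of the
  \<open>PW n\<close> basis elements; the exchange bound forbids this.\<close>

lemma forest_basis:
  "is_basis_family (\<OO>_forest :: _ \<Rightarrow> (word \<Rightarrow>\<^sub>0 'k::field)) (forests n) (WQSym n)"
proof -
  let ?B = "(\<OO>_forest :: _ \<Rightarrow> (word \<Rightarrow>\<^sub>0 'k)) ` forests n"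
  note free = free_family[OF indep_forests finite_forests, of n, where 'k = 'k]
  have "WQSym n \<subseteq> free.span ?B"
  proof (rule subsetI, rule ccontr)
    fix x :: "word \<Rightarrow>\<^sub>0 'k" assume x: "x \<in> WQSym n" "x \<notin> free.span ?B"
    then have "free.independent (insert x ?B)"
      using free.independent_insertI free(2) by blast
    moreover have "insert x ?B \<subseteq> free.span (\<QQ> ` PW n)"
      using x(1) WQSym_span forest_in_WQSym by blast
    ultimately have "card (insert x ?B) \<le> card ((\<QQ> :: word \<Rightarrow> (word \<Rightarrow>\<^sub>0 'k)) ` PW n)"
      using free.independent_span_bound[OF finite_imageI[OF finite_PW]] by blast
    also have "\<dots> \<le> card (PW n)"
      by (rule card_image_le[OF finite_PW])
    also have "\<dots> \<le> card ?B"
      using card_PW_le[of n] card_image[OF free(1)] by simp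
    also have "\<dots> < card (insert x ?B)"
    proof -
      have "x \<notin> ?B"
        using x(2) free.span_base by blast
      then show ?thesis
        by (simp add: finite_forests)
    qed
    finally show False by simp
  qed
  moreover have "free.span ?B \<subseteq> WQSym n"
  proof
    fix x assume "x \<in> free.span ?B"
    then obtain c where c: "x = (\<Sum>f\<in>forests n. fscale (c f) (\<OO>_forest f))"
      unfolding in_span_family[OF free(1) finite_forests] by blast
    show "x \<in> WQSym n"
      unfolding c by (rule WQSym_sum) (rule forest_in_WQSym)
  qed
  ultimately have "free.span ?B = WQSym n"
    by (rule equalityI[rotated])
  then show ?thesis
    unfolding is_basis_family_def using free by blast
qed

lemma tree_in_WQSym: "t \<in> trees n \<Longrightarrow> \<OO>_tree t \<in> WQSym n"
  using forest_in_WQSym[of "[t]" n] by (simp add: single_forest hF_single)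

section \<open>Primitive and totally primitive elements\<close>

lemma tensor_eq_0_iff:
  fixes X :: "word \<times> word \<Rightarrow>\<^sub>0 'k::field"
  assumes L: "\<And>a b. packed a \<Longrightarrow> packed b \<Longrightarrow> a \<noteq> [] \<Longrightarrow> b \<noteq> [] \<Longrightarrow> Poly_Mapping.lookup X (a, b) = K a b"
    and Z: "\<And>a b. Poly_Mapping.lookup X (a, b) \<noteq> 0 \<Longrightarrow> packed a \<and> a \<noteq> [] \<and> packed b \<and> b \<noteq> []"
  shows "X = 0 \<longleftrightarrow> (\<forall>a b. packed a \<longrightarrow> packed b \<longrightarrow> a \<noteq> [] \<longrightarrow> b \<noteq> [] \<longrightarrow> K a b = 0)"
proof
  assume X: "X = 0"
  show "\<forall>a b. packed a \<longrightarrow> packed b \<longrightarrow> a \<noteq> [] \<longrightarrow> b \<noteq> [] \<longrightarrow> K a b = 0"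
  proof (intro allI impI)
    fix a b assume "packed a" "packed b" "a \<noteq> []" "b \<noteq> []"
    from L[OF this] show "K a b = 0"
      unfolding X by simp
  qed
next
  assume R: "\<forall>a b. packed a \<longrightarrow> packed b \<longrightarrow> a \<noteq> [] \<longrightarrow> b \<noteq> [] \<longrightarrow> K a b = 0"
  show "X = 0"
  proof (rule poly_mapping_eqI)
    fix p :: "word \<times> word"
    obtain a b where p: "p = (a, b)" by (cases p)
    have "Poly_Mapping.lookup X (a, b) = 0"
    proof (rule ccontr)
      assume *: "Poly_Mapping.lookup X (a, b) \<noteq> 0"
      from Z[OF *] have "Poly_Mapping.lookup X (a, b) = K a b" "K a b = 0"
        using L[of a b] R by blast+
      then show False using * by simp
    qed
    then show "Poly_Mapping.lookup X p = Poly_Mapping.lookup 0 p"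
      by (simp add: p)
  qed
qed

lemma Delta_succ_eq_0_iff:
  assumes "packed_supp x"
  shows "Delta_succ x = 0 \<longleftrightarrow> (\<forall>a b. packed a \<longrightarrow> packed b \<longrightarrow> a \<noteq> [] \<longrightarrow> b \<noteq> [] \<longrightarrow>
     cop (wmax a) (last_high (wmax a) (hat x)) a (map ((+) (wmax a)) b) = 0)"
  by (rule tensor_eq_0_iff[OF lookup_Delta_succ[OF assms] Delta_succ_nonzero[OF assms]])

lemma Delta_prec_eq_0_iff:
  assumes "packed_supp x"
  shows "Delta_prec x = 0 \<longleftrightarrow> (\<forall>a b. packed a \<longrightarrow> packed b \<longrightarrow> a \<noteq> [] \<longrightarrow> b \<noteq> [] \<longrightarrow>
     cop (wmax a) (last_low (wmax a) (hat x)) a (map ((+) (wmax a)) b) = 0)"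
  by (rule tensor_eq_0_iff[OF lookup_Delta_prec[OF assms] Delta_prec_nonzero[OF assms]])

lemma Delta_eq_0_iff:
  assumes "packed_supp x"
  shows "Delta_prec x + Delta_succ x = 0 \<longleftrightarrow> (\<forall>a b. packed a \<longrightarrow> packed b \<longrightarrow> a \<noteq> [] \<longrightarrow> b \<noteq> [] \<longrightarrow>
     cop (wmax a) (hat x) a (map ((+) (wmax a)) b) = 0)"
proof (rule tensor_eq_0_iff)
  fix a b
  show "Poly_Mapping.lookup (Delta_prec x + Delta_succ x) (a, b) = cop (wmax a) (hat x) a (map ((+) (wmax a)) b)"
    if "packed a" "packed b" "a \<noteq> []" "b \<noteq> []"
    using cop_halves[of "map ((+) (wmax a)) b" "wmax a" "hat x" a] that
    by (simp add: lookup_add lookup_Delta_prec[OF assms] lookup_Delta_succ[OF assms])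
  show "packed a \<and> a \<noteq> [] \<and> packed b \<and> b \<noteq> []"
    if "Poly_Mapping.lookup (Delta_prec x + Delta_succ x) (a, b) \<noteq> 0"
  proof (cases "Poly_Mapping.lookup (Delta_prec x) (a, b) = 0")
    case True
    then show ?thesis
      using that Delta_succ_nonzero[OF assms, of a b] by (simp add: lookup_add)
  next
    case False
    then show ?thesis
      by (rule Delta_prec_nonzero[OF assms])
  qed
qed

lemma hat_sum_fun: "hat (\<Sum>i\<in>I. fscale (c i) (F i)) = (\<lambda>w. \<Sum>i\<in>I. c i * hat (F i) w)"
  by (rule ext) (rule hat_sum)

lemma last_low_sum:
  "last_low i (\<lambda>w. \<Sum>j\<in>J. c j * F j w) = (\<lambda>w. \<Sum>j\<in>J. c j * last_low i (F j) w)"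
  by (auto simp: last_low_def)

lemma prim_atD: "prim_at i f \<Longrightarrow> low i a \<Longrightarrow> high i b \<Longrightarrow> a \<noteq> [] \<Longrightarrow> b \<noteq> [] \<Longrightarrow> cop i f a b = 0"
  by (simp add: prim_at_def)

lemma Prim_sum_trees:
  assumes "1 \<le> n" "x \<in> Prim n"
  shows "\<exists>c. x = (\<Sum>t\<in>trees n. fscale (c t) (\<OO>_tree t :: word \<Rightarrow>\<^sub>0 'k::field))"
proof -
  have x: "x \<in> WQSym n" "Delta_prec x + Delta_succ x = 0"
    using assms(2) by (auto simp: Prim_def)
  have "x \<in> free.span (\<OO>_forest ` forests n)" "inj_on (\<OO>_forest :: _ \<Rightarrow> word \<Rightarrow>\<^sub>0 'k) (forests n)"
    using forest_basis[of n, where 'k = 'k] x(1) by (auto simp: is_basis_family_def)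
  then obtain c where c: "x = (\<Sum>f\<in>forests n. fscale (c f) (\<OO>_forest f))"
    using in_span_family[OF _ finite_forests] by metis
  have "packed_supp x"
    using x(1) by (simp add: WQSym_iff)
  from iffD1[OF Delta_eq_0_iff[OF this] x(2)]
  have z: "cop (wmax a) (hat x) a (map ((+) (wmax a)) b) = 0"
    if "packed a" "packed b" "a \<noteq> []" "b \<noteq> []" for a b
    using that by blast
  have "c f = 0" if "f \<in> forests n" "f = t # g" "g \<noteq> []" for f t g
  proof (rule forest_coeffs[OF indep_forests _ that])
    fix a b assume "packed a" "packed b" "a \<noteq> []" "b \<noteq> []"
    then show "(\<Sum>f\<in>forests n. c f * cop (wmax a) (hF f) a (map ((+) (wmax a)) b)) = 0"
      using z[of a b] unfolding c hat_sum_fun cop_sum by simp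
  qed
  then have "x = (\<Sum>t\<in>trees n. fscale (c [t]) (\<OO>_forest [t]))"
    unfolding c by (intro sum_forests_trees[OF assms(1)]) (simp add: free.scale_zero_left)
  then show ?thesis
    unfolding hF_single by (rule exI[of _ "\<lambda>t. c [t]"])
qed

lemma TPrim_subset: "TPrim n \<subseteq> Prim n"
  by (auto simp: TPrim_def Prim_def)

text \<open>The vanishing of \<open>Delta_prec\<close> enters through \<open>TPrim_subset\<close>,
  which gives the expansion in trees; that of \<open>Delta_succ\<close> then removes the trees with
  left forest.\<close>

lemma TPrim_sum_roots:
  assumes "1 \<le> n" "x \<in> TPrim n"
  shows "\<exists>c. x = (\<Sum>t\<in>roots n. fscale (c t) (\<OO>_tree t :: word \<Rightarrow>\<^sub>0 'k::field))"
proof -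
  have x: "x \<in> WQSym n" "Delta_succ x = 0"
    using assms(2) by (auto simp: TPrim_def)
  obtain c where c: "x = (\<Sum>t\<in>trees n. fscale (c t) (\<OO>_tree t))"
    using Prim_sum_trees assms TPrim_subset by blast
  have "packed_supp x"
    using x(1) by (simp add: WQSym_iff)
  from iffD1[OF Delta_succ_eq_0_iff[OF this] x(2)]
  have z: "cop (wmax a) (last_high (wmax a) (hat x)) a (map ((+) (wmax a)) b) = 0"
    if "packed a" "packed b" "a \<noteq> []" "b \<noteq> []" for a b
    using that by blast
  have "c t = 0" if "t \<in> trees n" "left_forest t \<noteq> []" for t
  proof (rule tree_coeffs[OF indep_forests _ that])
    fix a b assume "packed a" "packed b" "a \<noteq> []" "b \<noteq> []"
    then show "(\<Sum>t\<in>trees n. c t * cop (wmax a) (last_high (wmax a) (hO t)) a (map ((+) (wmax a)) b)) = 0"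
      using z[of a b] unfolding c hat_sum_fun last_high_sum cop_sum by simp
  qed
  then have "x = (\<Sum>t\<in>roots n. fscale (c t) (\<OO>_tree t))"
    unfolding c by (intro sum_trees_roots) (simp add: free.scale_zero_left)
  then show ?thesis by blast
qed

lemma sum_trees_in_Prim: "(\<Sum>t\<in>trees n. fscale (c t) (\<OO>_tree t :: word \<Rightarrow>\<^sub>0 'k::field)) \<in> Prim n"
proof -
  let ?x = "\<Sum>t\<in>trees n. fscale (c t) (\<OO>_tree t :: word \<Rightarrow>\<^sub>0 'k)"
  have W: "?x \<in> WQSym n"
    by (rule WQSym_sum) (rule tree_in_WQSym)
  then have "packed_supp ?x"
    by (simp add: WQSym_iff)
  then have "Delta_prec ?x + Delta_succ ?x = 0"
    unfolding Delta_eq_0_iff[OF \<open>packed_supp ?x\<close>] hat_sum_fun cop_sum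
    by (auto intro!: sum.neutral prim_atD prim_hO low_packed high_shift simp: trees_def)
  then show ?thesis
    using W by (simp add: Prim_def)
qed

lemma sum_roots_in_TPrim: "(\<Sum>t\<in>roots n. fscale (c t) (\<OO>_tree t :: word \<Rightarrow>\<^sub>0 'k::field)) \<in> TPrim n"
proof -
  let ?x = "\<Sum>t\<in>roots n. fscale (c t) (\<OO>_tree t :: word \<Rightarrow>\<^sub>0 'k)"
  have W: "?x \<in> WQSym n"
    by (rule WQSym_sum) (use tree_in_WQSym roots_subset in blast)
  then have P: "packed_supp ?x"
    by (simp add: WQSym_iff)
  have t: "prim_at i (last_high i (hO t :: word \<Rightarrow> 'k)) \<and> prim_at i (last_low i (hO t :: word \<Rightarrow> 'k))"
    if r: "t \<in> roots n" for t i
  proof -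
    obtain x rs where tx: "t = Node x [] rs"
      using root_eq[OF r] by blast
    have "blue_packed (Node x [] rs)"
      using r by (simp add: tx roots_def)
    then show ?thesis
      unfolding tx tprim_at_def[symmetric] by (rule tprim_hO)
  qed
  have "Delta_succ ?x = 0"
    unfolding Delta_succ_eq_0_iff[OF P] hat_sum_fun last_high_sum cop_sum
    by (auto intro!: sum.neutral prim_atD low_packed high_shift simp: t)
  moreover have "Delta_prec ?x = 0"
    unfolding Delta_prec_eq_0_iff[OF P] hat_sum_fun last_low_sum cop_sum
    by (auto intro!: sum.neutral prim_atD low_packed high_shift simp: t)
  ultimately show ?thesis
    using W by (simp add: TPrim_def)
qed

lemma indep_trees: "indep_fun (hO :: _ \<Rightarrow> word \<Rightarrow> 'k::field) (trees n)"
proof -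
  have "indep_fun (\<lambda>t. hF [t] :: word \<Rightarrow> 'k) (trees n)"
    by (rule indep_fun_image[OF indep_forests finite_forests[of n]]) (auto simp: inj_on_def single_forest)
  then show ?thesis
    by (simp only: hF_single)
qed

lemma tree_basis:
  assumes "1 \<le> n"
  shows "is_basis_family (\<OO>_tree :: _ \<Rightarrow> (word \<Rightarrow>\<^sub>0 'k::field)) (trees n) (Prim n)"
proof -
  note free = free_family[OF indep_trees finite_trees, of n, where 'k = 'k]
  have "free.span (\<OO>_tree ` trees n) = (Prim n :: (word \<Rightarrow>\<^sub>0 'k) set)"
  proof (intro set_eqI iffI)
    fix x :: "word \<Rightarrow>\<^sub>0 'k" assume "x \<in> free.span (\<OO>_tree ` trees n)"
    then obtain c where c: "x = (\<Sum>t\<in>trees n. fscale (c t) (\<OO>_tree t))"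
      unfolding in_span_family[OF free(1) finite_trees] by blast
    show "x \<in> Prim n"
      unfolding c by (rule sum_trees_in_Prim)
  qed (unfold in_span_family[OF free(1) finite_trees], rule Prim_sum_trees[OF assms])
  then show ?thesis
    unfolding is_basis_family_def using free by blast
qed

lemma root_basis:
  assumes "1 \<le> n"
  shows "is_basis_family (\<OO>_tree :: _ \<Rightarrow> (word \<Rightarrow>\<^sub>0 'k::field)) (roots n) (TPrim n)"
proof -
  note free = free_family[OF indep_roots[OF indep_forests] finite_roots, of n, where 'k = 'k]
  have "free.span (\<OO>_tree ` roots n) = (TPrim n :: (word \<Rightarrow>\<^sub>0 'k) set)"
  proof (intro set_eqI iffI)
    fix x :: "word \<Rightarrow>\<^sub>0 'k" assume "x \<in> free.span (\<OO>_tree ` roots n)"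
    then obtain c where c: "x = (\<Sum>t\<in>roots n. fscale (c t) (\<OO>_tree t))"
      unfolding in_span_family[OF free(1) finite_roots] by blast
    show "x \<in> TPrim n"
      unfolding c by (rule sum_roots_in_TPrim)
  qed (unfold in_span_family[OF free(1) finite_roots], rule TPrim_sum_roots[OF assms])
  then show ?thesis
    unfolding is_basis_family_def using free by blast
qed

theorem mainTheorem4:
  fixes n :: nat
  assumes "n \<ge> 1"
  shows "is_basis_family (\<OO>_forest :: label biplane list \<Rightarrow> (word \<Rightarrow>\<^sub>0 'k::field))
           {f. blue_packed_forest f \<and> forest_nodes f = n} (WQSym n)
       \<and> is_basis_family (\<OO>_tree :: label biplane \<Rightarrow> (word \<Rightarrow>\<^sub>0 'k))
           {t. blue_packed t \<and> nodes t = n} (Prim n)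
       \<and> is_basis_family (\<OO>_tree :: label biplane \<Rightarrow> (word \<Rightarrow>\<^sub>0 'k))
           {t. blue_packed t \<and> nodes t = n \<and> left_forest t = []} (TPrim n)"
  using forest_basis tree_basis[OF assms] root_basis[OF assms]
  unfolding forests_def trees_def roots_def by blast

end
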